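(* Let $S$ be a bounded, closed, convex, $d$-dimensional polytope in $\mathbf{R}^d$ and set $\Omega=\mathbf{R}^d\setminus S$, with boundary $\Gamma$. Further let $\{\pi_j\}_{1\le j\le n}$ denote the hyperplanes containing the ($(d-1)$-dimensional) faces of $S$ and $\{\alpha_{jk}\}$ the dihedral angles corresponding to the pairs $\pi_j,\pi_k$ with $j\neq k$. Then there is an $\alpha_c\in(0,\pi)$ such that $$a_0(\Gamma)=b_0(\Gamma)=b_0(\Omega)>2$$ if $\alpha_{jk}<\alpha_c$ for some choice of $j,k$.
   Context: The dihedral angle $\alpha_{jk}$ corresponding to the pair $\pi_j,\pi_k$ is the interior angle, i.e. the angle of the wedge bounded by $\pi_j$ and $\pi_k$ which contains $S$. $d_\Gamma(x)$ is the Euclidean distance from $x\in\Omega$ to $\Gamma$, $\Gamma_r=\{x\in\Omega: d_\Gamma(x)<r\}$ for $r>0$, $\|\cdot\|_2$ is the $L_2$-norm, and $C_c^1(W)$ denotes the $C^1$-functions with compact support in the open set $W$. For an open set $W\subseteq\Omega$ let $a_0(W)$ be the infimum of the $a>0$ such that $\|d_\Gamma^{-1}\psi\|_2\le a\,\|\nabla\psi\|_2$ for all $\psi\in C_c^1(W)$, and let $b_0(W)$ be the infimum of the $b>0$ for which there is a $c>0$ such that $\|d_\Gamma^{-1}\psi\|_2\le b\,\|\nabla\psi\|_2+c\,\|\psi\|_2$ for all $\psi\in C_c^1(W)$. Set $a_0(\Gamma)=\inf_{r>0}a_0(\Gamma_r)$ and $b_0(\Gamma)=\inf_{r>0}b_0(\Gamma_r)$.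 *)

theory Defs
  imports "HOL-Analysis.Analysis"
begin

section \<open>Dihedral angles\<close>

definition wedge :: "'a::euclidean_space set \<Rightarrow> 'a set \<Rightarrow> 'a set \<Rightarrow> 'a set" where
  "wedge S H K = \<Inter> {{x. a \<bullet> x \<le> b} | a b.
     a \<noteq> 0 \<and> S \<subseteq> {x. a \<bullet> x \<le> b} \<and> {x. a \<bullet> x = b} \<in> {H, K}}"

text \<open>
  The angle of the wedge is measured in the plane perpendicular to its edge \<open>H \<inter> K\<close> at a point
  \<open>p\<close>: \<open>u\<close> and \<open>v\<close> are the unit vectors along the two rays in which this plane meets the
  bounding half-hyperplanes. It is a relation rather than a function because two parallel
  hyperplanes do not bound a wedge and therefore have no dihedral angle.
\<close>

definition dihedral_angle ::
    "'a::euclidean_space set \<Rightarrow> 'a set \<Rightarrow> 'a set \<Rightarrow> real \<Rightarrow> bool" where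
  "dihedral_angle S H K \<theta> \<longleftrightarrow> (\<exists>p u v.
     p \<in> H \<inter> K \<and> norm u = 1 \<and> norm v = 1 \<and>
     p + u \<in> H \<inter> wedge S H K \<and> p + v \<in> K \<inter> wedge S H K \<and>
     (\<forall>q \<in> H \<inter> K. u \<bullet> (q - p) = 0 \<and> v \<bullet> (q - p) = 0) \<and>
     \<theta> = arccos (u \<bullet> v))"

section \<open>Hardy constants\<close>

definition gradient :: "('a::euclidean_space \<Rightarrow> real) \<Rightarrow> 'a \<Rightarrow> 'a" where
  "gradient f x = (THE D. GDERIV f x :> D)"

text \<open>Functions on \<open>W\<close> with compact support in \<open>W\<close> are extended by zero to the whole space.\<close>

definition C1_c :: "'a::euclidean_space set \<Rightarrow> ('a \<Rightarrow> real) set" where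
  "C1_c W = {f. (\<forall>x. f differentiable at x) \<and> continuous_on UNIV (gradient f) \<and>
     compact (closure {x. f x \<noteq> 0}) \<and> closure {x. f x \<noteq> 0} \<subseteq> W}"

text \<open>
  Only used for functions that vanish outside \<open>\<Omega>\<close>, for which it is the norm of \<open>L\<^sub>2(\<Omega>)\<close>.
\<close>

definition L2_norm :: "('a::euclidean_space \<Rightarrow> 'b::real_normed_vector) \<Rightarrow> real" where
  "L2_norm f = sqrt (\<integral>x. (norm (f x))\<^sup>2 \<partial>lborel)"

text \<open>
  In the following \<open>\<Omega>\<close> is the ambient domain and \<open>W\<close> an open subset of it; the distance is
  always the one to the boundary of \<open>\<Omega>\<close>. The constants are extended reals, so that the infimum
  over the empty set is \<open>\<infinity>\<close>.
\<close>

definition hardy_a0 :: "'a::euclidean_space set \<Rightarrow> 'a set \<Rightarrow> ereal" where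
  "hardy_a0 \<Omega> W = Inf {ereal a | a. a > 0 \<and>
     (\<forall>\<psi> \<in> C1_c W.
        L2_norm (\<lambda>x. inverse (infdist x (frontier \<Omega>)) * \<psi> x) \<le> a * L2_norm (gradient \<psi>))}"

definition hardy_b0 :: "'a::euclidean_space set \<Rightarrow> 'a set \<Rightarrow> ereal" where
  "hardy_b0 \<Omega> W = Inf {ereal b | b. b > 0 \<and>
     (\<exists>c>0. \<forall>\<psi> \<in> C1_c W.
        L2_norm (\<lambda>x. inverse (infdist x (frontier \<Omega>)) * \<psi> x)
          \<le> b * L2_norm (gradient \<psi>) + c * L2_norm \<psi>)}"

definition boundary_layer :: "'a::euclidean_space set \<Rightarrow> real \<Rightarrow> 'a set" where
  "boundary_layer \<Omega> r = {x \<in> \<Omega>. infdist x (frontier \<Omega>) < r}"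

definition hardy_a0_boundary :: "'a::euclidean_space set \<Rightarrow> ereal" where
  "hardy_a0_boundary \<Omega> = (INF r\<in>{0<..}. hardy_a0 \<Omega> (boundary_layer \<Omega> r))"

definition hardy_b0_boundary :: "'a::euclidean_space set \<Rightarrow> ereal" where
  "hardy_b0_boundary \<Omega> = (INF r\<in>{0<..}. hardy_b0 \<Omega> (boundary_layer \<Omega> r))"

end

theory Submission
  imports Defs
begin

text \<open>
  For a closed convex body the three constants always coincide. Since the squared distance to \<open>S\<close> is
  \<open>C\<^sup>1\<close>, there is a cutoff equal to one up to an error of order \<open>d\<close>, and this localises \<open>b\<^sub>0\<close> to any
  boundary layer; on the layer of width \<open>s\<close> the term \<open>c \<parallel>\<psi>\<parallel>\<close> is at most \<open>c s \<parallel>d\<^sup>-\<^sup>1 \<psi>\<parallel>\<close>, hence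
  absorbed as \<open>s\<close> tends to zero.

  At an edge with a small angle the complement of \<open>S\<close> is almost the complement of a half-hyperplane,
  and the distance to \<open>S\<close> is at most the distance to that half-hyperplane. With polar coordinates
  \<open>(\<rho>, \<phi>)\<close> in the plane perpendicular to the edge, \<open>y = cos\<^sup>2 (\<phi> / 2)\<close> and \<open>z\<close> along the edge, the
  function \<open>y\<^sup>1\<^sup>/\<^sup>4\<close> is a strict subsolution of the Euler equation of the Hardy inequality with constant
  \<open>2\<close>. The test function is \<open>y\<^sup>1\<^sup>/\<^sup>4 (ln y + 100 + 2 y)\<^sub>+\<^sup>2\<close> times cutoffs in \<open>ln \<rho>\<close> and \<open>|z|\<close>. Its energy
  is estimated pointwise up to the divergence of a compactly supported field with a tangential, a radial
  and a longitudinal part, so no change of variables in the integrals is needed.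
\<close>

section \<open>Functions with a continuous gradient\<close>

text \<open>Put W = 1/y + 1 + y and s = rho^2. The squared distance to the half-hyperplane is s for
  y >= 1/2 and 4 s y (1 - y) for y < 1/2, in both cases at most 4 s / W. So the weight 1 / (4 d^2)
  belonging to the constant 2 is at least W / (16 s). On functions of y, s times the Laplacian is L
  f = y (1 - y) f'' + (1/2 - y) f'. With this rational weight the two leading terms of L f + W f /
  16 cancel for f = y^(1/4) and y^(5/4) / 16 > 0 remains, which is the strictness that beats 2. The
  power 1/4 is borderline: its energy diverges logarithmically at the half-hyperplane, hence a slow
  cutoff in ln y; likewise the weight 1/s calls for a cutoff in ln rho. After the angular cutoff a
  gain of 1/6400 is left. It has to cover 12/250000 for the radial cutoff, 1/20000 for the
  longitudinal one and 1/20000 for lowering 1/4 to a smaller factor. All of this is invariant under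
  scaling about a point of the edge, so the gain is the same in every boundary layer and survives
  the infimum over r.\<close>

definition has_gradient_on :: "('a::euclidean_space \<Rightarrow> real) \<Rightarrow> ('a \<Rightarrow> 'a) \<Rightarrow> 'a set \<Rightarrow> bool" where
  "has_gradient_on f g U \<longleftrightarrow> (\<forall>x\<in>U. GDERIV f x :> g x) \<and> continuous_on U g"

lemma GDERIV_unique:
  assumes "GDERIV f x :> D" "GDERIV f x :> E"
  shows "D = E"
proof -
  have "(\<lambda>h. h \<bullet> D) = (\<lambda>h. h \<bullet> E)"
    using assms unfolding gderiv_def by (rule has_derivative_unique)
  then have "\<And>h. h \<bullet> D = h \<bullet> E"
    by (rule fun_cong)
  then show ?thesis
    using vector_eq_ldot by blast
qed

lemma gradient_eqI: "GDERIV f x :> D \<Longrightarrow> gradient f x = D"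
  unfolding gradient_def by (rule the_equality, assumption) (rule GDERIV_unique)

lemma differentiable_imp_GDERIV:
  fixes f :: "'a::euclidean_space \<Rightarrow> real"
  assumes "f differentiable at x"
  shows "GDERIV f x :> gradient f x"
proof -
  obtain L where L: "(f has_derivative L) (at x)"
    using assms unfolding differentiable_def by blast
  then have "linear L"
    by (rule has_derivative_linear)
  define v where "v = (\<Sum>b\<in>Basis. L b *\<^sub>R b)"
  have "L h = h \<bullet> v" for h
  proof -
    have "L (\<Sum>b\<in>Basis. (h \<bullet> b) *\<^sub>R b) = h \<bullet> v"
      unfolding v_def using \<open>linear L\<close> by (simp add: linear_sum linear_scale inner_sum_right mult.commute)
    then show ?thesis
      by (simp add: euclidean_representation)
  qed
  then have "L = (\<lambda>h. h \<bullet> v)"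
    by (rule ext)
  then have *: "GDERIV f x :> v"
    using L unfolding gderiv_def by simp
  then show ?thesis
    by (simp only: gradient_eqI[OF *])
qed

lemma has_gradient_on_subset:
  "has_gradient_on f g U \<Longrightarrow> V \<subseteq> U \<Longrightarrow> has_gradient_on f g V"
  unfolding has_gradient_on_def using continuous_on_subset by blast

lemma has_gradient_on_continuous:
  "has_gradient_on f g U \<Longrightarrow> continuous_on U f"
  unfolding has_gradient_on_def gderiv_def
  by (meson continuous_at_imp_continuous_on has_derivative_continuous)

lemma has_gradient_on_mult:
  assumes "has_gradient_on f f' U" "has_gradient_on g g' U"
  shows "has_gradient_on (\<lambda>x. f x * g x) (\<lambda>x. f x *\<^sub>R g' x + g x *\<^sub>R f' x) U"
  unfolding has_gradient_on_def
proof (intro conjI ballI)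
  fix x assume "x \<in> U"
  then show "GDERIV (\<lambda>x. f x * g x) x :> f x *\<^sub>R g' x + g x *\<^sub>R f' x"
    using assms unfolding has_gradient_on_def by (intro GDERIV_mult) auto
next
  show "continuous_on U (\<lambda>x. f x *\<^sub>R g' x + g x *\<^sub>R f' x)"
    using assms has_gradient_on_continuous[OF assms(1)] has_gradient_on_continuous[OF assms(2)]
    unfolding has_gradient_on_def by (intro continuous_intros) auto
qed

lemma has_gradient_on_compose:
  assumes f: "has_gradient_on f f' U"
    and g: "\<And>t. t \<in> T \<Longrightarrow> (g has_real_derivative g' t) (at t)" "continuous_on T g'"
    and T: "f ` U \<subseteq> T"
  shows "has_gradient_on (\<lambda>x. g (f x)) (\<lambda>x. g' (f x) *\<^sub>R f' x) U"
proof -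
  have cont: "continuous_on U (\<lambda>x. g' (f x))"
    using continuous_on_compose2[OF g(2) has_gradient_on_continuous[OF f] T] .
  show ?thesis
    unfolding has_gradient_on_def
  proof (intro conjI ballI)
    fix x assume "x \<in> U"
    then have "GDERIV f x :> f' x" "f x \<in> T"
      using f T unfolding has_gradient_on_def by auto
    then show "GDERIV (\<lambda>x. g (f x)) x :> g' (f x) *\<^sub>R f' x"
      using GDERIV_DERIV_compose[OF _ g(1)] by metis
  next
    show "continuous_on U (\<lambda>x. g' (f x) *\<^sub>R f' x)"
      using cont f unfolding has_gradient_on_def by (intro continuous_on_scaleR) auto
  qed
qed

text \<open>The complement of \<open>K\<close> is open and \<open>f\<close> is zero on it, so the
  gradient is zero there, even at points of \<open>U\<close>. Hence \<open>f'\<close> and 0 agree on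
  the overlap of \<open>U\<close> and the complement of \<open>K\<close> and glue to a continuous
  field.\<close>

lemma has_gradient_on_extend:
  assumes f: "has_gradient_on f f' U" and U: "open U"
    and K: "closed K" "K \<subseteq> U" and z: "\<And>x. x \<notin> K \<Longrightarrow> f x = 0"
  shows "has_gradient_on f (\<lambda>x. if x \<in> U then f' x else 0) UNIV"
    and "\<And>x. x \<notin> K \<Longrightarrow> (if x \<in> U then f' x else 0) = 0"
proof -
  have out: "GDERIV f x :> 0" if "x \<notin> K" for x
  proof -
    have "GDERIV (\<lambda>x. 0) x :> (0::'a)"
      by (rule GDERIV_const)
    then have "((\<lambda>x. 0) has_derivative (\<lambda>h. h \<bullet> 0)) (at x)"
      unfolding gderiv_def .
    then show ?thesis
      unfolding gderiv_def
      by (rule has_derivative_transform_within_open[where s = "-K"]) (use that K(1) z in auto)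
  qed
  show zero: "(if x \<in> U then f' x else 0) = 0" if "x \<notin> K" for x
  proof (cases "x \<in> U")
    case True
    then have "GDERIV f x :> f' x"
      using f unfolding has_gradient_on_def by simp
    then show ?thesis
      using GDERIV_unique[OF out[OF that]] by simp
  qed simp
  have "continuous_on (U \<union> - K) (\<lambda>x. if x \<in> U then f' x else 0)"
  proof (rule continuous_on_open_Un)
    show "continuous_on U (\<lambda>x. if x \<in> U then f' x else 0)"
      using f unfolding has_gradient_on_def by (auto cong: continuous_on_cong)
    show "continuous_on (- K) (\<lambda>x. if x \<in> U then f' x else 0)"
      using zero by (subst continuous_on_cong[OF refl, where g = "\<lambda>x. 0"]) auto
  qed (use U K in auto)
  moreover have "U \<union> - K = UNIV"
    using K by auto
  moreover have "GDERIV f x :> (if x \<in> U then f' x else 0)" for x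
  proof (cases "x \<in> U")
    case True
    then show ?thesis
      using f unfolding has_gradient_on_def by simp
  next
    case False
    then have "x \<notin> K"
      using K(2) by blast
    then show ?thesis
      using out False by simp
  qed
  ultimately show "has_gradient_on f (\<lambda>x. if x \<in> U then f' x else 0) UNIV"
    unfolding has_gradient_on_def by auto
qed

lemma C1_cD:
  assumes "f \<in> C1_c W"
  shows "has_gradient_on f (gradient f) UNIV" "compact (closure {x. f x \<noteq> 0})"
    "closure {x. f x \<noteq> 0} \<subseteq> W"
  using assms differentiable_imp_GDERIV unfolding C1_c_def has_gradient_on_def by auto

text \<open>\<open>C1_c\<close> asks for differentiability on the whole space, whereas formulas in
  polar coordinates are only differentiable away from a half-hyperplane. A compact \<open>K\<close>
  inside the good set \<open>U\<close> bridges the two.\<close>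

lemma C1_cI:
  assumes f: "has_gradient_on f f' U" and "open U" "compact K" "K \<subseteq> U" "K \<subseteq> W"
    and z: "\<And>x. x \<notin> K \<Longrightarrow> f x = 0"
  shows "f \<in> C1_c W" "\<And>x. x \<in> U \<Longrightarrow> gradient f x = f' x"
proof -
  note ext = has_gradient_on_extend[OF f \<open>open U\<close> compact_imp_closed[OF \<open>compact K\<close>] \<open>K \<subseteq> U\<close> z]
  have eq: "gradient f x = (if x \<in> U then f' x else 0)" for x
    by (rule gradient_eqI) (use ext(1) in \<open>simp add: has_gradient_on_def\<close>)
  have "closure {x. f x \<noteq> 0} \<subseteq> K"
    using z compact_imp_closed[OF \<open>compact K\<close>] by (intro closure_minimal) auto
  moreover from this have "compact (closure {x. f x \<noteq> 0})"
    using \<open>compact K\<close> by (meson bounded_subset closed_closure compact_eq_bounded_closed)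
  moreover have "f differentiable at x" for x
    using ext(1) unfolding has_gradient_on_def gderiv_def differentiable_def by auto
  moreover have "gradient f = (\<lambda>x. if x \<in> U then f' x else 0)"
    using eq by auto
  ultimately show "f \<in> C1_c W"
    using \<open>K \<subseteq> W\<close> ext(1) order_trans unfolding C1_c_def has_gradient_on_def by auto
  show "gradient f x = f' x" if "x \<in> U" for x
    using eq that by simp
qed

section \<open>The divergence theorem for compactly supported fields\<close>

lemma integrable_compact_support:
  fixes f :: "'a::euclidean_space \<Rightarrow> real"
  assumes "continuous_on UNIV f" "compact K" "\<And>x. x \<notin> K \<Longrightarrow> f x = 0"
  shows "integrable lborel f"
proof -
  have "integrable lborel (\<lambda>x. indicator K x *\<^sub>R f x)"
    using assms continuous_on_subset by (intro borel_integrable_compact) blast+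
  also have "(\<lambda>x. indicator K x *\<^sub>R f x) = f"
    using assms(3) by (auto simp: indicator_def fun_eq_iff)
  finally show ?thesis .
qed

text \<open>Difference quotients have integral zero by translation invariance of Lebesgue measure.
  The mean value theorem bounds them uniformly, so dominated convergence passes to the
  derivative.\<close>

lemma integral_directional_derivative:
  fixes f :: "'a::euclidean_space \<Rightarrow> real"
  assumes D: "\<And>x. (f has_derivative D x) (at x)" and cont: "continuous_on UNIV (\<lambda>x. D x b)"
    and K: "compact K" and z: "\<And>x. x \<notin> K \<Longrightarrow> f x = 0"
  shows "integral\<^sup>L lborel (\<lambda>x. D x b) = 0"
proof -
  have Dz: "D x b = 0" if "x \<notin> K" for x
  proof -
    have "((\<lambda>x. 0) has_derivative D x) (at x)"
      using that compact_imp_closed[OF K] z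
      by (intro has_derivative_transform_within_open[OF D, where s = "-K"]) auto
    then have "D x = (\<lambda>h. 0)"
      using has_derivative_const has_derivative_unique by blast
    then show ?thesis by simp
  qed
  have "bounded ((\<lambda>x. D x b) ` K)"
    using cont K by (meson compact_continuous_image compact_imp_bounded continuous_on_subset subset_UNIV)
  then obtain M0 where M0: "\<And>x. x \<in> K \<Longrightarrow> \<bar>D x b\<bar> \<le> M0"
    unfolding bounded_iff by auto
  define M where "M = \<bar>M0\<bar>"
  have M: "\<bar>D x b\<bar> \<le> M" for x
    using M0[of x] Dz[of x] unfolding M_def by (cases "x \<in> K") auto
  define s where "s n x = (f (x + (1 / Suc n) *\<^sub>R b) - f x) * Suc n" for n :: nat and x
  \<comment> \<open>The increments \<open>1 / Suc n\<close> are at most 1, so every difference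
    quotient vanishes outside this neighbourhood of \<open>K\<close>.\<close>
  define K' where "K' = {x + y |x y. x \<in> K \<and> y \<in> cball 0 (norm b)}"
  have K': "compact K'"
    unfolding K'_def using K by (intro compact_sums) auto
  have fcont: "continuous_on UNIV f"
    using D by (meson continuous_at_imp_continuous_on has_derivative_continuous)
  then have fcont': "continuous_on UNIV (\<lambda>x. f (x + c))" for c
    by (intro continuous_on_compose2[OF fcont] continuous_intros) auto
  have meas: "s n \<in> borel_measurable lborel" for n
    unfolding s_def measurable_lborel2
    by (intro borel_measurable_continuous_onI continuous_intros fcont fcont')
  have shift: "integral\<^sup>L lborel (\<lambda>x. f (x + c)) = integral\<^sup>L lborel f" for c
  proof -
    have "integral\<^sup>L lborel f = integral\<^sup>L (distr lborel borel ((+) c)) f"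
      by (simp add: lborel_distr_plus)
    also have "\<dots> = integral\<^sup>L lborel (\<lambda>x. f (c + x))"
      by (rule integral_distr) (use fcont borel_measurable_continuous_onI in auto)
    finally show ?thesis by (simp add: add.commute)
  qed
  have line: "((\<lambda>t. f (x + t *\<^sub>R b)) has_real_derivative D (x + t *\<^sub>R b) b) (at t)" for x t
  proof -
    have "((\<lambda>t. x + t *\<^sub>R b) has_derivative (\<lambda>u. u *\<^sub>R b)) (at t)"
      by (auto intro!: derivative_eq_intros)
    from has_derivative_compose[OF this, OF D]
    have "((\<lambda>t. f (x + t *\<^sub>R b)) has_derivative (\<lambda>u. D (x + t *\<^sub>R b) (u *\<^sub>R b))) (at t)" .
    moreover have "D y (u *\<^sub>R b) = D y b * u" for y u
      using linear_scale[OF has_derivative_linear[OF D[of y]]] by simp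
    ultimately show ?thesis
      unfolding has_field_derivative_def by simp
  qed
  have int: "integrable lborel f"
    by (rule integrable_compact_support[OF fcont K z])
  have int': "integrable lborel (\<lambda>x. f (x + c))" for c
  proof (rule integrable_compact_support[OF fcont' compact_translation[OF K, of "-c"]])
    fix x assume "x \<notin> (+) (- c) ` K"
    then have "x + c \<notin> K"
      by (metis add.commute add_uminus_conv_diff diff_add_cancel image_eqI)
    then show "f (x + c) = 0"
      by (rule z)
  qed
  have "integral\<^sup>L lborel (s n) = 0" for n
    unfolding s_def using int int' shift by simp
  moreover have "(\<lambda>n. integral\<^sup>L lborel (s n)) \<longlonglongrightarrow> integral\<^sup>L lborel (\<lambda>x. D x b)"
  proof (rule integral_dominated_convergence[where w = "\<lambda>x. indicator K' x *\<^sub>R M"])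
    show "(\<lambda>x. D x b) \<in> borel_measurable lborel"
      unfolding measurable_lborel2 using cont by (rule borel_measurable_continuous_onI)
    show "integrable lborel (\<lambda>x. indicator K' x *\<^sub>R M)"
      using borel_integrable_compact[OF K', of "\<lambda>x. M"] by simp
    show "AE x in lborel. (\<lambda>n. s n x) \<longlonglongrightarrow> D x b"
    proof (rule AE_I2)
      fix x
      have "((\<lambda>t. f (x + t *\<^sub>R b)) has_real_derivative D x b) (at 0)"
        using line[of x 0] by simp
      then have lim: "((\<lambda>t. (f (x + t *\<^sub>R b) - f x) / t) \<longlongrightarrow> D x b) (at 0)"
        unfolding DERIV_def by simp
      have "filterlim (\<lambda>n. 1 / real (Suc n)) (at 0) sequentially"
        unfolding filterlim_at using LIMSEQ_inverse_real_of_nat by (auto simp: inverse_eq_divide)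
      from filterlim_compose[OF lim this] show "(\<lambda>n. s n x) \<longlonglongrightarrow> D x b"
        unfolding s_def by simp
    qed
    fix n
    show "AE x in lborel. norm (s n x) \<le> indicator K' x *\<^sub>R M"
    proof (rule AE_I2)
      fix x
      show "norm (s n x) \<le> indicator K' x *\<^sub>R M"
      proof (cases "x \<in> K'")
        case True
        define h where "h = 1 / real (Suc n)"
        have h: "h > 0" unfolding h_def by simp
        obtain \<xi> where "f (x + h *\<^sub>R b) - f (x + 0 *\<^sub>R b) = (h - 0) * D (x + \<xi> *\<^sub>R b) b"
          using MVT2[OF h, of "\<lambda>t. f (x + t *\<^sub>R b)" "\<lambda>t. D (x + t *\<^sub>R b) b", OF line] by auto
        then have "s n x = D (x + \<xi> *\<^sub>R b) b"
          unfolding s_def h_def by (simp add: field_simps)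
        then show ?thesis
          using True M by simp
      next
        case False
        have "x \<notin> K"
        proof
          assume "x \<in> K"
          then have "x \<in> K'"
            unfolding K'_def mem_Collect_eq by (intro exI[of _ x] exI[of _ 0]) simp
          then show False using False by simp
        qed
        moreover have "x + (1 / Suc n) *\<^sub>R b \<notin> K"
        proof
          assume a: "x + (1 / Suc n) *\<^sub>R b \<in> K"
          have "- ((1 / Suc n) *\<^sub>R b) \<in> cball 0 (norm b)"
            by (auto simp: divide_simps mult_le_cancel_right1 field_simps)
          then have "x \<in> K'"
            unfolding K'_def mem_Collect_eq using a
            by (intro exI[of _ "x + (1 / Suc n) *\<^sub>R b"] exI[of _ "- ((1 / Suc n) *\<^sub>R b)"]) simp
          then show False using False by simp
        qed
        ultimately show ?thesis
          using z False unfolding s_def by simp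
      qed
    qed
  qed (use meas in auto)
  ultimately show ?thesis
    using LIMSEQ_unique[of "\<lambda>n. 0" 0] by simp
qed

text \<open>Only the scalar factor has compact support. The vector factor can therefore be a
  globally defined polynomial field, and all singular coefficients go into \<open>w\<close>.\<close>

lemma integral_divergence:
  fixes w :: "'a::euclidean_space \<Rightarrow> real" and V :: "'a \<Rightarrow> 'a"
  assumes w: "has_gradient_on w w' UNIV" and K: "compact K" and z: "\<And>x. x \<notin> K \<Longrightarrow> w x = 0"
    and V: "\<And>x. (V has_derivative V' x) (at x)"
    and div: "\<And>x. (\<Sum>b\<in>Basis. V' x b \<bullet> b) = d x" and V'c: "\<And>b. continuous_on UNIV (\<lambda>x. V' x b)"
  shows "integrable lborel (\<lambda>x. w' x \<bullet> V x + w x * d x)"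
    "integral\<^sup>L lborel (\<lambda>x. w' x \<bullet> V x + w x * d x) = 0"
proof -
  define D where "D b x h = (h \<bullet> w' x) * (V x \<bullet> b) + w x * (V' x h \<bullet> b)" for b x h
  have wd: "(w has_derivative (\<lambda>h. h \<bullet> w' x)) (at x)" for x
    using w unfolding has_gradient_on_def gderiv_def by auto
  have Vb: "((\<lambda>x. V x \<bullet> b) has_derivative (\<lambda>h. V' x h \<bullet> b)) (at x)" for b x
    by (rule has_derivative_inner_left[OF V])
  have D: "((\<lambda>x. w x * (V x \<bullet> b)) has_derivative D b x) (at x)" for b x
    using has_derivative_mult[OF wd Vb] unfolding D_def by (simp add: algebra_simps)
  have Vc: "continuous_on UNIV V"
    using V by (meson continuous_at_imp_continuous_on has_derivative_continuous)
  have c: "continuous_on UNIV (\<lambda>x. D b x b)" for b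
    unfolding D_def using w has_gradient_on_continuous[OF w] Vc V'c unfolding has_gradient_on_def
    by (intro continuous_intros) auto
  have Dz: "D b x b = 0" if "x \<notin> K" for b x
  proof -
    have "GDERIV w x :> 0"
      unfolding gderiv_def
      by (rule has_derivative_transform_within_open[where s = "-K" and f = "\<lambda>x. 0"])
        (use that z compact_imp_closed[OF K] in auto)
    then have "w' x = 0"
      using w GDERIV_unique[of w x 0 "w' x"] unfolding has_gradient_on_def by simp
    then show ?thesis
      using z[OF that] unfolding D_def by simp
  qed
  have int: "integrable lborel (\<lambda>x. D b x b)" for b
    by (rule integrable_compact_support[OF c K Dz])
  have "integral\<^sup>L lborel (\<lambda>x. D b x b) = 0" for b
    by (rule integral_directional_derivative[OF D c K]) (use z in auto)
  then have "integral\<^sup>L lborel (\<lambda>x. \<Sum>b\<in>Basis. D b x b) = 0"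
    using int by (subst Bochner_Integration.integral_sum) auto
  moreover have eq: "(\<Sum>b\<in>Basis. D b x b) = w' x \<bullet> V x + w x * d x" for x
    unfolding D_def sum.distrib sum_distrib_left[symmetric] div
    by (subst (2) euclidean_inner) (simp add: inner_commute)
  ultimately show "integral\<^sup>L lborel (\<lambda>x. w' x \<bullet> V x + w x * d x) = 0"
    by simp
  have "integrable lborel (\<lambda>x. \<Sum>b\<in>Basis. D b x b)"
    using int by auto
  then show "integrable lborel (\<lambda>x. w' x \<bullet> V x + w x * d x)"
    using eq by simp
qed

section \<open>Profiles of the test function\<close>

text \<open>From the exponent 2 on, the kink of the positive part disappears: at zero the difference
  quotient is at most \<open>\<bar>h\<bar> ^ Suc n\<close>.\<close>

lemma max0_power_has_derivative:
  assumes "(g has_real_derivative g') (at t)"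
  shows "((\<lambda>t. max 0 (g t) ^ Suc (Suc n)) has_real_derivative
    real (Suc (Suc n)) * max 0 (g t) ^ Suc n * g') (at t)"
proof -
  define u where "u = g t"
  have "((\<lambda>u::real. max 0 u ^ Suc (Suc n)) has_real_derivative
    real (Suc (Suc n)) * max 0 u ^ Suc n) (at u)"
  proof (cases "u = 0")
    case False
    show ?thesis
    proof (cases "u > 0")
      case True
      have "((\<lambda>u::real. u ^ Suc (Suc n)) has_real_derivative
        real (Suc (Suc n)) * u ^ Suc n) (at u)"
        using DERIV_pow[of "Suc (Suc n)" u] by (simp del: power_Suc)
      then have "((\<lambda>u::real. max 0 u ^ Suc (Suc n)) has_real_derivative
        real (Suc (Suc n)) * u ^ Suc n) (at u)"
        by (rule has_field_derivative_transform_within_open[where S = "{0<..}"]) (use True in auto)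
      then show ?thesis using True by simp
    next
      case neg: False
      have "((\<lambda>u::real. 0) has_real_derivative 0) (at u)"
        by simp
      then have "((\<lambda>u::real. max 0 u ^ Suc (Suc n)) has_real_derivative 0) (at u)"
        by (rule has_field_derivative_transform_within_open[where S = "{..<0}"]) (use neg False in auto)
      then show ?thesis using neg by simp
    qed
  next
    case True
    have "((\<lambda>h::real. (max 0 h ^ Suc (Suc n)) / h) \<longlongrightarrow> 0) (at 0)"
    proof (rule Lim_null_comparison)
      show "\<forall>\<^sub>F h::real in at 0. norm (max 0 h ^ Suc (Suc n) / h) \<le> \<bar>h\<bar> ^ Suc n"
      proof (intro always_eventually allI)
        fix h :: real
        show "norm (max 0 h ^ Suc (Suc n) / h) \<le> \<bar>h\<bar> ^ Suc n"
        proof (cases "h > 0")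
          case False
          then have "max 0 h = 0"
            by simp
          then show ?thesis
            by (simp only: power_0_Suc div_0 norm_zero zero_le_power_abs)
        qed (simp add: max_def)
      qed
      have "((\<lambda>h::real. \<bar>h\<bar> ^ Suc n) \<longlongrightarrow> \<bar>0\<bar> ^ Suc n) (at 0)"
        by (intro tendsto_intros)
      then show "((\<lambda>h::real. \<bar>h\<bar> ^ Suc n) \<longlongrightarrow> 0) (at 0)"
        by simp
    qed
    then show ?thesis
      unfolding DERIV_def True by simp
  qed
  from DERIV_chain2[OF this[unfolded u_def] assms] show ?thesis .
qed

lemma max0_power_has_derivative_numeral:
  assumes "(g has_real_derivative g') (at t)"
  shows "((\<lambda>t. (max 0 (g t))\<^sup>2) has_real_derivative 2 * max 0 (g t) * g') (at t)"
    and "((\<lambda>t. max 0 (g t) ^ 3) has_real_derivative 3 * (max 0 (g t))\<^sup>2 * g') (at t)"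
    and "((\<lambda>t. max 0 (g t) ^ 4) has_real_derivative 4 * max 0 (g t) ^ 3 * g') (at t)"
  using max0_power_has_derivative[OF assms, of 0] max0_power_has_derivative[OF assms, of 1]
    max0_power_has_derivative[OF assms, of 2]
  by (simp_all add: numeral_eq_Suc)

text \<open>The summand \<open>2 * y\<close> makes the term linear in \<open>ell\<close> in
  \<open>ell_sq_le\<close> positive for y < 1/2. The summand 100 makes \<open>ell\<close> large
  enough for y > 1/2 to absorb that term where it is negative. On (0, 1] the function vanishes up to
  \<open>exp (- 102)\<close>, the source of all later occurrences of 102.\<close>

definition ell :: "real \<Rightarrow> real" where
  "ell y = max 0 (ln y + 100 + 2 * y)"

text \<open>The case distinction makes \<open>gam\<close> vanish at \<open>0\<close>, where \<open>ln\<close> has the junk value \<open>0\<close>.\<close>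

definition gam :: "real \<Rightarrow> real" where
  "gam t = (if t \<le> 0 then 0 else max 0 (1 - (ln t)\<^sup>2 / 250000))"

lemma ell_derivs:
  assumes "y > 0"
  shows "((\<lambda>y. (ell y)\<^sup>2) has_real_derivative 2 * ell y * (1 / y + 2)) (at y)"
    and "((\<lambda>y. ell y ^ 3) has_real_derivative 3 * (ell y)\<^sup>2 * (1 / y + 2)) (at y)"
    and "((\<lambda>y. ell y ^ 4) has_real_derivative 4 * ell y ^ 3 * (1 / y + 2)) (at y)"
proof -
  have "((\<lambda>y. ln y + 100 + 2 * y) has_real_derivative (1 / y + 2)) (at y)"
    using assms by (auto intro!: derivative_eq_intros)
  note * = max0_power_has_derivative_numeral[OF this]
  show "((\<lambda>y. (ell y)\<^sup>2) has_real_derivative 2 * ell y * (1 / y + 2)) (at y)"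
    "((\<lambda>y. ell y ^ 3) has_real_derivative 3 * (ell y)\<^sup>2 * (1 / y + 2)) (at y)"
    "((\<lambda>y. ell y ^ 4) has_real_derivative 4 * ell y ^ 3 * (1 / y + 2)) (at y)"
    using * unfolding ell_def by simp_all
qed

lemma gam_derivs:
  assumes "t > 0"
  shows "((\<lambda>t. (gam t)\<^sup>2) has_real_derivative 2 * gam t * (- ln t / (125000 * t))) (at t)"
    and "((\<lambda>t. gam t ^ 3) has_real_derivative 3 * (gam t)\<^sup>2 * (- ln t / (125000 * t))) (at t)"
    and "((\<lambda>t. gam t ^ 4) has_real_derivative 4 * gam t ^ 3 * (- ln t / (125000 * t))) (at t)"
proof -
  have "((\<lambda>t. 1 - (ln t)\<^sup>2 / 250000) has_real_derivative (- ln t / (125000 * t))) (at t)"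
    using assms by (auto intro!: derivative_eq_intros simp: field_simps)
  note * = max0_power_has_derivative_numeral[OF this]
  have g: "gam t = max 0 (1 - (ln t)\<^sup>2 / 250000)" if "t \<in> {0<..}" for t
    using that unfolding gam_def by auto
  have gt: "gam t = max 0 (1 - (ln t)\<^sup>2 / 250000)"
    using g assms by simp
  show "((\<lambda>t. (gam t)\<^sup>2) has_real_derivative 2 * gam t * (- ln t / (125000 * t))) (at t)"
    unfolding gt by (rule has_field_derivative_transform_within_open[OF *(1), where S = "{0<..}"])
      (use assms g in auto)
  show "((\<lambda>t. gam t ^ 3) has_real_derivative 3 * (gam t)\<^sup>2 * (- ln t / (125000 * t))) (at t)"
    unfolding gt by (rule has_field_derivative_transform_within_open[OF *(2), where S = "{0<..}"])
      (use assms g in auto)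
  show "((\<lambda>t. gam t ^ 4) has_real_derivative 4 * gam t ^ 3 * (- ln t / (125000 * t))) (at t)"
    unfolding gt by (rule has_field_derivative_transform_within_open[OF *(3), where S = "{0<..}"])
      (use assms g in auto)
qed

lemma continuous_on_ell: "continuous_on {0<..} ell"
  unfolding ell_def by (intro continuous_intros) auto

lemma continuous_on_gam: "continuous_on {0<..} gam"
proof -
  have "continuous_on {0<..} (\<lambda>t::real. max 0 (1 - (ln t)\<^sup>2 / 250000))"
    by (intro continuous_intros) auto
  then show ?thesis
    by (rule continuous_on_eq) (auto simp: gam_def)
qed

section \<open>The angular profile\<close>

definition theta :: "real \<Rightarrow> real" where
  "theta y = sqrt (sqrt y) * (ell y)\<^sup>2"

definition theta' :: "real \<Rightarrow> real" where
  "theta' y = sqrt (sqrt y) * ((ell y)\<^sup>2 / (4 * y) + 2 * ell y * (1 / y + 2))"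

text \<open>\<open>nu\<close> is \<open>theta * theta'\<close> on the positive half-line.\<close>

definition nu :: "real \<Rightarrow> real" where
  "nu y = ell y ^ 3 * (ell y / 4 + 2 + 4 * y) / sqrt y"

definition nu' :: "real \<Rightarrow> real" where
  "nu' y = (3 * (ell y)\<^sup>2 * (1 / y + 2) * (ell y / 4 + 2 + 4 * y) + ell y ^ 3 * ((1 / y + 2) / 4 + 4)) / sqrt y
     - ell y ^ 3 * (ell y / 4 + 2 + 4 * y) / (2 * y * sqrt y)"

lemma theta_deriv:
  assumes "y > 0"
  shows "(theta has_real_derivative theta' y) (at y)"
proof -
  \<comment> \<open>As a power of this \<open>r\<close>, both nested roots become polynomial and the
    claim is field arithmetic.\<close>
  define r where "r = sqrt (sqrt y)"
  have r: "r > 0" "sqrt y = r\<^sup>2" "y = r ^ 4"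
    using assms power_mult[of r 2 2] unfolding r_def by auto
  have "((\<lambda>y. sqrt (sqrt y)) has_real_derivative sqrt (sqrt y) / (4 * y)) (at y)"
    using assms r(1) unfolding r_def[symmetric]
    by (auto intro!: derivative_eq_intros simp: r_def[symmetric] r(2)) (simp add: r(3) field_simps power_numeral_reduce)
  from DERIV_mult[OF this ell_derivs(1)[OF assms]] show ?thesis
    unfolding theta_def[abs_def] theta'_def by (simp add: algebra_simps)
qed

lemma theta_sq: "y > 0 \<Longrightarrow> (theta y)\<^sup>2 = sqrt y * ell y ^ 4"
  unfolding theta_def by (simp add: power_mult_distrib)

text \<open>\<open>theta'\<close> has a kink where \<open>ell\<close> reaches zero, so
  \<open>theta\<close> has no second derivative there. The product \<open>theta * theta'\<close>
  carries a factor \<open>ell ^ 3\<close> and is still differentiable, which is why the energy is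
  integrated by parts through \<open>nu\<close>.\<close>

lemma nu_deriv:
  assumes "y > 0"
  shows "(nu has_real_derivative nu' y) (at y)"
proof -
  have eq: "nu = (\<lambda>y. (ell y ^ 4 / 4 + ell y ^ 3 * (2 + 4 * y)) / sqrt y)"
    unfolding nu_def by (auto simp: fun_eq_iff algebra_simps power_numeral_reduce)
  have sq: "sqrt y * sqrt y = y" "sqrt y > 0"
    using assms by auto
  have "(nu has_real_derivative ((4 * ell y ^ 3 * (1 / y + 2) / 4 +
      (3 * (ell y)\<^sup>2 * (1 / y + 2) * (2 + 4 * y) + ell y ^ 3 * 4)) * sqrt y
      - (ell y ^ 4 / 4 + ell y ^ 3 * (2 + 4 * y)) * (inverse (sqrt y) / 2)) / (sqrt y * sqrt y)) (at y)"
  proof -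
    have "((\<lambda>y. 2 + 4 * y) has_real_derivative 4) (at y)"
      by (auto intro!: derivative_eq_intros)
    from DERIV_mult[OF ell_derivs(2)[OF assms] this]
    have "((\<lambda>y. ell y ^ 3 * (2 + 4 * y)) has_real_derivative
      3 * (ell y)\<^sup>2 * (1 / y + 2) * (2 + 4 * y) + ell y ^ 3 * 4) (at y)"
      by (simp add: mult.commute)
    note DERIV_add[OF DERIV_cdivide[OF ell_derivs(3)[OF assms], of 4] this]
    from DERIV_divide[OF this DERIV_real_sqrt[OF assms]] show ?thesis
      unfolding eq using assms by simp
  qed
  also have "((4 * ell y ^ 3 * (1 / y + 2) / 4 +
      (3 * (ell y)\<^sup>2 * (1 / y + 2) * (2 + 4 * y) + ell y ^ 3 * 4)) * sqrt y
      - (ell y ^ 4 / 4 + ell y ^ 3 * (2 + 4 * y)) * (inverse (sqrt y) / 2)) / (sqrt y * sqrt y) = nu' y"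
  proof -
    define r where "r = sqrt y"
    have "y = r\<^sup>2" "r > 0"
      using assms unfolding r_def by auto
    then show ?thesis
      unfolding nu'_def r_def[symmetric] \<open>y = r\<^sup>2\<close>
      by (simp add: field_simps power_numeral_reduce)
  qed
  finally show ?thesis .
qed

lemma continuous_on_theta': "continuous_on {0<..} theta'"
  unfolding theta'_def by (intro continuous_intros continuous_on_ell) auto

lemma continuous_on_nu': "continuous_on {0<..} nu'"
  unfolding nu'_def by (intro continuous_intros continuous_on_ell) auto

text \<open>Where \<open>ell\<close> is positive, the right-hand side is 16 y^(-1/4) times L theta +
  W theta / 16. For y <= 1/2 its first summand alone is at least 32, while l^2 / 400 <= 102^2 / 400
  < 32. For y > 1/2 the bound l >= 96 lets y l^2 absorb 96 y l, and 48 l >= l^2 / 400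
  remains.\<close>

lemma ell_sq_le:
  assumes "0 < y" "y \<le> 1" "ell y = l"
  shows "l\<^sup>2 / 400 \<le> 32 * (1 - y) * (1 + 2 * y)\<^sup>2 / y + 48 * l * (1 - 2 * y) + y * l\<^sup>2"
proof -
  have "ln y + 2 * y \<le> 0 + 2"
    using assms by (intro add_mono) auto
  then have l: "0 \<le> l" "l \<le> 102"
    using assms unfolding ell_def by auto
  have l2: "l\<^sup>2 \<le> 102\<^sup>2"
    using l by (intro power_mono) auto
  show ?thesis
  proof (cases "y \<le> 1 / 2")
    case True
    have "32 \<le> 32 * (1 - y) / y"
      using True assms by (simp add: field_simps)
    also have "\<dots> \<le> 32 * (1 - y) / y * (1 + 2 * y)\<^sup>2"
    proof -
      have "1 \<le> (1 + 2 * y)\<^sup>2"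
        using assms by (intro one_le_power) auto
      moreover have "0 \<le> 32 * (1 - y) / y"
        using assms by auto
      ultimately show ?thesis
        by (simp only: mult_le_cancel_left1) auto
    qed
    finally have "32 \<le> 32 * (1 - y) * (1 + 2 * y)\<^sup>2 / y"
      by simp
    moreover have "0 \<le> 48 * l * (1 - 2 * y)" "0 \<le> y * l\<^sup>2"
      using True assms l by auto
    ultimately show ?thesis
      using l2 by simp
  next
    case False
    have "ln (1 / y) \<le> 1 / y - 1"
      using assms by (intro ln_le_minus_one) auto
    moreover have "1 / y \<le> 2"
      using False by (simp add: field_simps)
    ultimately have "ln y \<ge> -1"
      using assms by (simp add: ln_div)
    then have l1: "l \<ge> 99 + 2 * y"
      using assms unfolding ell_def by auto
    have "(48 - 96 * y + y * l) \<ge> 48"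
    proof -
      have "y * l \<ge> y * 96"
        using l1 assms by (intro mult_left_mono) auto
      then show ?thesis by simp
    qed
    then have "l * 48 \<le> l * (48 - 96 * y + y * l)"
      using l by (intro mult_left_mono) auto
    moreover have "l * l / 400 \<le> l * 48"
      using l mult_left_mono[of l 102 l] by simp
    moreover have "0 \<le> 32 * (1 - y) * (1 + 2 * y)\<^sup>2 / y"
      using assms by auto
    ultimately show ?thesis
      by (simp add: algebra_simps power2_eq_square)
  qed
qed

text \<open>Where \<open>ell\<close> is positive, the left-hand side is - theta L theta: the angular
  energy density minus the divergence of \<open>nu (y) * grad y\<close>, both multiplied by s.
  Factoring out y^(1/4) isolates the expression of \<open>ell_sq_le\<close>, and 6400 = 16 *
  400.\<close>

lemma angular_inequality:
  assumes "0 < y" "y \<le> 1"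
  shows "y * (1 - y) * (theta' y)\<^sup>2 - y * (1 - y) * nu' y - (1 / 2 - y) * nu y
    \<le> (theta y)\<^sup>2 * ((1 / y + 1 + y) / 16 - 1 / 6400)"
proof -
  define r l where "r = sqrt y" and "l = ell y"
  have y: "y = r\<^sup>2" and r: "r > 0"
    using assms unfolding r_def by auto
  have sq: "(sqrt r)\<^sup>2 = r"
    using r by simp
  have "y * (1 - y) * (theta' y)\<^sup>2 - y * (1 - y) * nu' y - (1 / 2 - y) * nu y
    = r * l\<^sup>2 * ((1 / y + 1 + y) / 16 * l\<^sup>2
        - (32 * (1 - y) * (1 + 2 * y)\<^sup>2 / y + 48 * l * (1 - 2 * y) + y * l\<^sup>2) / 16)"
    unfolding theta'_def nu'_def nu_def l_def[symmetric] r_def[symmetric] power_mult_distrib sq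
    unfolding y using r by (simp add: field_simps power2_eq_square power_numeral_reduce)
  also have "\<dots> \<le> r * l\<^sup>2 * ((1 / y + 1 + y) / 16 * l\<^sup>2 - (l\<^sup>2 / 400) / 16)"
    using ell_sq_le[OF assms l_def[symmetric]] r by (intro mult_left_mono) auto
  also have "\<dots> = (theta y)\<^sup>2 * ((1 / y + 1 + y) / 16 - 1 / 6400)"
    unfolding theta_sq[OF assms(1)] l_def[symmetric] r_def[symmetric]
    by (simp add: algebra_simps power_numeral_reduce)
  finally show ?thesis .
qed

section \<open>The test function near an edge\<close>

text \<open>The model half-hyperplane is x2 = 0, x1 <= 0, with edge through \<open>p\<close>
  perpendicular to \<open>e1\<close> and \<open>e2\<close>. The radial cutoff is centred at distance
  \<open>\<mu>\<close> from the edge, and \<open>Q\<close> is the square of the cutoff length along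
  the edge.\<close>

locale edge_frame =
  fixes p e1 e2 :: "'a::euclidean_space" and \<mu> Q :: real
  assumes norm_e: "e1 \<bullet> e1 = 1" "e2 \<bullet> e2 = 1" and orth: "e1 \<bullet> e2 = 0"
    and scale_pos: "\<mu> > 0" "Q > 0"
begin

definition x1 :: "'a \<Rightarrow> real" where "x1 x = (x - p) \<bullet> e1"
definition x2 :: "'a \<Rightarrow> real" where "x2 x = (x - p) \<bullet> e2"
definition rad :: "'a \<Rightarrow> 'a" where "rad x = x1 x *\<^sub>R e1 + x2 x *\<^sub>R e2"
definition rot :: "'a \<Rightarrow> 'a" where "rot x = x1 x *\<^sub>R e2 - x2 x *\<^sub>R e1"
definition z :: "'a \<Rightarrow> 'a" where "z x = x - p - rad x"
definition s :: "'a \<Rightarrow> real" where "s x = (x1 x)\<^sup>2 + (x2 x)\<^sup>2"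
definition q :: "'a \<Rightarrow> real" where "q x = z x \<bullet> z x"
definition y :: "'a \<Rightarrow> real" where "y x = (1 + x1 x / sqrt (s x)) / 2"
text \<open>This is the complement of the model half-hyperplane. The condition
  \<open>s x > 0\<close> stands apart because division by zero gives \<open>y\<close> the value 1/2
  on the edge.\<close>

definition U :: "'a set" where "U = {x. s x > 0 \<and> y x > 0}"

definition grad_y :: "'a \<Rightarrow> 'a" where "grad_y x = - (x2 x / (2 * s x * sqrt (s x))) *\<^sub>R rot x"

lemma orth': "e2 \<bullet> e1 = 0"
  using orth by (simp add: inner_commute)

lemma z_perp: "z x \<bullet> e1 = 0" "z x \<bullet> e2 = 0"
  unfolding z_def rad_def x1_def x2_def
  by (simp_all add: inner_diff_left inner_add_left norm_e orth orth')

lemma frame_inner [simp]: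
  "rad x \<bullet> rad x = s x" "rot x \<bullet> rot x = s x" "rot x \<bullet> rad x = 0" "rad x \<bullet> rot x = 0"
  "z x \<bullet> rad x = 0" "rad x \<bullet> z x = 0" "z x \<bullet> rot x = 0" "rot x \<bullet> z x = 0"
proof -
  show "rad x \<bullet> rad x = s x" "rot x \<bullet> rot x = s x" "rot x \<bullet> rad x = 0" "rad x \<bullet> rot x = 0"
    unfolding rad_def rot_def s_def
    by (simp_all add: inner_simps norm_e orth orth' power2_eq_square algebra_simps)
  show "z x \<bullet> rad x = 0" "rad x \<bullet> z x = 0" "z x \<bullet> rot x = 0" "rot x \<bullet> z x = 0"
    using z_perp[of x] unfolding rad_def rot_def by (simp_all add: inner_simps inner_commute[of _ "z x"])
qed

lemma s_nonneg: "s x \<ge> 0"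
  unfolding s_def by auto

lemma norm_diff_eq: "(norm (x - p))\<^sup>2 = s x + q x"
proof -
  have "x - p = rad x + z x"
    unfolding z_def by simp
  then have "(norm (x - p))\<^sup>2 = (rad x + z x) \<bullet> (rad x + z x)"
    by (metis power2_norm_eq_inner)
  then show ?thesis
    by (simp add: inner_add_left inner_add_right q_def)
qed

section \<open>Gradients of the cylindrical coordinates\<close>

lemma x1_has_derivative [derivative_intros]: "(x1 has_derivative (\<lambda>h. h \<bullet> e1)) (at x)"
  and x2_has_derivative [derivative_intros]: "(x2 has_derivative (\<lambda>h. h \<bullet> e2)) (at x)"
  unfolding x1_def[abs_def] x2_def[abs_def] by (auto intro!: derivative_eq_intros)

lemma s_GDERIV: "GDERIV s x :> 2 *\<^sub>R rad x"
proof -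
  have "(s has_derivative (\<lambda>h. 2 * x1 x * (h \<bullet> e1) + 2 * x2 x * (h \<bullet> e2))) (at x)"
    unfolding s_def[abs_def] by (auto intro!: derivative_eq_intros)
  then show ?thesis
    unfolding gderiv_def rad_def by (simp add: inner_simps algebra_simps)
qed

lemma rad_has_derivative: "(rad has_derivative (\<lambda>h. (h \<bullet> e1) *\<^sub>R e1 + (h \<bullet> e2) *\<^sub>R e2)) (at x)"
  unfolding rad_def[abs_def] by (auto intro!: derivative_eq_intros)

lemma rot_has_derivative: "(rot has_derivative (\<lambda>h. (h \<bullet> e1) *\<^sub>R e2 - (h \<bullet> e2) *\<^sub>R e1)) (at x)"
  unfolding rot_def[abs_def] by (auto intro!: derivative_eq_intros)

lemma z_has_derivative: "(z has_derivative (\<lambda>h. h - ((h \<bullet> e1) *\<^sub>R e1 + (h \<bullet> e2) *\<^sub>R e2))) (at x)"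
  unfolding z_def[abs_def] by (auto intro!: derivative_eq_intros rad_has_derivative)

lemma q_GDERIV: "GDERIV q x :> 2 *\<^sub>R z x"
proof -
  have "(q has_derivative (\<lambda>h. z x \<bullet> (h - ((h \<bullet> e1) *\<^sub>R e1 + (h \<bullet> e2) *\<^sub>R e2)) +
      (h - ((h \<bullet> e1) *\<^sub>R e1 + (h \<bullet> e2) *\<^sub>R e2)) \<bullet> z x)) (at x)"
    unfolding q_def[abs_def] by (rule has_derivative_inner[OF z_has_derivative z_has_derivative])
  moreover have "z x \<bullet> (h - ((h \<bullet> e1) *\<^sub>R e1 + (h \<bullet> e2) *\<^sub>R e2)) +
      (h - ((h \<bullet> e1) *\<^sub>R e1 + (h \<bullet> e2) *\<^sub>R e2)) \<bullet> z x = h \<bullet> (2 *\<^sub>R z x)" for h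
    using z_perp[of x] by (simp add: inner_diff_right inner_add_right inner_commute[of _ "z x"])
  ultimately show ?thesis
    unfolding gderiv_def by simp
qed

lemma y_GDERIV:
  assumes "s x > 0"
  shows "GDERIV y x :> grad_y x"
proof -
  define r where "r = sqrt (s x)"
  have r: "r > 0" "s x = r * r"
    using assms unfolding r_def by auto
  have "((\<lambda>t. inverse (sqrt t)) has_real_derivative - (1 / (2 * r ^ 3))) (at (s x))"
    using assms r by (auto intro!: derivative_eq_intros simp: r_def[symmetric] power3_eq_cube field_simps)
  from GDERIV_DERIV_compose[OF s_GDERIV this]
  have inv: "GDERIV (\<lambda>x. inverse (sqrt (s x))) x :> - (1 / (2 * r ^ 3)) *\<^sub>R 2 *\<^sub>R rad x" .
  have "GDERIV x1 x :> e1"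
    unfolding gderiv_def by (rule x1_has_derivative)
  from GDERIV_mult[OF this inv]
  have "((\<lambda>x. x1 x * inverse (sqrt (s x))) has_derivative
      (\<lambda>h. h \<bullet> (x1 x *\<^sub>R - (1 / (2 * r ^ 3)) *\<^sub>R 2 *\<^sub>R rad x + inverse r *\<^sub>R e1))) (at x)"
    unfolding gderiv_def r_def .
  moreover have "((\<lambda>x. (1 + f x) / 2) has_derivative (\<lambda>h. f' h / 2)) (at x)"
    if "(f has_derivative f') (at x)" for f f' :: "'a \<Rightarrow> real"
    using that by (auto intro!: derivative_eq_intros)
  ultimately have "((\<lambda>x. (1 + x1 x * inverse (sqrt (s x))) / 2) has_derivative
      (\<lambda>h. h \<bullet> (x1 x *\<^sub>R - (1 / (2 * r ^ 3)) *\<^sub>R 2 *\<^sub>R rad x + inverse r *\<^sub>R e1) / 2)) (at x)"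
    by blast
  moreover have "h \<bullet> (x1 x *\<^sub>R - (1 / (2 * r ^ 3)) *\<^sub>R 2 *\<^sub>R rad x + inverse r *\<^sub>R e1) / 2 = h \<bullet> grad_y x" for h
  proof -
    \<comment> \<open>The tangential form of \<open>grad_y\<close> and the result of the quotient
      rule differ exactly by the relation x1^2 + x2^2 = r^2.\<close>
    have "s x = r\<^sup>2"
      using r by (simp add: power2_eq_square)
    then have sx: "(x2 x)\<^sup>2 = r\<^sup>2 - (x1 x)\<^sup>2"
      unfolding s_def by simp
    have "h \<bullet> grad_y x = - (x2 x / (2 * r ^ 3)) * (x1 x * (h \<bullet> e2) - x2 x * (h \<bullet> e1))"
      unfolding grad_y_def rot_def r_def[symmetric] unfolding r(2)
      by (simp add: inner_simps power3_eq_cube)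
    also have "\<dots> = ((x2 x)\<^sup>2 * (h \<bullet> e1) - x1 x * x2 x * (h \<bullet> e2)) / (2 * r ^ 3)"
      by (simp add: algebra_simps diff_divide_distrib power2_eq_square)
    also have "\<dots> = ((r\<^sup>2 - (x1 x)\<^sup>2) * (h \<bullet> e1) - x1 x * x2 x * (h \<bullet> e2)) / (2 * r ^ 3)"
      by (simp add: sx)
    also have "\<dots> = h \<bullet> (x1 x *\<^sub>R - (1 / (2 * r ^ 3)) *\<^sub>R 2 *\<^sub>R rad x + inverse r *\<^sub>R e1) / 2"
      unfolding rad_def using r(1)
      by (simp add: inner_simps field_simps power2_eq_square power3_eq_cube)
    finally show ?thesis ..
  qed
  ultimately have "((\<lambda>x. (1 + x1 x * inverse (sqrt (s x))) / 2) has_derivative (\<lambda>h. h \<bullet> grad_y x)) (at x)"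
    by (simp only:)
  then show ?thesis
    unfolding gderiv_def y_def[abs_def] divide_inverse .
qed

lemma continuous_coords [continuous_intros]:
  "continuous_on T x1" "continuous_on T x2" "continuous_on T s" "continuous_on T q"
  "continuous_on T z" "continuous_on T rad" "continuous_on T rot"
  unfolding x1_def[abs_def] x2_def[abs_def] s_def[abs_def] q_def[abs_def] z_def[abs_def]
    rad_def[abs_def] rot_def[abs_def]
  by (intro continuous_intros)+

lemma has_gradient_s: "has_gradient_on s (\<lambda>x. 2 *\<^sub>R rad x) T"
  and has_gradient_q: "has_gradient_on q (\<lambda>x. 2 *\<^sub>R z x) T"
  unfolding has_gradient_on_def using s_GDERIV q_GDERIV by (auto intro!: continuous_intros)

lemma has_gradient_y: "has_gradient_on y grad_y {x. s x > 0}"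
  unfolding has_gradient_on_def using y_GDERIV
  by (auto simp: grad_y_def[abs_def] intro!: continuous_intros)

lemma open_U: "open U"
proof -
  have "open {x. s x > 0}"
    using open_Collect_less[OF continuous_on_const continuous_coords(3)] .
  then have "open (y -` {0<..} \<inter> {x. s x > 0})"
    using has_gradient_on_continuous[OF has_gradient_y] continuous_on_open_vimage open_greaterThan by blast
  moreover have "U = y -` {0<..} \<inter> {x. s x > 0}"
    unfolding U_def by auto
  ultimately show ?thesis
    by simp
qed

lemma has_gradient_product:
  assumes f: "\<And>t. t > 0 \<Longrightarrow> (f has_real_derivative f' t) (at t)" "continuous_on {0<..} f'"
    and g: "\<And>t. t > 0 \<Longrightarrow> (g has_real_derivative g' t) (at t)" "continuous_on {0<..} g'"
    and k: "\<And>t. (k has_real_derivative k' t) (at t)" "continuous_on UNIV k'"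
  shows "has_gradient_on (\<lambda>x. f (y x) * g (s x) * k (q x))
    (\<lambda>x. (f (y x) * g (s x)) *\<^sub>R k' (q x) *\<^sub>R 2 *\<^sub>R z x +
      k (q x) *\<^sub>R (f (y x) *\<^sub>R g' (s x) *\<^sub>R 2 *\<^sub>R rad x + g (s x) *\<^sub>R f' (y x) *\<^sub>R grad_y x)) U"
proof (intro has_gradient_on_mult)
  show "has_gradient_on (\<lambda>x. f (y x)) (\<lambda>x. f' (y x) *\<^sub>R grad_y x) U"
    by (rule has_gradient_on_compose[OF has_gradient_on_subset[OF has_gradient_y], where T = "{0<..}"])
      (auto simp: U_def f)
  show "has_gradient_on (\<lambda>x. g (s x)) (\<lambda>x. g' (s x) *\<^sub>R 2 *\<^sub>R rad x) U"
    by (rule has_gradient_on_compose[OF has_gradient_s, where T = "{0<..}"]) (auto simp: U_def g)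
  show "has_gradient_on (\<lambda>x. k (q x)) (\<lambda>x. k' (q x) *\<^sub>R 2 *\<^sub>R z x) U"
    by (rule has_gradient_on_compose[OF has_gradient_q, where T = UNIV]) (auto simp: k)
qed

text \<open>The last condition is \<open>exp (- 102) \<le> y x\<close> multiplied out. In this form
  all conditions use functions continuous on the whole space, so that \<open>K\<close> is closed
  although \<open>y\<close> jumps at the edge. The bounds on \<open>s\<close> come from
  \<open>gam\<close>, which vanishes once the logarithm exceeds 500 in absolute value.\<close>

definition K :: "'a set" where
  "K = {x. \<mu>\<^sup>2 * exp (-500) \<le> s x \<and> s x \<le> \<mu>\<^sup>2 * exp 500 \<and> q x \<le> Q \<and>
    (2 * exp (-102) - 1) * sqrt (s x) \<le> x1 x}"

lemma K_pos: "x \<in> K \<Longrightarrow> s x > 0"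
  unfolding K_def using scale_pos by (smt (verit) exp_gt_zero mem_Collect_eq mult_pos_pos zero_less_power)

lemma K_y: "x \<in> K \<Longrightarrow> y x \<ge> exp (-102)"
  using K_pos[of x] unfolding K_def y_def by (simp add: field_simps)

lemma K_subset_U: "K \<subseteq> U"
  using K_pos K_y unfolding U_def by (auto intro: less_le_trans[OF exp_gt_zero])

lemma compact_K: "compact K"
proof -
  have "closed K"
    unfolding K_def by (intro closed_Collect_conj closed_Collect_le continuous_intros)
  moreover have "bounded K"
  proof (rule boundedI)
    fix x assume "x \<in> K"
    then have "s x + q x \<le> \<mu>\<^sup>2 * exp 500 + Q"
      unfolding K_def by (intro add_mono) blast+
    then have "norm (x - p) \<le> sqrt (\<mu>\<^sup>2 * exp 500 + Q)"
      unfolding norm_diff_eq[symmetric] by (rule real_le_rsqrt)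
    then show "norm x \<le> sqrt (\<mu>\<^sup>2 * exp 500 + Q) + norm p"
      using norm_triangle_sub[of x p] by simp
  qed
  ultimately show ?thesis
    by (simp add: compact_eq_bounded_closed)
qed

lemma y_bounds: "0 \<le> y x" "y x \<le> 1"
proof -
  have "\<bar>x1 x\<bar> \<le> sqrt (s x)"
    unfolding s_def by (rule real_le_rsqrt) auto
  then have "\<bar>x1 x / sqrt (s x)\<bar> \<le> 1"
    using divide_le_eq_1_pos[of "sqrt (s x)"] s_nonneg[of x] by (cases "s x = 0") (auto simp: abs_divide)
  then have "x1 x / sqrt (s x) \<le> 1" "- (x1 x / sqrt (s x)) \<le> 1"
    unfolding abs_le_iff by blast+
  then show "0 \<le> y x" "y x \<le> 1"
    unfolding y_def by auto
qed

definition om :: "real \<Rightarrow> real" where "om t = max 0 (1 - t / Q)"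

definition rho :: "real \<Rightarrow> real" where "rho t = gam (t / \<mu>\<^sup>2)"

text \<open>Each alternative names a factor that makes the product profiles vanish. The case
  \<open>y x = 0\<close> is separate because \<open>ln 0 = 0\<close> makes \<open>ell 0\<close>
  equal to 100.\<close>

lemma outside_K:
  assumes "x \<notin> K"
  shows "rho (s x) = 0 \<or> om (q x) = 0 \<or> (s x > 0 \<and> (ell (y x) = 0 \<or> y x = 0))"
proof -
  have l2: "\<mu>\<^sup>2 > 0"
    using scale_pos by simp
  consider "s x < \<mu>\<^sup>2 * exp (-500)" | "s x > \<mu>\<^sup>2 * exp 500" | "q x > Q"
    | "s x \<ge> \<mu>\<^sup>2 * exp (-500)" "(2 * exp (-102) - 1) * sqrt (s x) > x1 x"
    using assms unfolding K_def by fastforce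
  then show ?thesis
  proof cases
    case 1
    then have "s x / \<mu>\<^sup>2 < exp (-500)"
      using l2 by (simp add: pos_divide_less_eq mult.commute)
    then have "s x / \<mu>\<^sup>2 \<le> 0 \<or> ln (s x / \<mu>\<^sup>2) < - 500"
      using ln_less_cancel_iff[of "s x / \<mu>\<^sup>2" "exp (-500)"] by force
    moreover have "(ln (s x / \<mu>\<^sup>2))\<^sup>2 \<ge> 250000" if "ln (s x / \<mu>\<^sup>2) < - 500"
      using power_mono[of 500 "- ln (s x / \<mu>\<^sup>2)" 2] that by simp
    ultimately have "rho (s x) = 0"
      unfolding rho_def gam_def by (auto simp: max_def)
    then show ?thesis ..
  next
    case 2
    then have *: "s x / \<mu>\<^sup>2 > exp 500"
      using l2 by (simp add: pos_less_divide_eq mult.commute)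
    then have "s x / \<mu>\<^sup>2 > 0"
      using exp_gt_zero less_trans by blast
    with * have "ln (s x / \<mu>\<^sup>2) > 500"
      using ln_less_cancel_iff[of "exp 500" "s x / \<mu>\<^sup>2"] by simp
    then have "(ln (s x / \<mu>\<^sup>2))\<^sup>2 \<ge> 250000"
      using power_mono[of 500 "ln (s x / \<mu>\<^sup>2)" 2] by simp
    then show ?thesis
      unfolding rho_def gam_def by auto
  next
    case 3
    then show ?thesis
      unfolding om_def using scale_pos by simp
  next
    case 4
    then have s: "s x > 0"
      using l2 by (smt (verit) exp_gt_zero mult_pos_pos)
    then have y: "y x < exp (-102)"
      using 4 unfolding y_def by (simp add: field_simps)
    have "ell (y x) = 0" if "y x > 0"
    proof -
      have "ln (y x) < -102"
        using y that ln_less_cancel_iff[of "y x" "exp (-102)"] by simp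
      then show ?thesis
        unfolding ell_def using y_bounds[of x] by auto
    qed
    then show ?thesis
      using s y_bounds(1)[of x] by fastforce
  qed
qed


section \<open>The test function and its gradient\<close>

definition psi :: "'a \<Rightarrow> real" where
  "psi x = theta (y x) * (rho (s x))\<^sup>2 * (om (q x))\<^sup>2"

lemma rho_derivs:
  assumes "t > 0"
  shows "((\<lambda>t. (rho t)\<^sup>2) has_real_derivative 2 * rho t * (- ln (t / \<mu>\<^sup>2) / (125000 * t))) (at t)"
    and "((\<lambda>t. rho t ^ 3) has_real_derivative 3 * (rho t)\<^sup>2 * (- ln (t / \<mu>\<^sup>2) / (125000 * t))) (at t)"
    and "((\<lambda>t. rho t ^ 4) has_real_derivative 4 * rho t ^ 3 * (- ln (t / \<mu>\<^sup>2) / (125000 * t))) (at t)"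
proof -
  have m: "\<mu>\<^sup>2 > 0"
    using scale_pos by simp
  have d: "((\<lambda>t. t / \<mu>\<^sup>2) has_real_derivative 1 / \<mu>\<^sup>2) (at t)"
    by (rule DERIV_cdivide[OF DERIV_ident])
  have eq: "A * (- L / (125000 * (t / M))) * (1 / M) = A * (- L / (125000 * t))" if "M > 0" for A L M :: real
    using that assms by (simp add: field_simps)
  have pos: "t / \<mu>\<^sup>2 > 0"
    using assms m by simp
  show "((\<lambda>t. (rho t)\<^sup>2) has_real_derivative 2 * rho t * (- ln (t / \<mu>\<^sup>2) / (125000 * t))) (at t)"
    using DERIV_chain2[OF gam_derivs(1)[OF pos] d] unfolding rho_def by (simp only: eq[OF m])
  show "((\<lambda>t. rho t ^ 3) has_real_derivative 3 * (rho t)\<^sup>2 * (- ln (t / \<mu>\<^sup>2) / (125000 * t))) (at t)"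
    using DERIV_chain2[OF gam_derivs(2)[OF pos] d] unfolding rho_def by (simp only: eq[OF m])
  show "((\<lambda>t. rho t ^ 4) has_real_derivative 4 * rho t ^ 3 * (- ln (t / \<mu>\<^sup>2) / (125000 * t))) (at t)"
    using DERIV_chain2[OF gam_derivs(3)[OF pos] d] unfolding rho_def by (simp only: eq[OF m])
qed

lemma rho_ln:
  assumes "t > 0" "rho t \<noteq> 0"
  shows "(ln (t / \<mu>\<^sup>2))\<^sup>2 = 250000 * (1 - rho t)"
  using assms unfolding rho_def gam_def by (auto split: if_splits simp: max_def)

text \<open>The cutoff is quadratic in the logarithm. The squared logarithms produced by
  differentiation therefore turn into polynomials in the cutoff; the positive power of
  \<open>rho\<close> covers the region where the cutoff is zero.\<close>

lemma rho_ln_mult: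
  assumes "t > 0"
  shows "rho t ^ Suc n * (ln (t / \<mu>\<^sup>2))\<^sup>2 = 250000 * (rho t ^ Suc n - rho t ^ Suc (Suc n))"
proof (cases "rho t = 0")
  case False
  show ?thesis
    unfolding rho_ln[OF assms False] by (simp add: algebra_simps)
qed simp

lemma continuous_on_rho: "continuous_on {0<..} rho"
  unfolding rho_def[abs_def] using scale_pos
  by (intro continuous_on_compose2[OF continuous_on_gam] continuous_intros) auto

lemma om_derivs:
  "((\<lambda>t. (om t)\<^sup>2) has_real_derivative 2 * om t * (- 1 / Q)) (at t)"
  "((\<lambda>t. om t ^ 3) has_real_derivative 3 * (om t)\<^sup>2 * (- 1 / Q)) (at t)"
  "((\<lambda>t. om t ^ 4) has_real_derivative 4 * om t ^ 3 * (- 1 / Q)) (at t)"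
proof -
  have "((\<lambda>t. 1 - t / Q) has_real_derivative - 1 / Q) (at t)"
    using DERIV_diff[OF DERIV_const DERIV_cdivide[OF DERIV_ident]] by simp
  note * = max0_power_has_derivative_numeral[OF this]
  show "((\<lambda>t. (om t)\<^sup>2) has_real_derivative 2 * om t * (- 1 / Q)) (at t)"
    "((\<lambda>t. om t ^ 3) has_real_derivative 3 * (om t)\<^sup>2 * (- 1 / Q)) (at t)"
    "((\<lambda>t. om t ^ 4) has_real_derivative 4 * om t ^ 3 * (- 1 / Q)) (at t)"
    using * unfolding om_def by simp_all
qed

text \<open>The longitudinal counterpart of \<open>rho_ln_mult\<close>: the cutoff is affine in
  \<open>t\<close> on its support, so a factor \<open>t\<close> can be traded for powers of
  \<open>om\<close>.\<close>

lemma om_mult: "t * om t ^ Suc n = Q * (om t ^ Suc n - om t ^ Suc (Suc n))"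
proof (cases "om t = 0")
  case False
  then have "t = Q * (1 - om t)"
    using scale_pos unfolding om_def by (auto simp: max_def split: if_splits)
  then have "t * om t ^ Suc n = Q * (1 - om t) * om t ^ Suc n"
    by simp
  then show ?thesis
    by (simp add: algebra_simps)
qed simp

lemma continuous_on_om: "continuous_on T om"
  unfolding om_def[abs_def] using scale_pos by (intro continuous_intros) auto

lemma x2_sq: "s x > 0 \<Longrightarrow> (x2 x)\<^sup>2 = 4 * s x * y x * (1 - y x)"
  and x1_eq: "s x > 0 \<Longrightarrow> x1 x = (2 * y x - 1) * sqrt (s x)"
proof -
  assume s: "s x > 0"
  then show x1: "x1 x = (2 * y x - 1) * sqrt (s x)"
    unfolding y_def by (simp add: field_simps)
  have "(x1 x)\<^sup>2 = (2 * y x - 1)\<^sup>2 * s x"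
    using s by (subst x1) (simp add: power_mult_distrib)
  moreover have "(x2 x)\<^sup>2 = s x - (x1 x)\<^sup>2"
    unfolding s_def by simp
  ultimately show "(x2 x)\<^sup>2 = 4 * s x * y x * (1 - y x)"
    by (simp add: algebra_simps power2_eq_square)
qed

lemma grad_y_inner:
  assumes "s x > 0"
  shows "grad_y x \<bullet> grad_y x = y x * (1 - y x) / s x" "grad_y x \<bullet> rad x = 0" "grad_y x \<bullet> z x = 0"
    "grad_y x \<bullet> rot x = - x2 x / (2 * sqrt (s x))"
proof -
  have "grad_y x \<bullet> grad_y x = (x2 x)\<^sup>2 / (4 * (s x)\<^sup>2)"
    unfolding grad_y_def using assms
    by (simp add: power2_eq_square field_simps)
  also have "\<dots> = y x * (1 - y x) / s x"
    unfolding x2_sq[OF assms] using assms by (simp add: power2_eq_square)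
  finally show "grad_y x \<bullet> grad_y x = y x * (1 - y x) / s x" .
qed (use assms in \<open>simp_all add: grad_y_def\<close>)

definition grad_psi :: "'a \<Rightarrow> 'a" where
  "grad_psi x = (theta (y x) * (rho (s x))\<^sup>2) *\<^sub>R (2 * om (q x) * (- 1 / Q)) *\<^sub>R 2 *\<^sub>R z x +
      (om (q x))\<^sup>2 *\<^sub>R (theta (y x) *\<^sub>R (2 * rho (s x) * (- ln (s x / \<mu>\<^sup>2) / (125000 * s x))) *\<^sub>R 2 *\<^sub>R rad x
        + (rho (s x))\<^sup>2 *\<^sub>R theta' (y x) *\<^sub>R grad_y x)"

lemma has_gradient_psi: "has_gradient_on psi grad_psi U"
  unfolding psi_def[abs_def] grad_psi_def[abs_def]
  by (rule has_gradient_product[OF theta_deriv continuous_on_theta' rho_derivs(1) _ om_derivs(1)])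
    (use scale_pos in \<open>auto intro!: continuous_intros continuous_on_rho continuous_on_om\<close>)

text \<open>Both values come from \<open>sqrt 0\<close>: it is a factor in \<open>theta\<close>, and
  the divisor in \<open>nu\<close>, where division by zero gives zero.\<close>

lemma theta_0 [simp]: "theta 0 = 0" and nu_0 [simp]: "nu 0 = 0"
  unfolding theta_def nu_def by simp_all

lemma theta_eq_0: "ell t = 0 \<Longrightarrow> theta t = 0" and nu_eq_0: "ell t = 0 \<Longrightarrow> nu t = 0"
  unfolding theta_def nu_def by simp_all

lemma psi_outside: "x \<notin> K \<Longrightarrow> psi x = 0"
  using outside_K[of x] theta_eq_0 unfolding psi_def by auto

text \<open>The directions \<open>z\<close>, \<open>rad\<close> and \<open>grad_y\<close> are
  mutually orthogonal, so their contributions add. \<open>rho_ln_mult\<close> and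
  \<open>om_mult\<close> then eliminate the logarithm and \<open>q\<close>; the factor 64 / 250000
  is 16 * 250000 / 125000^2.\<close>

lemma grad_psi_norm:
  assumes "x \<in> U"
  shows "(norm (grad_psi x))\<^sup>2 =
    rho (s x) ^ 4 * om (q x) ^ 4 * (y x * (1 - y x) * (theta' (y x))\<^sup>2) / s x
    + (theta (y x))\<^sup>2 * om (q x) ^ 4 * (64 / 250000) * ((rho (s x))\<^sup>2 - rho (s x) ^ 3) / s x
    + (theta (y x))\<^sup>2 * rho (s x) ^ 4 * (16 / Q) * ((om (q x))\<^sup>2 - om (q x) ^ 3)"
proof -
  have s: "s x > 0"
    using assms unfolding U_def by simp
  define a b c where "a = theta (y x) * (rho (s x))\<^sup>2 * (2 * om (q x) * (- 1 / Q)) * 2"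
    and "b = (om (q x))\<^sup>2 * theta (y x) * (2 * rho (s x) * (- ln (s x / \<mu>\<^sup>2) / (125000 * s x))) * 2"
    and "c = (om (q x))\<^sup>2 * (rho (s x))\<^sup>2 * theta' (y x)"
  have "grad_psi x = a *\<^sub>R z x + b *\<^sub>R rad x + c *\<^sub>R grad_y x"
    unfolding grad_psi_def a_def b_def c_def
    by (simp only: scaleR_add_right scaleR_scaleR mult.assoc add.assoc)
  then have "(norm (grad_psi x))\<^sup>2 = a\<^sup>2 * q x + b\<^sup>2 * s x + c\<^sup>2 * (y x * (1 - y x) / s x)"
    unfolding power2_norm_eq_inner using grad_y_inner(1-3)[OF s]
    by (simp add: inner_add_left inner_add_right inner_commute[of "rad x" "grad_y x"]
        inner_commute[of "z x" "grad_y x"] q_def power2_eq_square)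
  also have "a\<^sup>2 * q x = (theta (y x))\<^sup>2 * rho (s x) ^ 4 * (16 / Q) * ((om (q x))\<^sup>2 - om (q x) ^ 3)"
  proof -
    have "a\<^sup>2 * q x = (theta (y x))\<^sup>2 * rho (s x) ^ 4 * (16 / Q\<^sup>2) * (q x * om (q x) ^ Suc 1)"
      unfolding a_def by (simp add: field_simps power2_eq_square power_numeral_reduce)
    also have "\<dots> = (theta (y x))\<^sup>2 * rho (s x) ^ 4 * (16 / Q) * ((om (q x))\<^sup>2 - om (q x) ^ 3)"
      unfolding om_mult using scale_pos by (simp add: field_simps power2_eq_square power_numeral_reduce)
    finally show ?thesis .
  qed
  also have "b\<^sup>2 * s x = (theta (y x))\<^sup>2 * om (q x) ^ 4 * (64 / 250000) * ((rho (s x))\<^sup>2 - rho (s x) ^ 3) / s x"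
  proof -
    define T where "T = ln (s x / \<mu>\<^sup>2)"
    have "b\<^sup>2 * s x = (theta (y x))\<^sup>2 * om (q x) ^ 4 * (16 / 125000\<^sup>2) * (rho (s x) ^ Suc 1 * T\<^sup>2) / s x"
      unfolding b_def T_def[symmetric] using s by (simp add: field_simps power2_eq_square power_numeral_reduce)
    also have "\<dots> = (theta (y x))\<^sup>2 * om (q x) ^ 4 * (64 / 250000) * ((rho (s x))\<^sup>2 - rho (s x) ^ 3) / s x"
      unfolding T_def rho_ln_mult[OF s] using s by (simp add: power_numeral_reduce field_simps)
    finally show ?thesis .
  qed
  also have "c\<^sup>2 * (y x * (1 - y x) / s x) =
    rho (s x) ^ 4 * om (q x) ^ 4 * (y x * (1 - y x) * (theta' (y x))\<^sup>2) / s x"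
    unfolding c_def by (simp add: field_simps power2_eq_square power_numeral_reduce)
  finally show ?thesis
    by simp
qed

text \<open>The coefficient is arranged so that the scalar times \<open>x2 *\<^sub>R rot\<close> is
  \<open>nu (y)\<close> times \<open>grad_y\<close> and the cutoffs; the vector factor left over is
  polynomial with divergence \<open>x1\<close>. The result combines |grad y|^2 = y (1 - y) / s with
  the Laplacian (1/2 - y) / s of y. The cutoffs are constant along \<open>rot\<close> and are not
  differentiated.\<close>

lemma rot_field:
  obtains w' where "has_gradient_on
      (\<lambda>x. nu (y x) * (rho (s x) ^ 4 * (- 1 / (2 * (s x * sqrt (s x))))) * om (q x) ^ 4) w' UNIV"
    "\<And>x. x \<notin> K \<Longrightarrow> w' x = 0"
    "\<And>x. x \<in> U \<Longrightarrow> w' x \<bullet> (x2 x *\<^sub>R rot x) + nu (y x) * (rho (s x) ^ 4 * (- 1 / (2 * (s x * sqrt (s x))))) * om (q x) ^ 4 * x1 x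
      = rho (s x) ^ 4 * om (q x) ^ 4 * (y x * (1 - y x) * nu' (y x) + (1 / 2 - y x) * nu (y x)) / s x"
proof -
  define h where "h t = - 1 / (2 * (t * sqrt t))" for t :: real
  define h' where "h' t = 3 / (4 * (t\<^sup>2 * sqrt t))" for t :: real
  have h: "(h has_real_derivative h' t) (at t)" if "t > 0" for t
  proof -
    define r where "r = sqrt t"
    have "r > 0" "t = r\<^sup>2"
      using that unfolding r_def by auto
    then show ?thesis
      unfolding h_def[abs_def] h'_def using that
      by (auto intro!: derivative_eq_intros simp: r_def[symmetric])
        (simp add: field_simps power2_eq_square power4_eq_xxxx)
  qed
  define g' where "g' t = 4 * rho t ^ 3 * (- ln (t / \<mu>\<^sup>2) / (125000 * t)) * h t + h' t * rho t ^ 4" for t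
  have g: "((\<lambda>t. rho t ^ 4 * h t) has_real_derivative g' t) (at t)" if "t > 0" for t
    unfolding g'_def by (rule DERIV_mult[OF rho_derivs(3)[OF that] h[OF that]])
  have g'c: "continuous_on {0<..} g'"
    unfolding g'_def[abs_def] h_def h'_def using scale_pos
    by (auto intro!: continuous_intros continuous_on_rho)
  define w where "w x = nu (y x) * (rho (s x) ^ 4 * h (s x)) * om (q x) ^ 4" for x
  define v where "v x = (nu (y x) * (rho (s x) ^ 4 * h (s x))) *\<^sub>R (4 * om (q x) ^ 3 * (- 1 / Q)) *\<^sub>R 2 *\<^sub>R z x +
      om (q x) ^ 4 *\<^sub>R (nu (y x) *\<^sub>R g' (s x) *\<^sub>R 2 *\<^sub>R rad x
        + (rho (s x) ^ 4 * h (s x)) *\<^sub>R nu' (y x) *\<^sub>R grad_y x)" for x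
  have w: "has_gradient_on w v U"
    unfolding w_def[abs_def] v_def[abs_def]
    by (rule has_gradient_product[OF nu_deriv continuous_on_nu' g g'c om_derivs(3)])
      (use scale_pos in \<open>auto intro!: continuous_intros continuous_on_om\<close>)
  have w0: "w x = 0" if "x \<notin> K" for x
    using outside_K[OF that] nu_eq_0 unfolding w_def by auto
  note ext = has_gradient_on_extend[OF w open_U compact_imp_closed[OF compact_K] K_subset_U w0]
  show thesis
  proof (rule that[OF ext[unfolded w_def h_def]])
    fix x assume x: "x \<in> U"
    then have s: "s x > 0"
      unfolding U_def by simp
    define r where "r = sqrt (s x)"
    have r: "r > 0" "s x = r\<^sup>2"
      using s unfolding r_def by auto
    have "v x \<bullet> (x2 x *\<^sub>R rot x) = om (q x) ^ 4 * rho (s x) ^ 4 * h (s x) * nu' (y x) * (- (x2 x)\<^sup>2 / (2 * r))"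
      unfolding v_def using grad_y_inner(4)[OF s]
      by (simp add: inner_add_left inner_diff_left r_def power2_eq_square)
    also have "\<dots> = om (q x) ^ 4 * rho (s x) ^ 4 * nu' (y x) * (y x * (1 - y x)) / s x"
      unfolding x2_sq[OF s] h_def r_def[symmetric] unfolding r(2) using r(1)
      by (simp add: field_simps power2_eq_square)
    finally have 1: "v x \<bullet> (x2 x *\<^sub>R rot x) = \<dots>" .
    have "nu (y x) * (rho (s x) ^ 4 * h (s x)) * om (q x) ^ 4 * x1 x
      = nu (y x) * rho (s x) ^ 4 * om (q x) ^ 4 * (1 / 2 - y x) / s x"
      unfolding x1_eq[OF s] h_def r_def[symmetric] unfolding r(2) using r(1)
      by (simp add: field_simps power2_eq_square)
    with 1 show "(if x \<in> U then v x else 0) \<bullet> (x2 x *\<^sub>R rot x) + nu (y x) * (rho (s x) ^ 4 * (- 1 / (2 * (s x * sqrt (s x))))) * om (q x) ^ 4 * x1 x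
      = rho (s x) ^ 4 * om (q x) ^ 4 * (y x * (1 - y x) * nu' (y x) + (1 / 2 - y x) * nu (y x)) / s x"
      using x unfolding h_def by (simp add: add_divide_distrib diff_divide_distrib algebra_simps)
  qed auto
qed


lemma theta_sq_deriv:
  "t > 0 \<Longrightarrow> ((\<lambda>t. (theta t)\<^sup>2) has_real_derivative 2 * theta t * theta' t) (at t)"
  using DERIV_power[OF theta_deriv, of t 2] by (simp add: mult.commute mult.left_commute)

lemma continuous_on_theta: "continuous_on {0<..} theta"
  unfolding theta_def[abs_def] by (intro continuous_intros continuous_on_ell)

text \<open>
  In the next two lemmas the coefficients are chosen so that the divergence cancels the lower powers
  of the cutoff which occur in the squared gradient of the test function.
\<close>

lemma rad_field:
  fixes G :: "real \<Rightarrow> real"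
  defines "G \<equiv> \<lambda>t. - (32 / 250000) * (ln (t / \<mu>\<^sup>2) * rho t ^ 4 / 48 + ln (t / \<mu>\<^sup>2) * rho t ^ 3 / 6)"
  obtains w' where "has_gradient_on
      (\<lambda>x. (theta (y x))\<^sup>2 * (G (s x) / s x) * om (q x) ^ 4) w' UNIV"
    "\<And>x. x \<notin> K \<Longrightarrow> w' x = 0"
    "\<And>x. x \<in> U \<Longrightarrow> w' x \<bullet> rad x + (theta (y x))\<^sup>2 * (G (s x) / s x) * om (q x) ^ 4 * 2
      = (theta (y x))\<^sup>2 * om (q x) ^ 4 * (64 / 250000) * ((rho (s x))\<^sup>2 - rho (s x) ^ 3 - 3 / 16 * rho (s x) ^ 4) / s x"
proof -
  define H where "H t = (32 / 250000) * ((rho t)\<^sup>2 - rho t ^ 3 - 3 / 16 * rho t ^ 4) / t" for t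
  have L: "((\<lambda>t. ln (t / \<mu>\<^sup>2)) has_real_derivative 1 / t) (at t)" if "t > 0" for t
  proof -
    have "((\<lambda>t. ln t - ln (\<mu>\<^sup>2)) has_real_derivative 1 / t) (at t)"
      using that by (auto intro!: derivative_eq_intros)
    then show ?thesis
      by (rule has_field_derivative_transform_within_open[where S = "{0<..}"])
        (use that scale_pos in \<open>auto simp: ln_div\<close>)
  qed
  have G: "(G has_real_derivative H t) (at t)" if "t > 0" for t
  proof -
    define T where "T = ln (t / \<mu>\<^sup>2)"
    \<comment> \<open>Differentiating the logarithm leaves a power of \<open>rho\<close>;
      differentiating the power leaves a squared logarithm, which \<open>rho_ln_mult\<close>
      removes. Up to 1/t the derivative is thus a polynomial in \<open>rho\<close>.\<close>
    have "((\<lambda>t. ln (t / \<mu>\<^sup>2) * rho t ^ 4) has_real_derivative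
      1 / t * rho t ^ 4 + 4 * rho t ^ 3 * (- T / (125000 * t)) * T) (at t)"
      unfolding T_def by (rule DERIV_mult[OF L[OF that] rho_derivs(3)[OF that]])
    also have "1 / t * rho t ^ 4 + 4 * rho t ^ 3 * (- T / (125000 * t)) * T
      = (rho t ^ 4 - 4 * (rho t ^ Suc 2 * T\<^sup>2) / 125000) / t"
      using that by (simp add: field_simps power2_eq_square power_numeral_reduce)
    also have "\<dots> = (9 * rho t ^ 4 - 8 * rho t ^ 3) / t"
      unfolding T_def rho_ln_mult[OF that]
      by (simp add: power_numeral_reduce algebra_simps diff_divide_distrib)
    finally have 1: "((\<lambda>t. ln (t / \<mu>\<^sup>2) * rho t ^ 4) has_real_derivative \<dots>) (at t)" .
    have "((\<lambda>t. ln (t / \<mu>\<^sup>2) * rho t ^ 3) has_real_derivative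
      1 / t * rho t ^ 3 + 3 * (rho t)\<^sup>2 * (- T / (125000 * t)) * T) (at t)"
      unfolding T_def by (rule DERIV_mult[OF L[OF that] rho_derivs(2)[OF that]])
    also have "1 / t * rho t ^ 3 + 3 * (rho t)\<^sup>2 * (- T / (125000 * t)) * T
      = (rho t ^ 3 - 3 * (rho t ^ Suc 1 * T\<^sup>2) / 125000) / t"
      using that by (simp add: field_simps power2_eq_square power_numeral_reduce)
    also have "\<dots> = (7 * rho t ^ 3 - 6 * (rho t)\<^sup>2) / t"
      unfolding T_def rho_ln_mult[OF that]
      by (simp add: power_numeral_reduce algebra_simps diff_divide_distrib)
    finally have 2: "((\<lambda>t. ln (t / \<mu>\<^sup>2) * rho t ^ 3) has_real_derivative \<dots>) (at t)" .
    \<comment> \<open>Up to the common factor and 1/t, the coefficient 1/6 produces the square with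
      coefficient 1, then 1/48 corrects the cube from -7/6 to -1, and -9/48 = -3/16 is left for the
      fourth power.\<close>
    have "(G has_real_derivative - (32 / 250000) * ((9 * rho t ^ 4 - 8 * rho t ^ 3) / t / 48 +
        (7 * rho t ^ 3 - 6 * (rho t)\<^sup>2) / t / 6)) (at t)"
      unfolding G_def by (rule DERIV_cmult[OF DERIV_add[OF DERIV_cdivide[OF 1] DERIV_cdivide[OF 2]]])
    also have "- (32 / 250000) * ((9 * rho t ^ 4 - 8 * rho t ^ 3) / t / 48 +
        (7 * rho t ^ 3 - 6 * (rho t)\<^sup>2) / t / 6) = H t"
      unfolding H_def using that by (simp add: field_simps)
    finally show ?thesis .
  qed
  define g' where "g' t = (H t * t - G t * 1) / (t * t)" for t
  have g: "((\<lambda>t. G t / t) has_real_derivative g' t) (at t)" if "t > 0" for t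
    unfolding g'_def by (rule DERIV_divide[OF G[OF that] DERIV_ident]) (use that in auto)
  have Gc: "continuous_on {0<..} G"
    using G by (meson DERIV_isCont continuous_at_imp_continuous_on greaterThan_iff)
  have g'c: "continuous_on {0<..} g'"
    unfolding g'_def[abs_def] H_def
    by (intro continuous_intros continuous_on_rho Gc) auto
  define w where "w x = (theta (y x))\<^sup>2 * (G (s x) / s x) * om (q x) ^ 4" for x
  define v where "v x = ((theta (y x))\<^sup>2 * (G (s x) / s x)) *\<^sub>R (4 * om (q x) ^ 3 * (- 1 / Q)) *\<^sub>R 2 *\<^sub>R z x +
      om (q x) ^ 4 *\<^sub>R ((theta (y x))\<^sup>2 *\<^sub>R g' (s x) *\<^sub>R 2 *\<^sub>R rad x
        + (G (s x) / s x) *\<^sub>R (2 * theta (y x) * theta' (y x)) *\<^sub>R grad_y x)" for x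
  have w: "has_gradient_on w v U"
    unfolding w_def[abs_def] v_def[abs_def]
    by (rule has_gradient_product[OF theta_sq_deriv _ g g'c om_derivs(3)])
      (use scale_pos in \<open>auto intro!: continuous_intros continuous_on_om continuous_on_theta continuous_on_theta'\<close>)
  have w0: "w x = 0" if "x \<notin> K" for x
    using outside_K[OF that] theta_eq_0 unfolding w_def G_def by auto
  note ext = has_gradient_on_extend[OF w open_U compact_imp_closed[OF compact_K] K_subset_U w0]
  show thesis
  proof (rule that[OF ext[unfolded w_def]])
    fix x assume x: "x \<in> U"
    then have s: "s x > 0"
      unfolding U_def by simp
    have "v x \<bullet> rad x = om (q x) ^ 4 * (theta (y x))\<^sup>2 * g' (s x) * 2 * s x"
      unfolding v_def using grad_y_inner(2)[OF s] by (simp add: inner_add_left inner_diff_left)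
    moreover have "g' (s x) * s x = H (s x) - G (s x) / s x"
      unfolding g'_def using s by (simp add: field_simps)
    ultimately have "v x \<bullet> rad x = om (q x) ^ 4 * (theta (y x))\<^sup>2 * 2 * (H (s x) - G (s x) / s x)"
      by (metis mult.assoc mult.commute)
    then show "(if x \<in> U then v x else 0) \<bullet> rad x + (theta (y x))\<^sup>2 * (G (s x) / s x) * om (q x) ^ 4 * 2
      = (theta (y x))\<^sup>2 * om (q x) ^ 4 * (64 / 250000) * ((rho (s x))\<^sup>2 - rho (s x) ^ 3 - 3 / 16 * rho (s x) ^ 4) / s x"
      using x s unfolding H_def by (simp add: field_simps)
  qed auto
qed

lemma z_field:
  fixes m :: real and k :: "real \<Rightarrow> real"
  defines "k \<equiv> \<lambda>t. - 8 / (3 * Q) * om t ^ 3 - m / (3 * Q) * om t ^ 4"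
  obtains w' where "has_gradient_on (\<lambda>x. (theta (y x))\<^sup>2 * rho (s x) ^ 4 * k (q x)) w' UNIV"
    "\<And>x. x \<notin> K \<Longrightarrow> w' x = 0"
    "\<And>x. x \<in> U \<Longrightarrow> w' x \<bullet> z x + (theta (y x))\<^sup>2 * rho (s x) ^ 4 * k (q x) * m
      = (theta (y x))\<^sup>2 * rho (s x) ^ 4 * ((16 / Q) * ((om (q x))\<^sup>2 - om (q x) ^ 3) - m * (m + 8) / (3 * Q) * om (q x) ^ 4)"
proof -
  define k' where "k' t = - 8 / (3 * Q) * (3 * (om t)\<^sup>2 * (- 1 / Q)) - m / (3 * Q) * (4 * om t ^ 3 * (- 1 / Q))" for t
  have k: "(k has_real_derivative k' t) (at t)" for t
    unfolding k_def k'_def by (intro DERIV_diff DERIV_cmult om_derivs)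
  have k'c: "continuous_on UNIV k'"
    unfolding k'_def[abs_def] by (intro continuous_intros continuous_on_om)
  define g' where "g' t = 4 * rho t ^ 3 * (- ln (t / \<mu>\<^sup>2) / (125000 * t))" for t
  define w where "w x = (theta (y x))\<^sup>2 * rho (s x) ^ 4 * k (q x)" for x
  define v where "v x = ((theta (y x))\<^sup>2 * rho (s x) ^ 4) *\<^sub>R k' (q x) *\<^sub>R 2 *\<^sub>R z x +
      k (q x) *\<^sub>R ((theta (y x))\<^sup>2 *\<^sub>R g' (s x) *\<^sub>R 2 *\<^sub>R rad x
        + rho (s x) ^ 4 *\<^sub>R (2 * theta (y x) * theta' (y x)) *\<^sub>R grad_y x)" for x
  have w: "has_gradient_on w v U"
    unfolding w_def[abs_def] v_def[abs_def] g'_def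
    by (rule has_gradient_product[OF theta_sq_deriv _ rho_derivs(3) _ k k'c])
      (use scale_pos in \<open>auto intro!: continuous_intros continuous_on_rho continuous_on_theta continuous_on_theta'\<close>)
  have w0: "w x = 0" if "x \<notin> K" for x
    using outside_K[OF that] theta_eq_0 unfolding w_def k_def by auto
  note ext = has_gradient_on_extend[OF w open_U compact_imp_closed[OF compact_K] K_subset_U w0]
  show thesis
  proof (rule that[OF ext[unfolded w_def]])
    fix x assume x: "x \<in> U"
    then have s: "s x > 0"
      unfolding U_def by simp
    have "v x \<bullet> z x = (theta (y x))\<^sup>2 * rho (s x) ^ 4 * (2 * k' (q x) * q x)"
      unfolding v_def using grad_y_inner(3)[OF s] by (simp add: inner_add_left inner_diff_left q_def)
    moreover have "2 * k' (q x) * q x + k (q x) * m = (16 / Q) * ((om (q x))\<^sup>2 - om (q x) ^ 3) - m * (m + 8) / (3 * Q) * om (q x) ^ 4"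
    proof -
      \<comment> \<open>The cubic part of \<open>k\<close> produces the wanted difference of powers.
        The quartic part cancels the multiple of \<open>om ^ 3\<close> that appears because
        \<open>z\<close> has divergence \<open>m\<close>.\<close>
      have "2 * k' (q x) * q x = 16 / Q\<^sup>2 * (q x * om (q x) ^ Suc 1) + 8 * m / (3 * Q\<^sup>2) * (q x * om (q x) ^ Suc 2)"
        unfolding k'_def using scale_pos by (simp add: field_simps power2_eq_square power_numeral_reduce)
      then have "2 * k' (q x) * q x + k (q x) * m = 16 / Q\<^sup>2 * (q x * om (q x) ^ Suc 1)
        + 8 * m / (3 * Q\<^sup>2) * (q x * om (q x) ^ Suc 2) + k (q x) * m"
        by simp
      also have "\<dots> = (16 / Q) * ((om (q x))\<^sup>2 - om (q x) ^ 3) - m * (m + 8) / (3 * Q) * om (q x) ^ 4"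
        unfolding om_mult k_def using scale_pos
        by (simp add: field_simps power2_eq_square power_numeral_reduce)
      finally show ?thesis .
    qed
    ultimately show "(if x \<in> U then v x else 0) \<bullet> z x + (theta (y x))\<^sup>2 * rho (s x) ^ 4 * k (q x) * m
      = (theta (y x))\<^sup>2 * rho (s x) ^ 4 * ((16 / Q) * ((om (q x))\<^sup>2 - om (q x) ^ 3) - m * (m + 8) / (3 * Q) * om (q x) ^ 4)"
      using x by (simp add: distrib_left[symmetric] mult.assoc)
  qed auto
qed

lemma sum_Basis_inner: "(\<Sum>b\<in>Basis. (b \<bullet> u) * (v \<bullet> b)) = u \<bullet> (v :: 'a)"
  by (subst euclidean_inner) (simp add: inner_commute)

text \<open>The squared gradient exceeds \<open>\<kappa>\<close> times the Hardy density by at most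
  the three divergences, which integrate to zero. The condition on \<open>Q\<close> bounds the
  longitudinal error on \<open>K\<close>. \<open>D\<close> stands for the distance to the body,
  which near the edge is at most the distance to the half-hyperplane.\<close>

lemma energy_bound:
  fixes D :: "'a \<Rightarrow> real" and m :: real
  defines "m \<equiv> real DIM('a) - 2" and "\<kappa> \<equiv> 1 / 4 - 1 / (5000 * (exp 102 + 2))"
  assumes Q: "20000 * (m * (m + 8)) * (\<mu>\<^sup>2 * exp 500) \<le> 3 * Q" and "m \<ge> 0"
    and D: "\<And>x. x \<in> K \<Longrightarrow> D x > 0 \<and> (D x)\<^sup>2 \<le> (x2 x)\<^sup>2 + (max 0 (x1 x))\<^sup>2"
    and int: "integrable lborel (\<lambda>x. (inverse (D x) * psi x)\<^sup>2)"
  shows "integral\<^sup>L lborel (\<lambda>x. (norm (gradient psi x))\<^sup>2)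
    \<le> \<kappa> * integral\<^sup>L lborel (\<lambda>x. (inverse (D x) * psi x)\<^sup>2)"
proof -
  define wA where "wA x = nu (y x) * (rho (s x) ^ 4 * (- 1 / (2 * (s x * sqrt (s x))))) * om (q x) ^ 4" for x
  obtain A' where A: "has_gradient_on wA A' UNIV" "\<And>x. x \<notin> K \<Longrightarrow> A' x = 0"
    and A': "\<And>x. x \<in> U \<Longrightarrow> A' x \<bullet> (x2 x *\<^sub>R rot x) + wA x * x1 x
      = rho (s x) ^ 4 * om (q x) ^ 4 * (y x * (1 - y x) * nu' (y x) + (1 / 2 - y x) * nu (y x)) / s x"
    unfolding wA_def[abs_def] by (rule rot_field) blast
  define G where "G = (\<lambda>t. - (32 / 250000) * (ln (t / \<mu>\<^sup>2) * rho t ^ 4 / 48 + ln (t / \<mu>\<^sup>2) * rho t ^ 3 / 6))"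
  define wB where "wB x = (theta (y x))\<^sup>2 * (G (s x) / s x) * om (q x) ^ 4" for x
  obtain B' where B: "has_gradient_on wB B' UNIV" "\<And>x. x \<notin> K \<Longrightarrow> B' x = 0"
    and B': "\<And>x. x \<in> U \<Longrightarrow> B' x \<bullet> rad x + wB x * 2
      = (theta (y x))\<^sup>2 * om (q x) ^ 4 * (64 / 250000) * ((rho (s x))\<^sup>2 - rho (s x) ^ 3 - 3 / 16 * rho (s x) ^ 4) / s x"
    unfolding wB_def[abs_def] G_def by (rule rad_field) blast
  define wC where "wC x = (theta (y x))\<^sup>2 * rho (s x) ^ 4 * (- 8 / (3 * Q) * om (q x) ^ 3 - m / (3 * Q) * om (q x) ^ 4)" for x
  obtain C' where C: "has_gradient_on wC C' UNIV" "\<And>x. x \<notin> K \<Longrightarrow> C' x = 0"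
    and C': "\<And>x. x \<in> U \<Longrightarrow> C' x \<bullet> z x + wC x * m
      = (theta (y x))\<^sup>2 * rho (s x) ^ 4 * ((16 / Q) * ((om (q x))\<^sup>2 - om (q x) ^ 3) - m * (m + 8) / (3 * Q) * om (q x) ^ 4)"
    unfolding wC_def[abs_def] by (rule z_field) blast
  have w0: "wA x = 0" "wB x = 0" "wC x = 0" if "x \<notin> K" for x
    using outside_K[OF that] theta_eq_0 nu_eq_0 unfolding wA_def wB_def wC_def G_def by auto
  define dA dB dC where "dA x = A' x \<bullet> (x2 x *\<^sub>R rot x) + wA x * x1 x"
    and "dB x = B' x \<bullet> rad x + wB x * 2" and "dC x = C' x \<bullet> z x + wC x * m" for x
  have dA: "integrable lborel dA" "integral\<^sup>L lborel dA = 0"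
  proof -
    have V: "((\<lambda>x. x2 x *\<^sub>R rot x) has_derivative
      (\<lambda>h. x2 x *\<^sub>R ((h \<bullet> e1) *\<^sub>R e2 - (h \<bullet> e2) *\<^sub>R e1) + (h \<bullet> e2) *\<^sub>R rot x)) (at x)" for x
      by (rule has_derivative_scaleR[OF x2_has_derivative rot_has_derivative])
    have t: "(\<Sum>b\<in>Basis. (x2 x *\<^sub>R ((b \<bullet> e1) *\<^sub>R e2 - (b \<bullet> e2) *\<^sub>R e1) + (b \<bullet> e2) *\<^sub>R rot x) \<bullet> b) = x1 x" for x
    proof -
      have "(\<Sum>b\<in>Basis. (x2 x *\<^sub>R ((b \<bullet> e1) *\<^sub>R e2 - (b \<bullet> e2) *\<^sub>R e1) + (b \<bullet> e2) *\<^sub>R rot x) \<bullet> b)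
        = x2 x * ((\<Sum>b\<in>Basis. (b \<bullet> e1) * (e2 \<bullet> b)) - (\<Sum>b\<in>Basis. (b \<bullet> e2) * (e1 \<bullet> b)))
          + (\<Sum>b\<in>Basis. (b \<bullet> e2) * (rot x \<bullet> b))"
        by (simp add: inner_add_left inner_diff_left sum.distrib sum_subtractf sum_distrib_left right_diff_distrib)
      also have "\<dots> = e2 \<bullet> rot x"
        unfolding sum_Basis_inner by (simp add: orth orth')
      finally show ?thesis
        unfolding rot_def by (simp add: inner_diff_right norm_e orth')
    qed
    have c: "continuous_on UNIV (\<lambda>x. x2 x *\<^sub>R ((b \<bullet> e1) *\<^sub>R e2 - (b \<bullet> e2) *\<^sub>R e1) + (b \<bullet> e2) *\<^sub>R rot x)" for b
      by (intro continuous_intros)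
    show "integrable lborel dA" "integral\<^sup>L lborel dA = 0"
      unfolding dA_def[abs_def] by (rule integral_divergence[OF A(1) compact_K w0(1) V t c]; assumption)+
  qed
  have dB: "integrable lborel dB" "integral\<^sup>L lborel dB = 0"
  proof -
    have t: "(\<Sum>b\<in>Basis. ((b \<bullet> e1) *\<^sub>R e1 + (b \<bullet> e2) *\<^sub>R e2) \<bullet> b) = 2"
      by (simp add: inner_add_left sum.distrib sum_Basis_inner norm_e)
    have c: "continuous_on UNIV (\<lambda>x::'a. (b \<bullet> e1) *\<^sub>R e1 + (b \<bullet> e2) *\<^sub>R e2)" for b
      by (intro continuous_intros)
    show "integrable lborel dB" "integral\<^sup>L lborel dB = 0"
      unfolding dB_def[abs_def] by (rule integral_divergence[OF B(1) compact_K w0(2) rad_has_derivative t c]; assumption)+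
  qed
  have dC: "integrable lborel dC" "integral\<^sup>L lborel dC = 0"
  proof -
    have t: "(\<Sum>b\<in>Basis. (b - ((b \<bullet> e1) *\<^sub>R e1 + (b \<bullet> e2) *\<^sub>R e2)) \<bullet> b) = m"
      by (simp add: inner_add_left inner_diff_left sum.distrib sum_subtractf sum_Basis_inner norm_e m_def)
    have c: "continuous_on UNIV (\<lambda>x::'a. b - ((b \<bullet> e1) *\<^sub>R e1 + (b \<bullet> e2) *\<^sub>R e2))" for b
      by (intro continuous_intros)
    show "integrable lborel dC" "integral\<^sup>L lborel dC = 0"
      unfolding dC_def[abs_def] by (rule integral_divergence[OF C(1) compact_K w0(3) z_has_derivative t c]; assumption)+
  qed
  have psi_C1: "psi \<in> C1_c UNIV" "\<And>x. x \<in> U \<Longrightarrow> gradient psi x = grad_psi x"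
    using C1_cI[OF has_gradient_psi open_U compact_K K_subset_U subset_UNIV psi_outside] by auto
  have psi_ext: "has_gradient_on psi (gradient psi) UNIV"
    by (rule C1_cD(1)[OF psi_C1(1)])
  have grad0: "gradient psi x = 0" if "x \<notin> U" for x
  proof -
    note ext = has_gradient_on_extend[OF has_gradient_psi open_U compact_imp_closed[OF compact_K] K_subset_U psi_outside]
    have "GDERIV psi x :> 0"
      using ext(1) that unfolding has_gradient_on_def by (auto dest: spec[of _ x])
    then show ?thesis
      by (rule gradient_eqI)
  qed
  have k4: "0 \<le> \<kappa>"
  proof -
    have "M > 0 \<Longrightarrow> 0 \<le> 1 / 4 - 1 / (5000 * (M + 2))" for M :: real
      by (simp add: field_simps)
    then show ?thesis
      unfolding \<kappa>_def using exp_gt_zero by blast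
  qed
  have pointwise: "(norm (gradient psi x))\<^sup>2 \<le> dA x + dB x + dC x + \<kappa> * (inverse (D x) * psi x)\<^sup>2" for x
  proof (cases "x \<in> U")
    case False
    then have "x \<notin> K"
      using K_subset_U by auto
    then show ?thesis
      using False grad0 A(2) B(2) C(2) w0 psi_outside unfolding dA_def dB_def dC_def by simp
  next
    case True
    then have s: "s x > 0" and y: "y x > 0"
      unfolding U_def by auto
    define r w t where "r = rho (s x)" and "w = om (q x)" and "t = theta (y x)"
    define P where "P = t\<^sup>2 * r ^ 4 * w ^ 4"
    have psiP: "(psi x)\<^sup>2 = P"
      unfolding psi_def P_def r_def w_def t_def by (simp add: power_mult_distrib flip: power_mult)
    have P: "P \<ge> 0"
      unfolding psiP[symmetric] by simp
    have "(norm (gradient psi x))\<^sup>2 = r ^ 4 * w ^ 4 * (y x * (1 - y x) * (theta' (y x))\<^sup>2) / s x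
      + t\<^sup>2 * w ^ 4 * (64 / 250000) * (r\<^sup>2 - r ^ 3) / s x + t\<^sup>2 * r ^ 4 * (16 / Q) * (w\<^sup>2 - w ^ 3)"
      unfolding psi_C1(2)[OF True] grad_psi_norm[OF True] r_def w_def t_def ..
    \<comment> \<open>Inserting the divergences leaves the left-hand side of
      \<open>angular_inequality\<close>, a radial remainder with 12 / 250000 = 3/16 * 64 / 250000,
      and the longitudinal remainder; the last two are multiples of \<open>P\<close>, the square of
      \<open>psi\<close>.\<close>
    also have "\<dots> = dA x + dB x + dC x
      + r ^ 4 * w ^ 4 / s x * (y x * (1 - y x) * (theta' (y x))\<^sup>2 - y x * (1 - y x) * nu' (y x) - (1 / 2 - y x) * nu (y x))
      + 12 / 250000 * P / s x + m * (m + 8) / (3 * Q) * P"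
      unfolding dA_def dB_def dC_def A'[OF True] B'[OF True] C'[OF True] P_def
      unfolding r_def[symmetric] w_def[symmetric] t_def[symmetric]
      using s scale_pos by (simp add: field_simps)
    also have "\<dots> \<le> dA x + dB x + dC x
      + r ^ 4 * w ^ 4 / s x * (t\<^sup>2 * ((1 / y x + 1 + y x) / 16 - 1 / 6400))
      + 12 / 250000 * P / s x + m * (m + 8) / (3 * Q) * P"
      unfolding t_def using angular_inequality[OF y y_bounds(2)] s
      by (intro add_mono mult_left_mono order_refl) (auto simp: r_def w_def rho_def om_def gam_def)
    also have "\<dots> = dA x + dB x + dC x
      + P * ((1 / y x + 1 + y x) / 16 - 1 / 6400 + 12 / 250000 + m * (m + 8) / (3 * Q) * s x) / s x"
      unfolding P_def using s scale_pos by (simp add: field_simps)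
    also have "\<dots> \<le> dA x + dB x + dC x + \<kappa> * (inverse (D x) * psi x)\<^sup>2"
    proof (cases "x \<in> K")
      case False
      then have "P = 0"
        using psi_outside psiP by simp
      then show ?thesis
        using k4 by simp
    next
      case K: True
      \<comment> \<open>For \<open>W / 4 / s x\<close> as a lower bound of the inverse squared
        distance, \<open>\<kappa>\<close> must be below 1/4 by an amount that stays harmless when
        multiplied by \<open>W\<close>. This is where the bound \<open>exp 102 + 2\<close> of
        \<open>W\<close> on \<open>K\<close> enters.\<close>
      define W where "W = 1 / y x + 1 + y x"
      have "m * (m + 8) / (3 * Q) * s x \<le> m * (m + 8) / (3 * Q) * (\<mu>\<^sup>2 * exp 500)"
        using K \<open>m \<ge> 0\<close> scale_pos unfolding K_def by (intro mult_left_mono) auto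
      also have "\<dots> = m * (m + 8) * (\<mu>\<^sup>2 * exp 500) / (3 * Q)"
        by simp
      also have "\<dots> \<le> 1 / 20000"
        using Q scale_pos by (simp add: pos_divide_le_eq)
      finally have 1: "m * (m + 8) / (3 * Q) * s x \<le> 1 / 20000" .
      have "1 / y x \<le> 1 / exp (- 102)"
        using K_y[OF K] y by (intro divide_left_mono) auto
      then have W: "W \<le> exp 102 + 2"
        unfolding W_def using y_bounds(2)[of x] by (simp add: exp_minus inverse_eq_divide)
      have "0 < exp (102::real) + 2"
        by (simp add: add_pos_pos)
      then have "W / (20000 * (exp 102 + 2)) \<le> 1 / 20000"
        using W by (simp add: divide_simps)
      moreover have "\<kappa> * (W / 4) = W / 16 - W / (20000 * (exp 102 + 2))"
      proof -
        have "(1 / 4 - 1 / (5000 * M)) * (W / 4) = W / 16 - W / (20000 * M)" for M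
          by (simp add: left_diff_distrib)
        then show ?thesis
          unfolding \<kappa>_def .
      qed
      \<comment> \<open>The budget: 1/6400 exceeds the sum of 12/250000 (radial cutoff), 1/20000
        (longitudinal cutoff) and 1/20000 (passage from 1/4 to \<open>\<kappa>\<close>).\<close>
      ultimately have 2: "W / 16 - 1 / 6400 + 12 / 250000 + m * (m + 8) / (3 * Q) * s x \<le> \<kappa> * (W / 4)"
        using 1 by simp
      \<comment> \<open>For y < 1/2 this rests on y (1 - y) W = 1 - y^3 <= 1; for y >= 1/2 the
        squared distance is at most \<open>s x\<close> and W <= 4.\<close>
      have 3: "W / 4 / s x \<le> 1 / (D x)\<^sup>2"
      proof -
        have "(x2 x)\<^sup>2 + (max 0 (x1 x))\<^sup>2 \<le> 4 * s x / W"
        proof (cases "y x < 1 / 2")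
          case True
          then have "x1 x \<le> 0"
            unfolding x1_eq[OF s] using s by (simp add: mult_le_0_iff)
          then have "(x2 x)\<^sup>2 + (max 0 (x1 x))\<^sup>2 = 4 * s x * (y x * (1 - y x))"
            unfolding x2_sq[OF s] by simp
          moreover have "y x * (1 - y x) \<le> 1 / W"
          proof -
            have "y x * (1 - y x) * W = 1 - y x ^ 3"
              unfolding W_def using y by (simp add: field_simps power_numeral_reduce)
            then show ?thesis
              using y unfolding W_def by (simp add: pos_le_divide_eq add_pos_pos)
          qed
          ultimately show ?thesis
            using s mult_left_mono[of "y x * (1 - y x)" "1 / W" "4 * s x"] by simp
        next
          case False
          have "(max 0 (x1 x))\<^sup>2 \<le> (x1 x)\<^sup>2"
            by (simp add: max_def)
          then have "(x2 x)\<^sup>2 + (max 0 (x1 x))\<^sup>2 \<le> s x"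
            unfolding s_def by simp
          moreover have "W \<le> 4"
          proof -
            have "(y x - 1 / 2) * (1 - y x) \<ge> 0"
              using False y_bounds(2)[of x] by simp
            then have "1 + y x + (y x)\<^sup>2 \<le> 4 * y x"
              using False by (simp add: algebra_simps power2_eq_square)
            then show ?thesis
              unfolding W_def using y by (simp add: field_simps power2_eq_square)
          qed
          moreover have "W > 0"
            unfolding W_def using y by (simp add: add_pos_pos)
          moreover from calculation have "s x \<le> 4 * s x / W"
            using s mult_left_mono[of W 4 "s x"] by (simp add: pos_le_divide_eq)
          ultimately show ?thesis
            by linarith
        qed
        then have "(D x)\<^sup>2 \<le> 4 * s x / W"
          using D[OF K] by linarith
        moreover have "W > 0"
          unfolding W_def using y by (simp add: add_pos_pos)
        ultimately have "1 / (4 * s x / W) \<le> 1 / (D x)\<^sup>2"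
          using D[OF K] s by (intro divide_left_mono) auto
        then show ?thesis by simp
      qed
      have "P * (W / 16 - 1 / 6400 + 12 / 250000 + m * (m + 8) / (3 * Q) * s x) / s x \<le> P * (\<kappa> * (W / 4)) / s x"
        using 2 P s by (intro divide_right_mono mult_left_mono) auto
      also have "\<dots> = \<kappa> * P * (W / 4 / s x)"
        by simp
      also have "\<dots> \<le> \<kappa> * P * (1 / (D x)\<^sup>2)"
        using 3 k4 P by (intro mult_left_mono) auto
      also have "\<dots> = \<kappa> * (inverse (D x) * psi x)\<^sup>2"
        by (simp add: power_mult_distrib psiP inverse_eq_divide power_divide)
      finally show ?thesis
        unfolding W_def by simp
    qed
    finally show ?thesis .
  qed
  have gint: "integrable lborel (\<lambda>x. (norm (gradient psi x))\<^sup>2)"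
    using psi_ext grad0 K_subset_U unfolding has_gradient_on_def
  proof (intro integrable_compact_support[OF _ compact_K] continuous_intros)
    fix x assume "x \<notin> K"
    then have "(if x \<in> U then grad_psi x else 0) = 0"
      by (intro has_gradient_on_extend(2)[OF has_gradient_psi open_U compact_imp_closed[OF compact_K] K_subset_U])
        (auto intro: psi_outside)
    then show "(norm (gradient psi x))\<^sup>2 = 0"
      using grad0[of x] psi_C1(2)[of x] by (cases "x \<in> U") auto
  qed auto
  have "integral\<^sup>L lborel (\<lambda>x. (norm (gradient psi x))\<^sup>2)
    \<le> integral\<^sup>L lborel (\<lambda>x. dA x + dB x + dC x + \<kappa> * (inverse (D x) * psi x)\<^sup>2)"
    using pointwise dA(1) dB(1) dC(1) int gint by (intro integral_mono) auto
  also have "\<dots> = \<kappa> * integral\<^sup>L lborel (\<lambda>x. (inverse (D x) * psi x)\<^sup>2)"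
    using dA dB dC int by simp
  finally show ?thesis .
qed

end

section \<open>Facets, edges and dihedral angles\<close>

lemma facet_halfspace:
  fixes S :: "'a::euclidean_space set"
  assumes "polytope S" "aff_dim S = int DIM('a)" "F facet_of S"
  obtains a b where "norm a = 1" "S \<subseteq> {x. a \<bullet> x \<le> b}" "F = S \<inter> {x. a \<bullet> x = b}"
    "affine hull F = {x. a \<bullet> x = b}"
proof -
  obtain a0 b0 where a0: "a0 \<noteq> 0" "S \<subseteq> {x. a0 \<bullet> x \<le> b0}" "F = S \<inter> {x. a0 \<bullet> x = b0}"
    using facet_of_polyhedron[OF polytope_imp_polyhedron[OF assms(1)] assms(3)] by metis
  define a b where "a = a0 /\<^sub>R norm a0" and "b = b0 / norm a0"
  have n: "norm a0 > 0"
    using a0 by simp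
  have le: "a \<bullet> x \<le> b \<longleftrightarrow> a0 \<bullet> x \<le> b0" and eq: "a \<bullet> x = b \<longleftrightarrow> a0 \<bullet> x = b0" for x
    unfolding a_def b_def using n by (auto simp: field_simps)
  have F: "F = S \<inter> {x. a \<bullet> x = b}"
    unfolding eq by (rule a0)
  have "affine hull F = {x. a \<bullet> x = b}"
  proof (rule affine_dim_equal)
    show "affine {x. a \<bullet> x = b}"
      by (rule affine_hyperplane)
    then show "affine hull F \<subseteq> {x. a \<bullet> x = b}"
      using F by (intro hull_minimal) auto
    show "affine hull F \<noteq> {}"
      using assms(3) unfolding facet_of_def by simp
    have "a \<noteq> 0"
      using a0 n unfolding a_def by simp
    then show "aff_dim (affine hull F) = aff_dim {x. a \<bullet> x = b}"
      using assms unfolding facet_of_def by simp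
  qed simp
  then show thesis
    using that[of a b] F a0(1,2) le n unfolding a_def by simp
qed

text \<open>Equality in Cauchy-Schwarz would make the two normals parallel, and parallel hyperplanes
  with a common point coincide.\<close>

lemma unit_inner_less_1:
  fixes a c :: "'a::euclidean_space"
  assumes "norm a = 1" "norm c = 1" "{x. a \<bullet> x = b} \<noteq> {x. c \<bullet> x = d}" "a \<bullet> p = b" "c \<bullet> p = d"
  shows "(a \<bullet> c)\<^sup>2 < 1"
proof (rule ccontr)
  define t where "t = a \<bullet> c"
  assume "\<not> (a \<bullet> c)\<^sup>2 < 1"
  moreover have "\<bar>a \<bullet> c\<bar> \<le> 1"
    using Cauchy_Schwarz_ineq2[of a c] assms by simp
  ultimately have t: "t\<^sup>2 = 1"
    unfolding t_def by (simp add: abs_square_le_1 order_antisym)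
  have "a \<bullet> a = 1" "c \<bullet> c = 1"
    using assms(1,2) by (simp_all add: dot_square_norm)
  then have "(c - t *\<^sub>R a) \<bullet> (c - t *\<^sub>R a) = 1 - t\<^sup>2"
    by (simp add: inner_diff_left inner_diff_right inner_commute[of c a] t_def power2_eq_square)
  then have c: "c = t *\<^sub>R a"
    using t by simp
  have "t \<noteq> 0"
    using t by auto
  have "d = t * b"
    using assms(4,5) c by auto
  then have "{x. a \<bullet> x = b} = {x. c \<bullet> x = d}"
    using c \<open>t \<noteq> 0\<close> by auto
  then show False
    using assms(3) by simp
qed

text \<open>Being perpendicular to the edge, \<open>u\<close> lies in the span of the normals; being
  orthogonal to \<open>a\<close>, it is a multiple of the component of \<open>c\<close> orthogonal
  to \<open>a\<close>. Its length fixes the multiple up to sign, and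
  \<open>c \<bullet> u \<le> 0\<close> fixes the sign.\<close>

lemma edge_direction:
  fixes a c u :: "'a::euclidean_space"
  assumes "a \<bullet> a = 1" "c \<bullet> c = 1" "(a \<bullet> c)\<^sup>2 < 1" "u \<bullet> u = 1" "a \<bullet> u = 0" "c \<bullet> u \<le> 0"
    and perp: "\<And>w. a \<bullet> w = 0 \<Longrightarrow> c \<bullet> w = 0 \<Longrightarrow> u \<bullet> w = 0"
  shows "u = (- 1 / sqrt (1 - (a \<bullet> c)\<^sup>2)) *\<^sub>R (c - (a \<bullet> c) *\<^sub>R a)"
proof -
  define t f k where "t = a \<bullet> c" and "f = c - t *\<^sub>R a" and "k = u \<bullet> f / (1 - t\<^sup>2)"
  have ca: "c \<bullet> a = t"
    unfolding t_def by (rule inner_commute)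
  have f: "f \<bullet> f = 1 - t\<^sup>2" "a \<bullet> f = 0" "c \<bullet> f = 1 - t\<^sup>2"
    unfolding f_def using assms(1,2) ca
    by (simp_all add: inner_diff_left inner_diff_right power2_eq_square t_def)
  have pos: "1 - t\<^sup>2 > 0"
    using assms(3) unfolding t_def by simp
  define w where "w = u - k *\<^sub>R f"
  have fw: "f \<bullet> w = 0"
    unfolding w_def k_def using f(1) pos by (simp add: inner_diff_right inner_commute[of f u])
  have aw: "a \<bullet> w = 0"
    unfolding w_def using f(2) assms(5) by (simp add: inner_diff_right)
  have "c \<bullet> w = 0"
    using fw aw unfolding f_def by (simp add: inner_diff_left)
  then have uw: "u \<bullet> w = 0"
    by (rule perp[OF aw])
  have "w \<bullet> w = u \<bullet> w - k * (f \<bullet> w)"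
    by (subst (1) w_def) (simp add: inner_diff_left)
  then have "w = 0"
    using fw uw by simp
  then have u: "u = k *\<^sub>R f"
    unfolding w_def by simp
  have "k \<le> 0"
    using assms(6) pos f(3) unfolding u by (simp add: mult_le_0_iff)
  moreover have "k\<^sup>2 * (1 - t\<^sup>2) = 1"
    using assms(4) f(1) unfolding u by (simp add: power2_eq_square)
  then have "(- k * sqrt (1 - t\<^sup>2))\<^sup>2 = 1"
    using pos by (simp add: power_mult_distrib)
  ultimately have "- k * sqrt (1 - t\<^sup>2) = 1"
    using pos by (simp add: power2_eq_1_iff) (smt (verit) mult_nonpos_nonneg real_sqrt_ge_zero)
  then have "k = - 1 / sqrt (1 - t\<^sup>2)"
    using pos by (simp add: field_simps)
  then show ?thesis
    using u unfolding f_def t_def by simp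
qed

text \<open>The wedge lies in both half-spaces, so each ray satisfies the sign condition of
  \<open>edge_direction\<close>. This determines \<open>u\<close> and \<open>v\<close>, whose inner
  product is minus that of the outer normals.\<close>

lemma dihedral_angle_eq:
  fixes S :: "'a::euclidean_space set"
  assumes "norm a = 1" "norm c = 1" "S \<subseteq> {x. a \<bullet> x \<le> b}" "S \<subseteq> {x. c \<bullet> x \<le> d}"
    and ne: "{x. a \<bullet> x = b} \<noteq> {x. c \<bullet> x = d}"
    and ang: "dihedral_angle S {x. a \<bullet> x = b} {x. c \<bullet> x = d} \<theta>"
  shows "\<theta> = arccos (- (a \<bullet> c))" "(a \<bullet> c)\<^sup>2 < 1"
proof -
  obtain p u v where p: "a \<bullet> p = b" "c \<bullet> p = d" and uv: "norm u = 1" "norm v = 1"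
    and pu: "a \<bullet> (p + u) = b" "p + u \<in> wedge S {x. a \<bullet> x = b} {x. c \<bullet> x = d}"
    and pv: "c \<bullet> (p + v) = d" "p + v \<in> wedge S {x. a \<bullet> x = b} {x. c \<bullet> x = d}"
    and perp: "\<And>q. a \<bullet> q = b \<Longrightarrow> c \<bullet> q = d \<Longrightarrow> u \<bullet> (q - p) = 0 \<and> v \<bullet> (q - p) = 0"
    and \<theta>: "\<theta> = arccos (u \<bullet> v)"
    using ang unfolding dihedral_angle_def by blast
  show t: "(a \<bullet> c)\<^sup>2 < 1"
    by (rule unit_inner_less_1[OF assms(1,2) ne p])
  have sq: "a \<bullet> a = 1" "c \<bullet> c = 1" "u \<bullet> u = 1" "v \<bullet> v = 1"
    using assms(1,2) uv by (simp_all add: dot_square_norm)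
  have "a \<noteq> 0" "c \<noteq> 0"
    using assms(1,2) by auto
  then have w: "wedge S {x. a \<bullet> x = b} {x. c \<bullet> x = d} \<subseteq> {x. a \<bullet> x \<le> b}"
    "wedge S {x. a \<bullet> x = b} {x. c \<bullet> x = d} \<subseteq> {x. c \<bullet> x \<le> d}"
    unfolding wedge_def using assms(3,4) by (intro Inter_lower; blast)+
  have perp': "u \<bullet> w = 0" "v \<bullet> w = 0" if "a \<bullet> w = 0" "c \<bullet> w = 0" for w
    using perp[of "p + w"] p that by (simp_all add: inner_add_right)
  have "u = (- 1 / sqrt (1 - (a \<bullet> c)\<^sup>2)) *\<^sub>R (c - (a \<bullet> c) *\<^sub>R a)"
    using pu pv p w sq t perp'
    by (intro edge_direction) (auto simp: inner_add_right subset_iff)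
  moreover have "v = (- 1 / sqrt (1 - (c \<bullet> a)\<^sup>2)) *\<^sub>R (a - (c \<bullet> a) *\<^sub>R c)"
    using pu pv p w sq t perp'
    by (intro edge_direction) (auto simp: inner_add_right subset_iff inner_commute[of c a])
  ultimately have "u \<bullet> v = (1 / (1 - (a \<bullet> c)\<^sup>2)) * ((c - (a \<bullet> c) *\<^sub>R a) \<bullet> (a - (a \<bullet> c) *\<^sub>R c))"
    using t by (simp add: inner_commute[of c a])
  also have "(c - (a \<bullet> c) *\<^sub>R a) \<bullet> (a - (a \<bullet> c) *\<^sub>R c) = - (a \<bullet> c) * (1 - (a \<bullet> c)\<^sup>2)"
    using sq by (simp add: inner_diff_left inner_diff_right inner_commute[of c a] power2_eq_square algebra_simps)
  finally show "\<theta> = arccos (- (a \<bullet> c))"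
    unfolding \<theta> using t by simp
qed

section \<open>The body near a common edge of two facets\<close>

lemma aff_dim_edge:
  fixes a c :: "'a::euclidean_space"
  assumes a: "norm a = 1" "norm c = 1" "(a \<bullet> c)\<^sup>2 < 1" and pab: "a \<bullet> p = b" "c \<bullet> p = d"
  shows "aff_dim ({x. a \<bullet> x = b} \<inter> {x. c \<bullet> x = d}) = int DIM('a) - 2"
proof -
  have a0: "a \<noteq> 0" "c \<noteq> 0"
    using a by auto
  define f where "f = c - (a \<bullet> c) *\<^sub>R a"
  have "a \<bullet> a = 1" "c \<bullet> c = 1"
    using a by (simp_all add: dot_square_norm)
  then have "a \<bullet> f = 0" "c \<bullet> f = 1 - (a \<bullet> c)\<^sup>2"
    unfolding f_def by (simp_all add: inner_diff_right inner_commute[of c a] power2_eq_square)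
  then have "p + f \<in> {x. a \<bullet> x = b}" "p + f \<notin> {x. c \<bullet> x = d}"
    using pab a(3) by (auto simp: inner_add_right)
  then have "\<not> {x. a \<bullet> x = b} \<subseteq> {x. c \<bullet> x = d}"
    by blast
  moreover have "{x. a \<bullet> x = b} \<inter> {x. c \<bullet> x = d} \<noteq> {}"
    using pab by blast
  ultimately show "aff_dim ({x. a \<bullet> x = b} \<inter> {x. c \<bullet> x = d}) = int DIM('a) - 2"
    using a0 by (simp add: aff_dim_affine_Int_hyperplane affine_hyperplane)
qed

text \<open>Near a relative interior point of the edge, the facet fills the half-hyperplane: a small
  displacement is reached by a convex combination of a nearby edge point and one fixed facet point
  \<open>g\<close> off the edge.\<close>

lemma edge_neighbourhood:
  fixes S :: "'a::euclidean_space set"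
  assumes S: "convex S" and a: "norm a = 1" "norm c = 1" "(a \<bullet> c)\<^sup>2 < 1"
    and Sc: "S \<subseteq> {x. c \<bullet> x \<le> d}"
    and F: "F = S \<inter> {x. a \<bullet> x = b}" "affine hull F = {x. a \<bullet> x = b}" and G: "G = S \<inter> {x. c \<bullet> x = d}"
    and dim: "aff_dim (F \<inter> G) = int DIM('a) - 2" "DIM('a) \<ge> 2"
  obtains p r where "r > 0" "a \<bullet> p = b" "c \<bullet> p = d" "p \<in> S"
    "\<And>\<xi>. norm \<xi> < r \<Longrightarrow> a \<bullet> \<xi> = 0 \<Longrightarrow> c \<bullet> \<xi> \<le> 0 \<Longrightarrow> p + \<xi> \<in> S"
proof -
  define E where "E = F \<inter> G"
  have a0: "a \<noteq> 0" "c \<noteq> 0"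
    using a by auto
  have E: "E = S \<inter> {x. a \<bullet> x = b} \<inter> {x. c \<bullet> x = d}"
    unfolding E_def F(1) G by auto
  have "E \<noteq> {}"
  proof
    assume "E = {}"
    then have "aff_dim (F \<inter> G) = -1"
      unfolding E_def by simp
    then show False
      using dim by linarith
  qed
  have "convex E"
    unfolding E by (intro convex_Int S convex_hyperplane)
  then obtain p where p: "p \<in> rel_interior E"
    using \<open>E \<noteq> {}\<close> rel_interior_eq_empty by blast
  then obtain e where e: "e > 0" "ball p e \<inter> affine hull E \<subseteq> E" and pE: "p \<in> E"
    unfolding mem_rel_interior_ball by blast
  have pab: "a \<bullet> p = b" "c \<bullet> p = d"
    using pE unfolding E by auto
  have hull: "affine hull E = {x. a \<bullet> x = b} \<inter> {x. c \<bullet> x = d}"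
  proof (rule affine_dim_equal)
    show "affine ({x. a \<bullet> x = b} \<inter> {x. c \<bullet> x = d})"
      by (intro affine_Int affine_hyperplane)
    then show "affine hull E \<subseteq> {x. a \<bullet> x = b} \<inter> {x. c \<bullet> x = d}"
      unfolding E by (intro hull_minimal) auto
    show "affine hull E \<noteq> {}"
      using \<open>E \<noteq> {}\<close> by simp
    have "aff_dim ({x. a \<bullet> x = b} \<inter> {x. c \<bullet> x = d}) = int DIM('a) - 2"
      by (rule aff_dim_edge[OF a pab])
    then show "aff_dim (affine hull E) = aff_dim ({x. a \<bullet> x = b} \<inter> {x. c \<bullet> x = d})"
      using dim(1) unfolding E_def by simp
  qed simp
  have "\<not> F \<subseteq> affine hull E"
  proof
    assume "F \<subseteq> affine hull E"
    then have "aff_dim F \<le> aff_dim E"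
      using aff_dim_subset[of F "affine hull E"] by simp
    moreover have "aff_dim F = int DIM('a) - 1"
      using aff_dim_affine_hull[of F] a0 unfolding F(2) by simp
    ultimately show False
      using dim(1) unfolding E_def by simp
  qed
  then obtain g where g: "g \<in> F" "g \<notin> affine hull E"
    by blast
  then have gS: "g \<in> S" "a \<bullet> g = b" "c \<bullet> g < d"
    using Sc unfolding F(1) hull by force+
  define w where "w = g - p"
  have w: "a \<bullet> w = 0" "c \<bullet> w < 0"
    unfolding w_def using gS pab by (simp_all add: inner_diff_right)
  define \<tau> where "\<tau> = - (c \<bullet> w)"
  have \<tau>: "\<tau> > 0"
    unfolding \<tau>_def using w by simp
  \<comment> \<open>The displacement along the edge is at most \<open>M\<close> times the norm of
    \<xi>. Together with k < 1/2 and the resulting factor 1 / (1 - k) <= 2, this explains both terms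
    in the choice of \<open>r\<close>.\<close>
  define M where "M = 1 + norm w / \<tau>"
  have M: "M > 0"
    unfolding M_def using \<tau> by (simp add: add_pos_nonneg)
  define r where "r = min (\<tau> / 2) (e / (2 * M))"
  have r: "r > 0"
    unfolding r_def using \<tau> e M by simp
  show thesis
  proof (rule that[OF r pab])
    show "p \<in> S"
      using pE unfolding E by auto
    fix \<xi> assume \<xi>: "norm \<xi> < r" "a \<bullet> \<xi> = 0" "c \<bullet> \<xi> \<le> 0"
    \<comment> \<open>With this weight of \<open>g\<close>, the remainder \<open>\<eta>\<close> is
      parallel to the edge.\<close>
    define k where "k = - (c \<bullet> \<xi>) / \<tau>"
    have "\<bar>c \<bullet> \<xi>\<bar> \<le> norm \<xi>"
      using Cauchy_Schwarz_ineq2[of c \<xi>] a(2) by simp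
    then have ck: "- (c \<bullet> \<xi>) \<le> norm \<xi>"
      by linarith
    have k0: "k \<ge> 0"
      unfolding k_def using \<xi>(3) \<tau> by (simp add: divide_nonpos_pos)
    have kn: "k \<le> norm \<xi> / \<tau>"
      unfolding k_def using ck \<tau> by (intro divide_right_mono) auto
    have "norm \<xi> < \<tau> / 2"
      using \<xi>(1) unfolding r_def by simp
    then have "norm \<xi> / \<tau> < 1 / 2"
      using \<tau> by (simp add: field_simps)
    with kn have k1: "k < 1 / 2"
      by linarith
    define \<eta> where "\<eta> = \<xi> - k *\<^sub>R w"
    have "a \<bullet> \<eta> = 0" "c \<bullet> \<eta> = 0"
      unfolding \<eta>_def k_def using \<xi>(2) w \<tau> by (simp_all add: inner_diff_right \<tau>_def)
    define p' where "p' = p + (1 / (1 - k)) *\<^sub>R \<eta>"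
    have "p' \<in> affine hull E"
      unfolding hull p'_def using pab \<open>a \<bullet> \<eta> = 0\<close> \<open>c \<bullet> \<eta> = 0\<close> by (simp add: inner_add_right)
    moreover have "p' \<in> ball p e"
    proof -
      have "norm \<eta> \<le> norm \<xi> + k * norm w"
        unfolding \<eta>_def using norm_triangle_ineq4[of \<xi> "k *\<^sub>R w"] k0 by simp
      also have "\<dots> \<le> norm \<xi> + norm \<xi> / \<tau> * norm w"
        using kn by (intro add_left_mono mult_right_mono) auto
      also have "\<dots> = norm \<xi> * M"
        unfolding M_def by (simp add: algebra_simps)
      also have "\<dots> < e / (2 * M) * M"
        using \<xi>(1) M unfolding r_def by (intro mult_strict_right_mono) auto
      finally have n: "norm \<eta> < e / 2"
        using M by simp
      have "1 / (1 - k) \<le> 2"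
        using k1 by (simp add: field_simps)
      then have "(1 / (1 - k)) * norm \<eta> \<le> 2 * norm \<eta>"
        by (intro mult_right_mono) auto
      then have "norm ((1 / (1 - k)) *\<^sub>R \<eta>) < e"
        using n k1 by simp
      then show ?thesis
        unfolding p'_def by (simp add: dist_norm)
    qed
    ultimately have "p' \<in> S"
      using e(2) unfolding E by blast
    then have "(1 - k) *\<^sub>R p' + k *\<^sub>R g \<in> S"
      using S gS(1) k0 k1 by (intro convexD) auto
    also have "(1 - k) *\<^sub>R p' + k *\<^sub>R g = p + \<xi>"
    proof -
      have "(1 - k) *\<^sub>R p' = (1 - k) *\<^sub>R p + \<eta>"
        unfolding p'_def using k1 by (simp add: scaleR_add_right)
      then show ?thesis
        unfolding \<eta>_def w_def by (simp add: algebra_simps)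
    qed
    finally show "p + \<xi> \<in> S" .
  qed
qed

section \<open>The \<open>L\<^sub>2\<close>-norm\<close>

lemma L2_norm_nonneg: "0 \<le> L2_norm f"
  unfolding L2_norm_def by simp

lemma L2_norm_sq: "(L2_norm f)\<^sup>2 = (\<integral>x. (norm (f x))\<^sup>2 \<partial>lborel)"
  unfolding L2_norm_def by (simp add: integral_nonneg_AE)

text \<open>Minkowski's inequality through (u + v)^2 <= (A + B) (u^2 / A + v^2 / B), with the two
  norms as weights. The added epsilon keeps the weights positive. Different codomains allow
  gradients to be compared with scalar functions.\<close>

lemma L2_norm_le_add:
  fixes f :: "'a::euclidean_space \<Rightarrow> 'b::real_normed_vector"
    and g :: "'a \<Rightarrow> 'c::real_normed_vector" and k :: "'a \<Rightarrow> 'd::real_normed_vector"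
  assumes int: "integrable lborel (\<lambda>x. (norm (f x))\<^sup>2)"
    and f': "integrable lborel (\<lambda>x. (norm (g x))\<^sup>2)"
      "integrable lborel (\<lambda>x. (norm (k x))\<^sup>2)"
    and le: "\<And>x. norm (f x) \<le> norm (g x) + norm (k x)"
  shows "L2_norm f \<le> L2_norm g + L2_norm k"
proof (rule field_le_epsilon)
  fix e :: real assume e: "e > 0"
  define A B where "A = L2_norm g + e / 2" and "B = L2_norm k + e / 2"
  have AB: "A > 0" "B > 0"
    unfolding A_def B_def using e L2_norm_nonneg[of g] L2_norm_nonneg[of k] by linarith+
  have quad: "(u + v)\<^sup>2 \<le> (A + B) * (u\<^sup>2 / A + v\<^sup>2 / B)" for u v
  proof -
    have "(A + B) * (u\<^sup>2 / A + v\<^sup>2 / B) - (u + v)\<^sup>2 = (B * u - A * v)\<^sup>2 / (A * B)"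
      using AB by (simp add: field_simps power2_eq_square)
    also have "\<dots> \<ge> 0"
      using AB by simp
    finally show ?thesis by simp
  qed
  have "(L2_norm f)\<^sup>2 \<le> (\<integral>x. (A + B) * ((norm (g x))\<^sup>2 / A + (norm (k x))\<^sup>2 / B) \<partial>lborel)"
    unfolding L2_norm_sq
  proof (rule integral_mono[OF int])
    show "integrable lborel (\<lambda>x. (A + B) * ((norm (g x))\<^sup>2 / A + (norm (k x))\<^sup>2 / B))"
      using f' by auto
    show "(norm (f x))\<^sup>2 \<le> (A + B) * ((norm (g x))\<^sup>2 / A + (norm (k x))\<^sup>2 / B)" for x
      by (rule order_trans[OF power_mono[OF le[of x] norm_ge_zero] quad])
  qed
  also have "\<dots> = (A + B) * ((L2_norm g)\<^sup>2 / A + (L2_norm k)\<^sup>2 / B)"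
    unfolding L2_norm_sq using f' by simp
  finally have 1: "(L2_norm f)\<^sup>2 \<le> (A + B) * ((L2_norm g)\<^sup>2 / A + (L2_norm k)\<^sup>2 / B)" .
  have "(L2_norm g)\<^sup>2 \<le> A\<^sup>2" "(L2_norm k)\<^sup>2 \<le> B\<^sup>2"
    using e L2_norm_nonneg[of g] L2_norm_nonneg[of k] by (auto intro!: power_mono simp: A_def B_def)
  then have "(L2_norm g)\<^sup>2 / A + (L2_norm k)\<^sup>2 / B \<le> A\<^sup>2 / A + B\<^sup>2 / B"
    using AB by (intro add_mono divide_right_mono) auto
  also have "A\<^sup>2 / A + B\<^sup>2 / B = A + B"
    using AB by (simp add: power2_eq_square)
  finally have 2: "(L2_norm g)\<^sup>2 / A + (L2_norm k)\<^sup>2 / B \<le> A + B" .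
  have "(A + B) * ((L2_norm g)\<^sup>2 / A + (L2_norm k)\<^sup>2 / B) \<le> (A + B) * (A + B)"
    using 2 AB by (intro mult_left_mono) auto
  with 1 have "(L2_norm f)\<^sup>2 \<le> (A + B)\<^sup>2"
    unfolding power2_eq_square[of "A + B"] by (rule order_trans)
  then have "L2_norm f \<le> A + B"
    by (rule power2_le_imp_le) (use AB in simp)
  then show "L2_norm f \<le> L2_norm g + L2_norm k + e"
    unfolding A_def B_def by simp
qed

lemma L2_norm_le_mult:
  assumes int: "integrable lborel (\<lambda>x. (norm (f x))\<^sup>2)" "integrable lborel (\<lambda>x. (norm (g x))\<^sup>2)"
    and le: "\<And>x. norm (f x) \<le> C * norm (g x)" and C: "C \<ge> 0"
  shows "L2_norm f \<le> C * L2_norm g"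
proof -
  have "(L2_norm f)\<^sup>2 \<le> (\<integral>x. C\<^sup>2 * (norm (g x))\<^sup>2 \<partial>lborel)"
    unfolding L2_norm_sq
  proof (rule integral_mono[OF int(1)])
    show "integrable lborel (\<lambda>x. C\<^sup>2 * (norm (g x))\<^sup>2)"
      using int(2) by auto
    show "(norm (f x))\<^sup>2 \<le> C\<^sup>2 * (norm (g x))\<^sup>2" for x
      using power_mono[OF le[of x] norm_ge_zero, of 2] by (simp only: power_mult_distrib)
  qed
  also have "\<dots> = (C * L2_norm g)\<^sup>2"
    by (simp add: power_mult_distrib L2_norm_sq)
  finally show ?thesis
    by (rule power2_le_imp_le) (rule mult_nonneg_nonneg[OF C L2_norm_nonneg])
qed

lemma integral_pos_continuous:
  fixes f :: "'a::euclidean_space \<Rightarrow> real"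
  assumes f: "continuous_on UNIV f" "integrable lborel f" "\<And>x. f x \<ge> 0" and x: "f x > 0"
  shows "integral\<^sup>L lborel f > 0"
proof -
  have "isCont f x"
    using f(1) by (simp add: continuous_on_eq_continuous_at)
  then obtain e where e: "e > 0" "\<And>y. dist y x < e \<Longrightarrow> dist (f y) (f x) < f x / 2"
    using x unfolding continuous_at_eps_delta by (auto dest!: spec[of _ "f x / 2"])
  define B where "B = ball x e"
  have lower: "f x / 2 * indicator B y \<le> f y" for y
  proof (cases "y \<in> B")
    case True
    then have "dist (f y) (f x) < f x / 2"
      unfolding B_def by (intro e(2)) (simp add: dist_commute)
    then have "f x / 2 \<le> f y"
      unfolding dist_real_def by linarith
    then show ?thesis
      using True by simp
  qed (use f(3) in simp)
  have B: "B \<in> sets lborel" "emeasure lborel B < \<infinity>"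
    unfolding B_def using emeasure_lborel_ball_finite by auto
  have "0 < f x / 2 * measure lborel B"
    using x e(1) content_ball_pos[of e x] unfolding B_def by simp
  also have "\<dots> = (\<integral>y. f x / 2 * indicator B y \<partial>lborel)"
    using B by simp
  also have "\<dots> \<le> integral\<^sup>L lborel f"
    using B f(2) lower by (intro integral_mono) auto
  finally show ?thesis .
qed

section \<open>Hardy constants of the complement of a convex body\<close>

locale convex_body =
  fixes S :: "'a::euclidean_space set"
  assumes convex: "convex S" and closed: "closed S" and full: "aff_dim S = int DIM('a)"
begin

definition dst :: "'a \<Rightarrow> real" where "dst x = infdist x (frontier (- S))"

lemma nonempty: "S \<noteq> {}"
  using full by auto

text \<open>The point of \<open>S\<close> closest to an outer point lies on the relative frontier,
  which is the frontier because \<open>S\<close> is full-dimensional.\<close>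

lemma dst_eq:
  assumes "x \<notin> S"
  shows "dst x = infdist x S"
proof -
  have hull: "affine hull S = UNIV"
    using full by (simp add: aff_dim_eq_full)
  have fr: "rel_frontier S = frontier S"
    using hull by (rule rel_frontier_frontier)
  have "closest_point S x \<in> rel_frontier S"
    using assms hull rel_interior_subset[of S] by (intro closest_point_in_rel_frontier closed nonempty) auto
  then have c: "closest_point S x \<in> frontier S"
    unfolding fr .
  obtain x0 where x0: "x0 \<in> S" "infdist x S = dist x x0"
    using infdist_attains_inf[OF closed nonempty, of x] by blast
  have "infdist x (frontier S) \<le> dist x (closest_point S x)"
    using c by (rule infdist_le)
  also have "\<dots> \<le> infdist x S"
    unfolding x0(2) using closed x0(1) by (rule closest_point_le)
  finally have "infdist x (frontier S) \<le> infdist x S" .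
  moreover have "infdist x S \<le> infdist x (frontier S)"
    using c closed by (intro infdist_mono) (auto simp: frontier_subset_closed)
  ultimately show ?thesis
    unfolding dst_def by simp
qed

lemma dst_pos: "x \<notin> S \<Longrightarrow> dst x > 0"
  using infdist_pos_not_in_closed[OF closed nonempty] dst_eq by simp

lemma continuous_dst: "continuous_on T dst"
  unfolding dst_def[abs_def] by (intro continuous_intros)

lemma C1_c_facts:
  assumes "\<psi> \<in> C1_c (- S)"
  shows "continuous_on UNIV (\<lambda>x. inverse (dst x) * \<psi> x)"
    "integrable lborel (\<lambda>x. (norm (inverse (dst x) * \<psi> x))\<^sup>2)"
    "integrable lborel (\<lambda>x. (norm (\<psi> x))\<^sup>2)"
    "integrable lborel (\<lambda>x. (norm (gradient \<psi> x))\<^sup>2)"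
proof -
  define K where "K = closure {x. \<psi> x \<noteq> 0}"
  have K: "compact K" "K \<subseteq> - S" and g: "has_gradient_on \<psi> (gradient \<psi>) UNIV"
    using C1_cD[OF assms] unfolding K_def by auto
  have z: "\<psi> x = 0" if "x \<notin> K" for x
    using that closure_subset[of "{x. \<psi> x \<noteq> 0}"] unfolding K_def by auto
  have c: "continuous_on UNIV \<psi>"
    by (rule has_gradient_on_continuous[OF g])
  \<comment> \<open>The reciprocal distance is continuous off \<open>S\<close>, and the product is
    zero off \<open>K\<close>. Since \<open>K\<close> misses \<open>S\<close>, these two open sets
    cover the space.\<close>
  have "continuous_on (- S \<union> - K) (\<lambda>x. inverse (dst x) * \<psi> x)"
  proof (rule continuous_on_open_Un)
    show "continuous_on (- S) (\<lambda>x. inverse (dst x) * \<psi> x)"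
    proof (intro continuous_intros continuous_dst)
      show "continuous_on (- S) \<psi>"
        using c by (rule continuous_on_subset) simp
      show "\<forall>x\<in>- S. dst x \<noteq> 0"
        using dst_pos by (metis ComplD less_irrefl)
    qed
    show "continuous_on (- K) (\<lambda>x. inverse (dst x) * \<psi> x)"
      using z by (subst continuous_on_cong[OF refl, where g = "\<lambda>x. 0"]) auto
  qed (use closed K compact_imp_closed in \<open>auto simp: open_Compl\<close>)
  moreover have "- S \<union> - K = UNIV"
    using K by auto
  ultimately show c1: "continuous_on UNIV (\<lambda>x. inverse (dst x) * \<psi> x)"
    by simp
  show "integrable lborel (\<lambda>x. (norm (inverse (dst x) * \<psi> x))\<^sup>2)"
    using z by (intro integrable_compact_support[OF _ K(1)] continuous_intros c1) auto
  show "integrable lborel (\<lambda>x. (norm (\<psi> x))\<^sup>2)"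
    using z by (intro integrable_compact_support[OF _ K(1)] continuous_intros c) auto
  show "integrable lborel (\<lambda>x. (norm (gradient \<psi> x))\<^sup>2)"
  proof (intro integrable_compact_support[OF _ K(1)] continuous_intros)
    show "continuous_on UNIV (gradient \<psi>)"
      using g unfolding has_gradient_on_def by simp
    show "(norm (gradient \<psi> x))\<^sup>2 = 0" if "x \<notin> K" for x
      using has_gradient_on_extend(2)[OF g open_UNIV compact_imp_closed[OF K(1)] subset_UNIV z that]
      by simp
  qed
qed

text \<open>Using the closest point of \<open>x\<close> as a competitor for \<open>w\<close> bounds
  the increment from above, and exchanging the roles bounds it from below. As the projection is
  1-Lipschitz, the increment differs from its linear part by at most |w - x|^2.\<close>

lemma sq_infdist_has_gradient:
  "has_gradient_on (\<lambda>x. (infdist x S)\<^sup>2) (\<lambda>x. 2 *\<^sub>R (x - closest_point S x)) UNIV"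
  unfolding has_gradient_on_def
proof (intro conjI ballI)
  define P where "P = closest_point S"
  have P: "P x \<in> S" for x
    unfolding P_def using closest_point_in_set[OF closed nonempty] .
  have I: "infdist x S = norm (x - P x)" for x
  proof -
    obtain x0 where x0: "x0 \<in> S" "infdist x S = dist x x0"
      using infdist_attains_inf[OF closed nonempty, of x] by blast
    then have "dist x (P x) \<le> infdist x S"
      unfolding P_def using closest_point_le[OF closed] by simp
    moreover have "infdist x S \<le> dist x (P x)"
      by (rule infdist_le[OF P])
    ultimately show ?thesis
      by (simp add: dist_norm)
  qed
  have le: "(infdist x S)\<^sup>2 \<le> (x - w) \<bullet> (x - w)" if "w \<in> S" for x w
    using power_mono[OF infdist_le[OF that, of x] infdist_nonneg, of 2]
    by (simp add: dist_norm power2_norm_eq_inner)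
  have I2: "(infdist x S)\<^sup>2 = (x - P x) \<bullet> (x - P x)" for x
    unfolding I by (rule power2_norm_eq_inner)
  show "continuous_on UNIV (\<lambda>x. 2 *\<^sub>R (x - closest_point S x))"
    using continuous_on_closest_point[OF convex closed nonempty] by (intro continuous_intros) auto
  fix x
  have bound: "\<bar>(infdist w S)\<^sup>2 - (infdist x S)\<^sup>2 - (w - x) \<bullet> 2 *\<^sub>R (x - P x)\<bar> \<le> (norm (w - x))\<^sup>2" for w
  proof -
    define h where "h = w - x"
    have w: "w = x + h"
      unfolding h_def by simp
    have "(infdist w S)\<^sup>2 \<le> (w - P x) \<bullet> (w - P x)"
      by (rule le[OF P])
    also have "\<dots> = (infdist x S)\<^sup>2 + 2 * (h \<bullet> (x - P x)) + (norm h)\<^sup>2"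
      unfolding w I2 power2_norm_eq_inner
      by (simp add: inner_add_left inner_add_right inner_diff_left inner_diff_right inner_commute)
    finally have 1: "(infdist w S)\<^sup>2 - (infdist x S)\<^sup>2 - 2 * (h \<bullet> (x - P x)) \<le> (norm h)\<^sup>2"
      by simp
    have "(infdist x S)\<^sup>2 \<le> (x - P w) \<bullet> (x - P w)"
      by (rule le[OF P])
    also have "\<dots> = (infdist w S)\<^sup>2 - 2 * (h \<bullet> (w - P w)) + (norm h)\<^sup>2"
      unfolding I2 power2_norm_eq_inner h_def
      by (simp add: inner_add_left inner_add_right inner_diff_left inner_diff_right inner_commute)
    finally have 2: "(infdist w S)\<^sup>2 - (infdist x S)\<^sup>2 \<ge> 2 * (h \<bullet> (w - P w)) - (norm h)\<^sup>2"
      by simp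
    have "h \<bullet> (P w - P x) \<le> norm h * norm (P w - P x)"
      by (rule norm_cauchy_schwarz)
    also have "\<dots> \<le> norm h * norm h"
      using closest_point_lipschitz[OF convex closed nonempty, of w x]
      unfolding P_def h_def dist_norm by (intro mult_left_mono) auto
    finally have "h \<bullet> (w - P w) \<ge> h \<bullet> (x - P x)"
      unfolding w by (simp add: inner_add_right inner_diff_right power2_norm_eq_inner[symmetric] power2_eq_square)
    with 1 2 show ?thesis
      unfolding h_def[symmetric] by (simp add: abs_le_iff)
  qed
  show "GDERIV (\<lambda>x. (infdist x S)\<^sup>2) x :> 2 *\<^sub>R (x - closest_point S x)"
    unfolding gderiv_def P_def[symmetric]
  proof (rule has_derivativeI_sandwich[where e = 1])
    show "bounded_linear (\<lambda>h. h \<bullet> 2 *\<^sub>R (x - P x))"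
      by (rule bounded_linear_inner_left)
    show "((\<lambda>w. norm (w - x)) \<longlongrightarrow> 0) (at x)"
      using tendsto_norm_zero[OF LIM_zero[OF tendsto_ident_at]] .
    fix w assume "w \<noteq> x"
    then show "norm ((infdist w S)\<^sup>2 - (infdist x S)\<^sup>2 - (w - x) \<bullet> 2 *\<^sub>R (x - P x)) / norm (w - x) \<le> norm (w - x)"
      using bound[of w] by (simp add: divide_le_eq power2_eq_square)
  qed simp
qed

lemma dist_closest_point: "norm (x - closest_point S x) = infdist x S"
proof -
  obtain x0 where x0: "x0 \<in> S" "infdist x S = dist x x0"
    using infdist_attains_inf[OF closed nonempty, of x] by blast
  then have "dist x (closest_point S x) \<le> infdist x S"
    using closest_point_le[OF closed] by simp
  moreover have "infdist x S \<le> dist x (closest_point S x)"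
    by (rule infdist_le[OF closest_point_in_set[OF closed nonempty]])
  ultimately show ?thesis
    by (simp add: dist_norm)
qed

text \<open>The squared distance is used because the distance itself has a kink on the frontier of
  \<open>S\<close>. The cutoff vanishes beyond r / sqrt 2 < 3/4 r, so its support stays well inside
  the layer.\<close>

lemma cutoff:
  assumes r: "r > 0"
  obtains \<eta> \<eta>' where "has_gradient_on \<eta> \<eta>' UNIV" "\<And>x. 0 \<le> \<eta> x \<and> \<eta> x \<le> 1"
    "\<And>x. infdist x S \<ge> 3 / 4 * r \<Longrightarrow> \<eta> x = 0"
    "\<And>x. 1 - \<eta> x \<le> 4 / r * infdist x S" "\<And>x. norm (\<eta>' x) \<le> 8 / r"
proof -
  define f where "f t = (max 0 (1 - 2 * t / r\<^sup>2))\<^sup>2" for t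
  define f' where "f' t = 2 * max 0 (1 - 2 * t / r\<^sup>2) * (- 2 / r\<^sup>2)" for t
  define \<eta> where "\<eta> x = f ((infdist x S)\<^sup>2)" for x
  define \<eta>' where "\<eta>' x = f' ((infdist x S)\<^sup>2) *\<^sub>R 2 *\<^sub>R (x - closest_point S x)" for x
  have r2: "r\<^sup>2 > 0"
    using r by simp
  have "((\<lambda>t. 1 - 2 * t / r\<^sup>2) has_real_derivative - 2 / r\<^sup>2) (at t)" for t
    using DERIV_diff[OF DERIV_const DERIV_cdivide[OF DERIV_cmult[OF DERIV_ident]]] by simp
  then have f: "(f has_real_derivative f' t) (at t)" for t
    unfolding f_def[abs_def] f'_def by (rule max0_power_has_derivative_numeral(1))
  have "continuous_on UNIV f'"
    unfolding f'_def[abs_def] using r by (intro continuous_intros) auto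
  then have "has_gradient_on \<eta> \<eta>' UNIV"
    unfolding \<eta>_def[abs_def] \<eta>'_def[abs_def]
    using has_gradient_on_compose[OF sq_infdist_has_gradient f] by simp
  moreover have "0 \<le> \<eta> x \<and> \<eta> x \<le> 1" for x
    unfolding \<eta>_def f_def by (auto intro!: power_le_one)
  moreover have small: "(infdist x S)\<^sup>2 < r\<^sup>2 / 2 \<or> max 0 (1 - 2 * (infdist x S)\<^sup>2 / r\<^sup>2) = 0" for x
    using r2 by (auto simp: max_def field_simps)
  have "\<eta> x = 0" if "infdist x S \<ge> 3 / 4 * r" for x
  proof -
    have "(3 / 4 * r)\<^sup>2 \<le> (infdist x S)\<^sup>2"
      using that r by (intro power_mono) auto
    moreover have "(3 / 4 * r)\<^sup>2 \<ge> r\<^sup>2 / 2"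
      using r2 by (simp add: power_mult_distrib power2_eq_square)
    ultimately show ?thesis
      using small[of x] unfolding \<eta>_def f_def by auto
  qed
  moreover have "1 - \<eta> x \<le> 4 / r * infdist x S" for x
  proof (cases "infdist x S \<le> r")
    case True
    define m where "m = max 0 (1 - 2 * (infdist x S)\<^sup>2 / r\<^sup>2)"
    have m: "0 \<le> m" "m \<le> 1" "1 - m \<le> 2 * (infdist x S)\<^sup>2 / r\<^sup>2"
      unfolding m_def by auto
    have "1 - \<eta> x = (1 + m) * (1 - m)"
      unfolding \<eta>_def f_def m_def[symmetric] by (simp add: power2_eq_square algebra_simps)
    also have "\<dots> \<le> 2 * (2 * (infdist x S)\<^sup>2 / r\<^sup>2)"
      using m by (intro mult_mono) auto
    also have "\<dots> = 4 / r * infdist x S * (infdist x S / r)"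
      by (simp add: power2_eq_square)
    also have "\<dots> \<le> 4 / r * infdist x S * 1"
      using True r infdist_nonneg[of x S] by (intro mult_left_mono) auto
    finally show ?thesis by simp
  next
    case False
    have "1 - \<eta> x \<le> 1"
      unfolding \<eta>_def f_def by simp
    also have "1 \<le> 4 / r * infdist x S"
      using False r by (simp add: field_simps)
    finally show ?thesis .
  qed
  moreover have "norm (\<eta>' x) \<le> 8 / r" for x
  proof (cases "max 0 (1 - 2 * (infdist x S)\<^sup>2 / r\<^sup>2) = 0")
    case True
    then show ?thesis
      using r unfolding \<eta>'_def f'_def by simp
  next
    case False
    then have "(infdist x S)\<^sup>2 < r\<^sup>2 / 2"
      using small[of x] by blast
    then have "(infdist x S)\<^sup>2 \<le> r\<^sup>2"
      using r2 by linarith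
    then have le: "infdist x S \<le> r"
      by (rule power2_le_imp_le) (use r in simp)
    have "norm (\<eta>' x) = 2 * max 0 (1 - 2 * (infdist x S)\<^sup>2 / r\<^sup>2) * (2 / r\<^sup>2) * (2 * infdist x S)"
      unfolding \<eta>'_def f'_def by (simp add: dist_closest_point abs_mult)
    also have "\<dots> \<le> 2 * 1 * (2 / r\<^sup>2) * (2 * r)"
      using le r infdist_nonneg[of x S] by (intro mult_mono) auto
    also have "\<dots> = 8 / r"
      using r by (simp add: power2_eq_square)
    finally show ?thesis .
  qed
  ultimately show thesis
    by (rule that)
qed


section \<open>Equality of the three Hardy constants\<close>

lemma hardy_b0_le_a0: "hardy_b0 (- S) W \<le> hardy_a0 (- S) W"
  unfolding hardy_b0_def hardy_a0_def
proof (rule Inf_superset_mono, safe)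
  fix a :: real
  assume a: "a > 0" "\<forall>\<psi>\<in>C1_c W. L2_norm (\<lambda>x. inverse (infdist x (frontier (- S))) * \<psi> x) \<le> a * L2_norm (gradient \<psi>)"
  have "L2_norm (\<lambda>x. inverse (infdist x (frontier (- S))) * \<psi> x) \<le> a * L2_norm (gradient \<psi>) + 1 * L2_norm \<psi>"
    if "\<psi> \<in> C1_c W" for \<psi>
    using a(2) that L2_norm_nonneg[of \<psi>] by fastforce
  then show "\<exists>b. ereal a = ereal b \<and> 0 < b \<and> (\<exists>c>0. \<forall>\<psi>\<in>C1_c W.
      L2_norm (\<lambda>x. inverse (infdist x (frontier (- S))) * \<psi> x) \<le> b * L2_norm (gradient \<psi>) + c * L2_norm \<psi>)"
    using a(1) by (intro exI[of _ a] conjI exI[of _ 1]) auto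
qed

lemma hardy_b0_mono:
  assumes "W \<subseteq> W'"
  shows "hardy_b0 (- S) W \<le> hardy_b0 (- S) W'"
proof -
  have "C1_c W \<subseteq> C1_c W'"
    using assms unfolding C1_c_def by auto
  then show ?thesis
    unfolding hardy_b0_def by (intro Inf_superset_mono) blast
qed

lemma boundary_layer_subset: "boundary_layer (- S) r \<subseteq> - S"
  unfolding boundary_layer_def by auto

lemma C1_c_layer: "\<psi> \<in> C1_c (boundary_layer (- S) r) \<Longrightarrow> \<psi> \<in> C1_c (- S)"
  using boundary_layer_subset[of r] unfolding C1_c_def by auto

lemma hardy_b0_le_layer:
  assumes r: "r > 0"
  shows "hardy_b0 (- S) (- S) \<le> hardy_b0 (- S) (boundary_layer (- S) r)"
  unfolding hardy_b0_def dst_def[symmetric]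
proof (rule Inf_superset_mono, safe)
  fix b c :: real
  assume b: "b > 0" and c: "c > 0" and H: "\<forall>\<psi>\<in>C1_c (boundary_layer (- S) r).
    L2_norm (\<lambda>x. inverse (dst x) * \<psi> x) \<le> b * L2_norm (gradient \<psi>) + c * L2_norm \<psi>"
  obtain \<eta> \<eta>' where \<eta>: "has_gradient_on \<eta> \<eta>' UNIV" "\<And>x. 0 \<le> \<eta> x \<and> \<eta> x \<le> 1"
    "\<And>x. infdist x S \<ge> 3 / 4 * r \<Longrightarrow> \<eta> x = 0"
    "\<And>x. 1 - \<eta> x \<le> 4 / r * infdist x S" "\<And>x. norm (\<eta>' x) \<le> 8 / r"
    using cutoff[OF r] by blast
  \<comment> \<open>The first summand pays for the gradient of the cutoff and the last for the part
    of \<psi> that is cut off. Both are multiples of the plain norm of \<psi>, so \<open>b\<close>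
    is unchanged.\<close>
  define C where "C = b * (8 / r) + c + 4 / r"
  have "L2_norm (\<lambda>x. inverse (dst x) * \<psi> x) \<le> b * L2_norm (gradient \<psi>) + C * L2_norm \<psi>"
    if \<psi>: "\<psi> \<in> C1_c (- S)" for \<psi>
  proof -
    define K0 where "K0 = closure {x. \<psi> x \<noteq> 0}"
    define K where "K = K0 \<inter> {x. infdist x S \<le> 3 / 4 * r}"
    have K0: "compact K0" "K0 \<subseteq> - S" and g: "has_gradient_on \<psi> (gradient \<psi>) UNIV"
      using C1_cD[OF \<psi>] unfolding K0_def by auto
    have K: "compact K"
      unfolding K_def
      by (intro compact_Int_closed K0 closed_Collect_le continuous_intros)
    have KW: "K \<subseteq> boundary_layer (- S) r"
    proof
      fix x assume "x \<in> K"
      then have "x \<notin> S" "infdist x S < r"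
        using K0 r unfolding K_def by auto
      then show "x \<in> boundary_layer (- S) r"
        using dst_eq[of x] unfolding boundary_layer_def dst_def by simp
    qed
    define \<phi> where "\<phi> x = \<eta> x * \<psi> x" for x
    have z: "\<phi> x = 0" if "x \<notin> K" for x
    proof (cases "x \<in> K0")
      case True
      then show ?thesis
        using that \<eta>(3)[of x] unfolding K_def \<phi>_def by auto
    next
      case False
      then show ?thesis
        using closure_subset[of "{x. \<psi> x \<noteq> 0}"] unfolding K0_def \<phi>_def by auto
    qed
    have \<phi>g: "has_gradient_on \<phi> (\<lambda>x. \<eta> x *\<^sub>R gradient \<psi> x + \<psi> x *\<^sub>R \<eta>' x) UNIV"
      unfolding \<phi>_def[abs_def] by (rule has_gradient_on_mult[OF \<eta>(1) g])
    have \<phi>: "\<phi> \<in> C1_c (boundary_layer (- S) r)"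
      by (rule C1_cI(1)[OF \<phi>g open_UNIV K subset_UNIV KW z])
    have \<phi>': "gradient \<phi> x = \<eta> x *\<^sub>R gradient \<psi> x + \<psi> x *\<^sub>R \<eta>' x" for x
      by (rule C1_cI(2)[OF \<phi>g open_UNIV K subset_UNIV KW z UNIV_I])
    note \<psi>i = C1_c_facts[OF \<psi>] and \<phi>i = C1_c_facts[OF C1_c_layer[OF \<phi>]]
    have int4: "integrable lborel (\<lambda>x. (norm (k * \<psi> x))\<^sup>2)" for k
      unfolding norm_mult power_mult_distrib by (intro integrable_mult_right \<psi>i(3))
    have scale: "L2_norm (\<lambda>x. k * \<psi> x) = k * L2_norm \<psi>" if "k > 0" for k :: real
      using that unfolding L2_norm_def norm_mult power_mult_distrib by (simp add: real_sqrt_mult)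
    have "L2_norm (\<lambda>x. inverse (dst x) * \<psi> x) \<le> L2_norm (\<lambda>x. inverse (dst x) * \<phi> x) + L2_norm (\<lambda>x. (4 / r) * \<psi> x)"
    proof (rule L2_norm_le_add[OF \<psi>i(2) \<phi>i(2) int4])
      fix x
      show "norm (inverse (dst x) * \<psi> x) \<le> norm (inverse (dst x) * \<phi> x) + norm (4 / r * \<psi> x)"
      proof (cases "x \<in> S")
        case True
        then have "\<psi> x = 0"
          using K0(2) closure_subset[of "{x. \<psi> x \<noteq> 0}"] unfolding K0_def by auto
        then show ?thesis by simp
      next
        case False
        then have d: "dst x > 0" "dst x = infdist x S"
          using dst_pos dst_eq by auto
        have "(1 - \<eta> x) * inverse (dst x) \<le> 4 / r"
          using \<eta>(4)[of x] d by (simp add: divide_inverse[symmetric] pos_divide_le_eq)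
        then have "\<bar>\<psi> x\<bar> * ((1 - \<eta> x) * inverse (dst x)) \<le> \<bar>\<psi> x\<bar> * (4 / r)"
          by (intro mult_left_mono) auto
        moreover have "norm (inverse (dst x) * \<psi> x) = inverse (dst x) * \<bar>\<psi> x\<bar>"
          "norm (inverse (dst x) * \<phi> x) = inverse (dst x) * (\<eta> x * \<bar>\<psi> x\<bar>)"
          "norm (4 / r * \<psi> x) = 4 / r * \<bar>\<psi> x\<bar>"
          unfolding \<phi>_def using d r \<eta>(2)[of x] by (simp_all add: abs_mult)
        ultimately show ?thesis
          by (simp add: algebra_simps)
      qed
    qed
    also have "L2_norm (\<lambda>x. inverse (dst x) * \<phi> x) \<le> b * L2_norm (gradient \<phi>) + c * L2_norm \<phi>"
      using H \<phi> by blast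
    also have "L2_norm \<phi> \<le> 1 * L2_norm \<psi>"
    proof (rule L2_norm_le_mult[OF \<phi>i(3) \<psi>i(3)])
      show "norm (\<phi> x) \<le> 1 * norm (\<psi> x)" for x
        unfolding \<phi>_def using \<eta>(2)[of x] mult_right_mono[of "\<eta> x" 1 "\<bar>\<psi> x\<bar>"] by (simp add: abs_mult)
    qed simp
    also have "L2_norm (gradient \<phi>) \<le> L2_norm (gradient \<psi>) + L2_norm (\<lambda>x. (8 / r) * \<psi> x)"
    proof (rule L2_norm_le_add[OF \<phi>i(4) \<psi>i(4) int4])
      fix x
      have "norm (gradient \<phi> x) \<le> \<eta> x * norm (gradient \<psi> x) + \<bar>\<psi> x\<bar> * norm (\<eta>' x)"
        unfolding \<phi>' using norm_triangle_ineq[of "\<eta> x *\<^sub>R gradient \<psi> x" "\<psi> x *\<^sub>R \<eta>' x"] \<eta>(2)[of x] by simp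
      also have "\<dots> \<le> 1 * norm (gradient \<psi> x) + \<bar>\<psi> x\<bar> * (8 / r)"
        using \<eta>(2)[of x] \<eta>(5)[of x] by (intro add_mono mult_right_mono mult_left_mono) auto
      also have "\<dots> = norm (gradient \<psi> x) + norm (8 / r * \<psi> x)"
        using r by (simp add: abs_mult)
      finally show "norm (gradient \<phi> x) \<le> norm (gradient \<psi> x) + norm (8 / r * \<psi> x)" .
    qed
    finally have *: "L2_norm (\<lambda>x. inverse (dst x) * \<psi> x) \<le> b * (L2_norm (gradient \<psi>) + L2_norm (\<lambda>x. (8 / r) * \<psi> x))
        + c * (1 * L2_norm \<psi>) + L2_norm (\<lambda>x. (4 / r) * \<psi> x)"
      using b c by (simp add: mult_left_mono)
    have "8 / r > 0" "4 / r > 0"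
      using r by auto
    from *[unfolded scale[OF this(1)] scale[OF this(2)]] show ?thesis
      unfolding C_def by (simp add: algebra_simps)
  qed
  moreover have "C > 0"
    unfolding C_def using b c r by (simp add: add_pos_pos)
  ultimately show "\<exists>b'. ereal b = ereal b' \<and> 0 < b' \<and> (\<exists>c>0. \<forall>\<psi>\<in>C1_c (- S).
      L2_norm (\<lambda>x. inverse (dst x) * \<psi> x) \<le> b' * L2_norm (gradient \<psi>) + c * L2_norm \<psi>)"
    using b by (intro exI[of _ b] conjI exI[of _ C]) auto
qed

lemma hardy_a0_boundary_le:
  assumes r: "r > 0"
  shows "hardy_a0_boundary (- S) \<le> hardy_b0 (- S) (boundary_layer (- S) r)"
  unfolding hardy_b0_def dst_def[symmetric]
proof (rule Inf_greatest, safe)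
  fix b c :: real
  assume b: "b > 0" and c: "c > 0" and H: "\<forall>\<psi>\<in>C1_c (boundary_layer (- S) r).
    L2_norm (\<lambda>x. inverse (dst x) * \<psi> x) \<le> b * L2_norm (gradient \<psi>) + c * L2_norm \<psi>"
  show "hardy_a0_boundary (- S) \<le> ereal b"
  proof (rule ereal_le_epsilon2)
    fix e :: real assume e: "e > 0"
    \<comment> \<open>This width gives \<open>c * t \<le> e / (b + e)\<close>. The fraction b / (b +
      e) of the weighted norm then survives on the left, which turns the constant \<open>b\<close>
      into \<open>b + e\<close>.\<close>
    define t where "t = min r (e / (c * (b + e)))"
    have t: "t > 0" "t \<le> r"
      unfolding t_def using r e b c by auto
    have ct: "c * t \<le> e / (b + e)"
    proof -
      have "c * t \<le> c * (e / (c * (b + e)))"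
        unfolding t_def using c by (intro mult_left_mono) auto
      then show ?thesis
        using c by simp
    qed
    have "L2_norm (\<lambda>x. inverse (dst x) * \<psi> x) \<le> (b + e) * L2_norm (gradient \<psi>)"
      if \<psi>: "\<psi> \<in> C1_c (boundary_layer (- S) t)" for \<psi>
    proof -
      define X where "X = L2_norm (\<lambda>x. inverse (dst x) * \<psi> x)"
      have "boundary_layer (- S) t \<subseteq> boundary_layer (- S) r"
        unfolding boundary_layer_def using t by auto
      then have "\<psi> \<in> C1_c (boundary_layer (- S) r)"
        using \<psi> unfolding C1_c_def by auto
      then have 1: "X \<le> b * L2_norm (gradient \<psi>) + c * L2_norm \<psi>"
        using H unfolding X_def by blast
      note i = C1_c_facts[OF C1_c_layer[OF \<psi>]]
      have "L2_norm \<psi> \<le> t * X"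
        unfolding X_def
      proof (rule L2_norm_le_mult[OF i(3) i(2)])
        fix x
        show "norm (\<psi> x) \<le> t * norm (inverse (dst x) * \<psi> x)"
        proof (cases "\<psi> x = 0")
          case False
          then have "x \<in> boundary_layer (- S) t"
            using C1_cD(3)[OF \<psi>] closure_subset[of "{x. \<psi> x \<noteq> 0}"] by auto
          then have "x \<notin> S" "dst x < t"
            unfolding boundary_layer_def dst_def by auto
          then have d: "dst x > 0" "dst x < t"
            using dst_pos by auto
          then have "1 \<le> t * inverse (dst x)"
            by (simp add: divide_inverse[symmetric] pos_le_divide_eq)
          then have "1 * \<bar>\<psi> x\<bar> \<le> t * inverse (dst x) * \<bar>\<psi> x\<bar>"
            by (intro mult_right_mono) auto
          then show ?thesis
            using d by (simp add: abs_mult)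
        qed simp
      qed (use t in simp)
      then have "c * L2_norm \<psi> \<le> c * (t * X)"
        using c by (intro mult_left_mono) auto
      also have "\<dots> = c * t * X"
        by simp
      also have "\<dots> \<le> e / (b + e) * X"
        using ct L2_norm_nonneg unfolding X_def by (intro mult_right_mono) auto
      finally have "X - e / (b + e) * X \<le> b * L2_norm (gradient \<psi>)"
        using 1 by simp
      moreover have "X - e / (b + e) * X = b * X / (b + e)"
        using b e by (simp add: field_simps)
      ultimately have "b * X \<le> b * ((b + e) * L2_norm (gradient \<psi>))"
        using b e by (simp add: pos_divide_le_eq mult.assoc mult.commute)
      then show ?thesis
        using b unfolding X_def by simp
    qed
    then have "hardy_a0 (- S) (boundary_layer (- S) t) \<le> ereal (b + e)"
      unfolding hardy_a0_def dst_def[symmetric] using b e by (intro Inf_lower) auto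
    moreover have "hardy_a0_boundary (- S) \<le> hardy_a0 (- S) (boundary_layer (- S) t)"
      unfolding hardy_a0_boundary_def using t by (intro INF_lower) auto
    ultimately show "hardy_a0_boundary (- S) \<le> ereal b + ereal e"
      by (simp add: order_trans)
  qed
qed

lemma hardy_constants_eq:
  "hardy_a0_boundary (- S) = hardy_b0_boundary (- S)"
  "hardy_b0_boundary (- S) = hardy_b0 (- S) (- S)"
proof -
  have "hardy_b0_boundary (- S) \<le> hardy_a0_boundary (- S)"
    unfolding hardy_b0_boundary_def hardy_a0_boundary_def
    by (intro INF_mono) (use hardy_b0_le_a0 in auto)
  moreover have "hardy_a0_boundary (- S) \<le> hardy_b0_boundary (- S)"
    unfolding hardy_b0_boundary_def using hardy_a0_boundary_le by (intro INF_greatest) auto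
  ultimately show "hardy_a0_boundary (- S) = hardy_b0_boundary (- S)"
    by (rule antisym[rotated])
  have "hardy_b0_boundary (- S) \<le> hardy_b0 (- S) (boundary_layer (- S) 1)"
    unfolding hardy_b0_boundary_def by (intro INF_lower) auto
  also have "\<dots> \<le> hardy_b0 (- S) (- S)"
    by (rule hardy_b0_mono[OF boundary_layer_subset])
  finally have "hardy_b0_boundary (- S) \<le> hardy_b0 (- S) (- S)" .
  moreover have "hardy_b0 (- S) (- S) \<le> hardy_b0_boundary (- S)"
    unfolding hardy_b0_boundary_def using hardy_b0_le_layer by (intro INF_greatest) auto
  ultimately show "hardy_b0_boundary (- S) = hardy_b0 (- S) (- S)"
    by (rule antisym)
qed

end

section \<open>Sharp edges\<close>

text \<open>The value comes from the lower end \<open>exp (- 102)\<close> of the support of the angular profile: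
  at an edge with a smaller angle the support of the test function does not meet the body.\<close>

definition crit_angle :: real where
  "crit_angle = arccos (1 - exp (- 102))"

lemma crit_angle_bounds: "0 < crit_angle" "crit_angle < pi"
proof -
  have e: "0 < exp (- 102 :: real)" "exp (- 102 :: real) < 1"
    by auto
  show "0 < crit_angle"
    unfolding crit_angle_def using e arccos_less_mono[of 1 "1 - exp (- 102)"] by simp
  have "arccos (1 - exp (- 102)) < arccos (- 1)"
    by (rule iffD2[OF arccos_less_mono]) (use e in linarith)+
  then show "crit_angle < pi"
    unfolding crit_angle_def by simp
qed

lemma (in convex_body) hardy_a0_layer_ge:
  assumes \<psi>: "\<psi> \<in> C1_c (boundary_layer (- S) r)" and k: "0 < k"
    and le: "(\<integral>x. (norm (gradient \<psi> x))\<^sup>2 \<partial>lborel) \<le> k * (\<integral>x. (inverse (dst x) * \<psi> x)\<^sup>2 \<partial>lborel)"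
    and nz: "\<psi> x0 \<noteq> 0"
  shows "ereal (1 / sqrt k) \<le> hardy_a0 (- S) (boundary_layer (- S) r)"
  unfolding hardy_a0_def dst_def[symmetric]
proof (rule Inf_greatest, safe)
  fix a :: real
  assume a: "a > 0" and H: "\<forall>\<psi>\<in>C1_c (boundary_layer (- S) r).
    L2_norm (\<lambda>x. inverse (dst x) * \<psi> x) \<le> a * L2_norm (gradient \<psi>)"
  define X where "X = L2_norm (\<lambda>x. inverse (dst x) * \<psi> x)"
  note i = C1_c_facts[OF C1_c_layer[OF \<psi>]]
  have "x0 \<in> boundary_layer (- S) r"
    using C1_cD(3)[OF \<psi>] closure_subset[of "{x. \<psi> x \<noteq> 0}"] nz by auto
  then have "dst x0 > 0"
    using dst_pos boundary_layer_subset by auto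
  then have "(\<integral>x. (norm (inverse (dst x) * \<psi> x))\<^sup>2 \<partial>lborel) > 0"
    using nz by (intro integral_pos_continuous[where x = x0] continuous_intros i(1,2)) auto
  then have X: "X > 0"
    unfolding X_def L2_norm_def by simp
  have "(L2_norm (gradient \<psi>))\<^sup>2 \<le> k * X\<^sup>2"
    using le unfolding X_def L2_norm_sq by simp
  then have "(L2_norm (gradient \<psi>))\<^sup>2 \<le> (sqrt k * X)\<^sup>2"
    using k by (simp add: power_mult_distrib)
  then have "L2_norm (gradient \<psi>) \<le> sqrt k * X"
    by (rule power2_le_imp_le) (use k X in simp)
  then have "a * L2_norm (gradient \<psi>) \<le> a * (sqrt k * X)"
    using a by (intro mult_left_mono) auto
  moreover have "X \<le> a * L2_norm (gradient \<psi>)"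
    using H \<psi> unfolding X_def by blast
  ultimately have "1 * X \<le> (a * sqrt k) * X"
    by simp
  then have "1 \<le> a * sqrt k"
    using X by (rule mult_right_le_imp_le)
  then show "ereal (1 / sqrt k) \<le> ereal a"
    using k by (simp add: pos_divide_le_eq)
qed

text \<open>The intersection is nonempty and has dimension \<open>DIM('a) - 2\<close>; in dimension
  one this would be the dimension of the empty set.\<close>

lemma DIM_ge_2:
  fixes a c :: "'a::euclidean_space"
  assumes "norm a = 1" "norm c = 1" "(a \<bullet> c)\<^sup>2 < 1" "a \<bullet> p = b" "c \<bullet> p = d"
  shows "DIM('a) \<ge> 2"
proof -
  define X where "X = {x. a \<bullet> x = b} \<inter> {x. c \<bullet> x = d}"
  have "p \<in> X"
    unfolding X_def using assms by simp
  then have "aff_dim X \<noteq> -1"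
    using aff_dim_empty[of X] by auto
  moreover have "aff_dim X = int DIM('a) - 2"
    unfolding X_def by (rule aff_dim_edge[OF assms])
  moreover have "DIM('a) > 0"
    by simp
  ultimately show ?thesis
    by linarith
qed

context convex_body
begin

text \<open>The half-hyperplane through \<open>p\<close> in the supporting hyperplane of the first
  facet belongs to \<open>S\<close> near \<open>p\<close>, which bounds the distance from above. The
  small angle keeps \<open>S\<close> out of the support of the test function.\<close>

lemma hardy_a0_boundary_edge:
  assumes p: "p \<in> S" and r0: "r0 > 0"
    and a: "norm a = 1" "norm c = 1" "(a \<bullet> c)\<^sup>2 < 1" "a \<bullet> p = b" "c \<bullet> p = d"
    and Sa: "S \<subseteq> {x. a \<bullet> x \<le> b}" and Sc: "S \<subseteq> {x. c \<bullet> x \<le> d}"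
    and nb: "\<And>\<xi>. norm \<xi> < r0 \<Longrightarrow> a \<bullet> \<xi> = 0 \<Longrightarrow> c \<bullet> \<xi> \<le> 0 \<Longrightarrow> p + \<xi> \<in> S"
    and angle: "- (a \<bullet> c) > 1 - exp (- 102)"
  shows "2 < hardy_a0_boundary (- S)"
proof -
  define m where "m = real DIM('a) - 2"
  define t where "t = a \<bullet> c"
  define \<sigma> where "\<sigma> = sqrt (1 - t\<^sup>2)"
  \<comment> \<open>\<open>e1\<close> lies in the first supporting hyperplane and points away from
    \<open>S\<close>, and \<open>e2\<close> is its inner normal. In these coordinates
    \<open>S\<close> has x2 >= 0, and the facet near \<open>p\<close> is x2 = 0, x1 <= 0.\<close>
  define e1 where "e1 = (1 / \<sigma>) *\<^sub>R (c - t *\<^sub>R a)"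
  define e2 where "e2 = - a"
  define \<kappa> :: real where "\<kappa> = 1 / 4 - 1 / (5000 * (exp 102 + 2))"
  have aa: "a \<bullet> a = 1" "c \<bullet> c = 1" and ca: "c \<bullet> a = t"
    using a(1,2) by (simp_all add: dot_square_norm t_def inner_commute)
  have \<sigma>: "\<sigma> > 0" "\<sigma>\<^sup>2 = 1 - t\<^sup>2"
    using a(3) unfolding \<sigma>_def t_def by auto
  have f: "(c - t *\<^sub>R a) \<bullet> (c - t *\<^sub>R a) = \<sigma>\<^sup>2" "(c - t *\<^sub>R a) \<bullet> a = 0"
    unfolding \<sigma>(2) using aa ca
    by (simp_all add: inner_diff_left inner_diff_right t_def power2_eq_square)
  have fr: "e1 \<bullet> e1 = 1" "e2 \<bullet> e2 = 1" "e1 \<bullet> e2 = 0"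
    unfolding e1_def e2_def using f \<sigma>(1) aa by (simp_all add: power2_eq_square)
  have c_eq: "c = \<sigma> *\<^sub>R e1 + t *\<^sub>R a"
    unfolding e1_def using \<sigma> by simp
  have m: "m \<ge> 0"
  proof -
    have "DIM('a) \<ge> 2"
      by (rule DIM_ge_2[OF a])
    then show ?thesis
      unfolding m_def by simp
  qed
  have \<kappa>: "0 < \<kappa>" "\<kappa> < 1 / 4"
  proof -
    have "M > 0 \<Longrightarrow> 0 < 1 / 4 - 1 / (5000 * (M + 2))" "M > 0 \<Longrightarrow> 1 / 4 - 1 / (5000 * (M + 2)) < 1 / 4" for M :: real
      by (simp_all add: field_simps)
    then show "0 < \<kappa>" "\<kappa> < 1 / 4"
      unfolding \<kappa>_def using exp_gt_zero by blast+
  qed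
  have "ereal (1 / sqrt \<kappa>) \<le> hardy_a0 (- S) (boundary_layer (- S) r)" if r: "r > 0" for r
  proof -
    \<comment> \<open>\<open>q0\<close> is the ratio of \<open>Q\<close> to the squared radial scale
      that \<open>energy_bound\<close> requires, made positive by adding 1. The scale
      \<open>\<mu>\<close> then fits the support into the ball of radius \<open>R\<close> about
      \<open>p\<close>, inside the region where \<open>nb\<close> applies and within distance
      \<open>r\<close> of \<open>S\<close>.\<close>
    define q0 where "q0 = 20000 * (m * (m + 8)) * exp 500 / 3 + 1"
    define R where "R = min r r0 / 2"
    define \<mu> where "\<mu> = R / sqrt (exp 500 + q0)"
    define Q where "Q = \<mu>\<^sup>2 * q0"
    have q0: "q0 > 0"
      unfolding q0_def using m by (simp add: add_nonneg_pos)
    have R: "R > 0" "R < r" "R < r0"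
      unfolding R_def using r r0 by auto
    have \<mu>: "\<mu> > 0"
      unfolding \<mu>_def using R q0 by (simp add: add_pos_pos)
    have \<mu>R: "\<mu>\<^sup>2 * exp 500 + Q = R\<^sup>2"
    proof -
      have "exp 500 + q0 > 0"
        using q0 by (simp add: add_pos_pos)
      then have "\<mu>\<^sup>2 * (exp 500 + q0) = R\<^sup>2"
        unfolding \<mu>_def by (simp add: power_divide)
      then show ?thesis
        unfolding Q_def by (simp add: algebra_simps)
    qed
    interpret E: edge_frame p e1 e2 \<mu> Q
      by standard (use fr \<mu> q0 in \<open>auto simp: Q_def\<close>)
    have in_K: "norm (x - p) \<le> R" "E.s x > 0" "x \<notin> S" "dst x > 0"
      "(dst x)\<^sup>2 \<le> (E.x2 x)\<^sup>2 + (max 0 (E.x1 x))\<^sup>2" "x \<in> boundary_layer (- S) r" if x: "x \<in> E.K" for x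
    proof -
      have "(norm (x - p))\<^sup>2 \<le> R\<^sup>2"
        unfolding E.norm_diff_eq \<mu>R[symmetric] using x unfolding E.K_def by (intro add_mono) auto
      then show n: "norm (x - p) \<le> R"
        by (rule power2_le_imp_le) (use R in simp)
      show s: "E.s x > 0"
        by (rule E.K_pos[OF x])
      have x2: "E.x2 x = - (a \<bullet> (x - p))"
        unfolding E.x2_def by (simp add: e2_def inner_commute)
      have cx: "c \<bullet> (x - p) = \<sigma> * E.x1 x - t * E.x2 x"
        unfolding x2 E.x1_def by (subst c_eq) (simp add: inner_add_left inner_commute[of e1 "x - p"])
      \<comment> \<open>With \<phi> the polar angle, points of \<open>S\<close> satisfy cos \<phi>
        <= t, where t is minus the cosine of the dihedral angle. On \<open>K\<close> one has cos
        \<phi> = 2 y - 1 >= 2 exp(-102) - 1, while the hypothesis says t < exp(-102) - 1.\<close>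
      show nS: "x \<notin> S"
      proof
        assume "x \<in> S"
        then have "a \<bullet> (x - p) \<le> 0" "c \<bullet> (x - p) \<le> 0"
          using Sa Sc a(4,5) by (auto simp: inner_diff_right)
        then have 1: "E.x2 x \<ge> 0" "\<sigma> * E.x1 x \<le> t * E.x2 x"
          unfolding x2[symmetric] cx using x2 by auto
        have t0: "t < 0"
        proof -
          have "exp (- 102 :: real) < 1"
            by simp
          then show ?thesis
            using angle unfolding t_def by linarith
        qed
        then have "\<sigma> * E.x1 x \<le> 0"
          using 1 t0 mult_nonpos_nonneg[of t "E.x2 x"] by linarith
        then have x1: "E.x1 x \<le> 0"
          using \<sigma>(1) by (simp add: mult_le_0_iff)
        have "(- t * E.x2 x)\<^sup>2 \<le> (- \<sigma> * E.x1 x)\<^sup>2"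
          using 1 t0 by (intro power_mono) (auto simp: mult_nonpos_nonneg)
        then have "t\<^sup>2 * (E.x2 x)\<^sup>2 \<le> (1 - t\<^sup>2) * (E.x1 x)\<^sup>2"
          by (simp add: power_mult_distrib \<sigma>(2))
        then have "t\<^sup>2 * E.s x \<le> (E.x1 x)\<^sup>2"
          unfolding E.s_def by (simp add: algebra_simps)
        then have "(- t * sqrt (E.s x))\<^sup>2 \<le> (- E.x1 x)\<^sup>2"
          using s by (simp add: power_mult_distrib)
        then have "- t * sqrt (E.s x) \<le> - E.x1 x"
          by (rule power2_le_imp_le) (use x1 in simp)
        moreover have "(2 * exp (- 102) - 1) * sqrt (E.s x) \<le> E.x1 x"
          using x unfolding E.K_def by simp
        ultimately have "(2 * exp (- 102) - 1) * sqrt (E.s x) \<le> t * sqrt (E.s x)"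
          by linarith
        then have "2 * exp (- 102) - 1 \<le> t"
          using s by (simp add: mult_le_cancel_right)
        moreover have "exp (- 102 :: real) > 0"
          by simp
        ultimately show False
          using angle unfolding t_def by linarith
      qed
      show pos: "dst x > 0"
        by (rule dst_pos[OF nS])
      \<comment> \<open>\<open>p + \<xi>\<close> is the point of the half-hyperplane closest to
        \<open>x\<close>. It is no farther from \<open>p\<close> than \<open>x\<close>, so
        \<open>nb\<close> places it in \<open>S\<close>.\<close>
      define \<xi> where "\<xi> = E.z x + min 0 (E.x1 x) *\<^sub>R e1"
      have "a = - e2"
        unfolding e2_def by simp
      then have az: "a \<bullet> E.z x = 0" "a \<bullet> e1 = 0"
        using E.z_perp(2)[of x] fr(3) by (simp_all add: inner_commute)
      have "c \<bullet> \<xi> = \<sigma> * min 0 (E.x1 x)"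
        unfolding \<xi>_def using az E.z_perp(1)[of x] fr(1)
        by (subst c_eq) (simp add: inner_add_left inner_add_right inner_commute[of e1 "E.z x"])
      then have c\<xi>: "c \<bullet> \<xi> \<le> 0"
        using \<sigma>(1) by (simp add: mult_le_0_iff)
      have a\<xi>: "a \<bullet> \<xi> = 0"
        unfolding \<xi>_def using az by (simp add: inner_add_right)
      have "(norm \<xi>)\<^sup>2 = E.q x + (min 0 (E.x1 x))\<^sup>2"
        unfolding \<xi>_def power2_norm_eq_inner E.q_def using E.z_perp(1)[of x] fr(1)
        by (simp add: inner_add_left inner_add_right inner_commute[of e1 "E.z x"] power2_eq_square)
      also have "\<dots> \<le> E.q x + E.s x"
        unfolding E.s_def by (auto simp: min_def)
      also have "\<dots> = (norm (x - p))\<^sup>2"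
        unfolding E.norm_diff_eq by simp
      finally have "norm \<xi> \<le> norm (x - p)"
        by (rule power2_le_imp_le) simp
      then have "p + \<xi> \<in> S"
        using n R a\<xi> c\<xi> by (intro nb) auto
      then have "dst x \<le> dist x (p + \<xi>)"
        unfolding dst_eq[OF nS] by (rule infdist_le)
      moreover have "x - (p + \<xi>) = E.x2 x *\<^sub>R e2 + max 0 (E.x1 x) *\<^sub>R e1"
        unfolding \<xi>_def E.z_def E.rad_def by (cases "E.x1 x \<le> 0") (auto simp: algebra_simps)
      then have "(dist x (p + \<xi>))\<^sup>2 = (E.x2 x)\<^sup>2 + (max 0 (E.x1 x))\<^sup>2"
        unfolding dist_norm power2_norm_eq_inner using fr
        by (simp add: inner_add_left inner_add_right inner_commute[of e2 e1] power2_eq_square)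
      ultimately show "(dst x)\<^sup>2 \<le> (E.x2 x)\<^sup>2 + (max 0 (E.x1 x))\<^sup>2"
        using power_mono[of "dst x" "dist x (p + \<xi>)" 2] pos by simp
      have "dst x \<le> dist x p"
        unfolding dst_eq[OF nS] by (rule infdist_le[OF p])
      then show "x \<in> boundary_layer (- S) r"
        using n R nS unfolding boundary_layer_def dst_def[symmetric] by (simp add: dist_norm)
    qed
    have \<psi>: "E.psi \<in> C1_c (boundary_layer (- S) r)"
      by (rule C1_cI(1)[OF E.has_gradient_psi E.open_U E.compact_K E.K_subset_U])
        (use in_K(6) E.psi_outside in auto)
    show ?thesis
    proof (rule hardy_a0_layer_ge[OF \<psi> \<kappa>(1)])
      show "(\<integral>x. (norm (gradient E.psi x))\<^sup>2 \<partial>lborel) \<le> \<kappa> * (\<integral>x. (inverse (dst x) * E.psi x)\<^sup>2 \<partial>lborel)"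
        unfolding \<kappa>_def
      proof (rule E.energy_bound)
        show "20000 * ((real DIM('a) - 2) * (real DIM('a) - 2 + 8)) * (\<mu>\<^sup>2 * exp 500) \<le> 3 * Q"
        proof -
          have "3 * (u * (X * w / 3 + 1)) = X * (u * w) + 3 * u" for u X w :: real
            by (simp add: algebra_simps)
          then show ?thesis
            unfolding m_def[symmetric] Q_def q0_def by simp
        qed
        show "0 \<le> real DIM('a) - 2"
          using m unfolding m_def .
        show "dst x > 0 \<and> (dst x)\<^sup>2 \<le> (E.x2 x)\<^sup>2 + (max 0 (E.x1 x))\<^sup>2" if "x \<in> E.K" for x
          using in_K(4,5)[OF that] by simp
        show "integrable lborel (\<lambda>x. (inverse (dst x) * E.psi x)\<^sup>2)"
          using C1_c_facts(2)[OF C1_c_layer[OF \<psi>]] by simp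
      qed
      \<comment> \<open>Here \<open>y\<close> is 1 and both cutoffs equal 1, so \<open>psi\<close>
        is \<open>(ell 1)\<^sup>2\<close>.\<close>
      define x0 where "x0 = p + \<mu> *\<^sub>R e1"
      have "E.x1 x0 = \<mu>" "E.x2 x0 = 0"
        unfolding E.x1_def E.x2_def x0_def using fr by simp_all
      moreover from this have "E.s x0 = \<mu>\<^sup>2" "E.z x0 = 0"
        unfolding E.s_def E.z_def E.rad_def by (simp_all add: x0_def)
      ultimately have "E.y x0 = 1" "E.s x0 = \<mu>\<^sup>2" "E.q x0 = 0"
        unfolding E.y_def E.q_def using \<mu> by simp_all
      then have "E.psi x0 = 102\<^sup>2"
        unfolding E.psi_def theta_def ell_def E.rho_def gam_def E.om_def using \<mu> by simp
      then show "E.psi x0 \<noteq> 0"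
        by simp
    qed
  qed
  then have "ereal (1 / sqrt \<kappa>) \<le> hardy_a0_boundary (- S)"
    unfolding hardy_a0_boundary_def by (intro INF_greatest) auto
  moreover have "sqrt \<kappa> < 1 / 2"
    using \<kappa> real_sqrt_less_mono[of \<kappa> "1 / 4"] by (simp add: real_sqrt_divide)
  then have "2 < 1 / sqrt \<kappa>"
    using \<kappa> by (simp add: field_simps)
  then have "ereal 2 < ereal (1 / sqrt \<kappa>)"
    by (simp only: less_ereal.simps)
  then have "(2::ereal) < ereal (1 / sqrt \<kappa>)"
    by simp
  ultimately show ?thesis
    by (rule less_le_trans[rotated])
qed

end

section \<open>Polytopes\<close>

lemma polytope_convex_body:
  fixes S :: "'a::euclidean_space set"
  assumes "polytope S" "aff_dim S = int DIM('a)"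
  shows "convex_body S"
  using assms by unfold_locales (auto simp: polytope_imp_convex polytope_imp_closed)

lemma facets_dihedral_angle:
  fixes S :: "'a::euclidean_space set"
  assumes S: "polytope S" "aff_dim S = int DIM('a)" and F: "F facet_of S" "G facet_of S" "F \<noteq> G"
    and a: "norm a = 1" "S \<subseteq> {x. a \<bullet> x \<le> b}" "F = S \<inter> {x. a \<bullet> x = b}" "affine hull F = {x. a \<bullet> x = b}"
    and c: "norm c = 1" "S \<subseteq> {x. c \<bullet> x \<le> d}" "G = S \<inter> {x. c \<bullet> x = d}" "affine hull G = {x. c \<bullet> x = d}"
    and ang: "dihedral_angle S (affine hull F) (affine hull G) \<alpha>"
  shows "\<alpha> = arccos (- (a \<bullet> c))" "(a \<bullet> c)\<^sup>2 < 1"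
    "\<exists>p. a \<bullet> p = b \<and> c \<bullet> p = d"
proof -
  have ne: "{x. a \<bullet> x = b} \<noteq> {x. c \<bullet> x = d}"
    using F(3) a(3) c(3) by auto
  show "\<alpha> = arccos (- (a \<bullet> c))" "(a \<bullet> c)\<^sup>2 < 1"
    using dihedral_angle_eq[OF a(1) c(1) a(2) c(2) ne] ang unfolding a(4) c(4) by auto
  show "\<exists>p. a \<bullet> p = b \<and> c \<bullet> p = d"
    using ang unfolding dihedral_angle_def a(4) c(4) by auto
qed

lemma hardy_sharp_edge:
  fixes S :: "'a::euclidean_space set"
  assumes S: "polytope S" "aff_dim S = int DIM('a)" and F: "F facet_of S" "G facet_of S" "F \<noteq> G"
    and dim: "aff_dim (F \<inter> G) = int DIM('a) - 2"
    and ang: "dihedral_angle S (affine hull F) (affine hull G) \<alpha>" "\<alpha> < crit_angle"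
  shows "2 < hardy_a0_boundary (- S)"
proof -
  interpret convex_body S
    by (rule polytope_convex_body[OF S])
  obtain a b where a: "norm a = 1" "S \<subseteq> {x. a \<bullet> x \<le> b}" "F = S \<inter> {x. a \<bullet> x = b}" "affine hull F = {x. a \<bullet> x = b}"
    using facet_halfspace[OF S F(1)] .
  obtain c d where c: "norm c = 1" "S \<subseteq> {x. c \<bullet> x \<le> d}" "G = S \<inter> {x. c \<bullet> x = d}" "affine hull G = {x. c \<bullet> x = d}"
    using facet_halfspace[OF S F(2)] .
  note d = facets_dihedral_angle[OF S F a c ang(1)]
  obtain p0 where p0: "a \<bullet> p0 = b" "c \<bullet> p0 = d"
    using d(3) by blast
  have D2: "DIM('a) \<ge> 2"
    by (rule DIM_ge_2[OF a(1) c(1) d(2) p0])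
  obtain p r where p: "r > 0" "a \<bullet> p = b" "c \<bullet> p = d" "p \<in> S"
    "\<And>\<xi>. norm \<xi> < r \<Longrightarrow> a \<bullet> \<xi> = 0 \<Longrightarrow> c \<bullet> \<xi> \<le> 0 \<Longrightarrow> p + \<xi> \<in> S"
    using edge_neighbourhood[OF convex a(1) c(1) d(2) c(2) a(3,4) c(3) dim D2] by metis
  have "\<bar>- (a \<bullet> c)\<bar> \<le> 1"
    using Cauchy_Schwarz_ineq2[of a c] a(1) c(1) by simp
  moreover have "\<bar>1 - exp (- 102 :: real)\<bar> \<le> 1"
    by simp
  ultimately have "- (a \<bullet> c) > 1 - exp (- 102)"
    using ang(2) arccos_less_mono unfolding d(1) crit_angle_def by blast
  from hardy_a0_boundary_edge[OF p(4,1) a(1) c(1) d(2) p(2,3) a(2) c(2) p(5) this]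
  show ?thesis .
qed

text \<open>A pair of facets determines its angle through the outer normals, and a polytope has
  finitely many facets. Distinct hyperplanes that intersect have normals with inner product strictly
  between -1 and 1, so the arccosine is positive.\<close>

lemma dihedral_angles_finite_pos:
  fixes S :: "'a::euclidean_space set"
  assumes S: "polytope S" "aff_dim S = int DIM('a)"
  defines "A \<equiv> {\<alpha>. \<exists>F G. F facet_of S \<and> G facet_of S \<and> F \<noteq> G \<and> dihedral_angle S (affine hull F) (affine hull G) \<alpha>}"
  shows "finite A" "\<And>\<alpha>. \<alpha> \<in> A \<Longrightarrow> \<alpha> > 0"
proof -
  define P where "P F a b \<longleftrightarrow> norm a = 1 \<and> S \<subseteq> {x. a \<bullet> x \<le> b} \<and> F = S \<inter> {x. a \<bullet> x = b} \<and> affine hull F = {x. a \<bullet> x = b}"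
    for F :: "'a set" and a b
  have "\<exists>a b. P F a b" if "F facet_of S" for F
    using facet_halfspace[OF S that] unfolding P_def by metis
  then obtain n h where P: "P F (n F) (h F)" if "F facet_of S" for F
    by metis
  have eq: "\<alpha> = arccos (- (n F \<bullet> n G))" "(n F \<bullet> n G)\<^sup>2 < 1"
    if "F facet_of S" "G facet_of S" "F \<noteq> G" "dihedral_angle S (affine hull F) (affine hull G) \<alpha>" for F G \<alpha>
    using facets_dihedral_angle[OF S that(1-3) _ _ _ _ _ _ _ _ that(4)] P[OF that(1)] P[OF that(2)]
    unfolding P_def by blast+
  have "A \<subseteq> (\<lambda>(F, G). arccos (- (n F \<bullet> n G))) ` ({F. F facet_of S} \<times> {F. F facet_of S})"
    unfolding A_def using eq(1) by fastforce
  then show "finite A"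
    by (rule finite_subset) (intro finite_imageI finite_cartesian_product finite_polytope_facets[OF S(1)])
  fix \<alpha> assume "\<alpha> \<in> A"
  then obtain F G where FG: "\<alpha> = arccos (- (n F \<bullet> n G))" "(n F \<bullet> n G)\<^sup>2 < 1"
    unfolding A_def using eq by blast
  then have "\<bar>n F \<bullet> n G\<bar> < 1"
    by (simp add: abs_square_less_1)
  then show "\<alpha> > 0"
    unfolding FG(1) using arccos_less_mono[of 1 "- (n F \<bullet> n G)"] by simp
qed

text \<open>A threshold common to all polytopes needs a genuine edge of \<open>S\<close>, where the
  test functions are placed; the hyperplanes of two facets that are not adjacent may meet away from
  \<open>S\<close>. For arbitrary pairs the threshold depends on the polytope.\<close>

theorem proposition6p2:
  shows
    "(\<exists>\<alpha>\<^sub>c::real. 0 < \<alpha>\<^sub>c \<and> \<alpha>\<^sub>c < pi \<and>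
        (\<forall>S :: 'a::euclidean_space set. polytope S \<and> aff_dim S = int DIM('a) \<longrightarrow>
          (\<exists>F G \<alpha>. F facet_of S \<and> G facet_of S \<and> F \<noteq> G \<and> aff_dim (F \<inter> G) = int DIM('a) - 2 \<and>
             dihedral_angle S (affine hull F) (affine hull G) \<alpha> \<and> \<alpha> < \<alpha>\<^sub>c) \<longrightarrow>
          hardy_a0_boundary (- S) = hardy_b0_boundary (- S) \<and>
          hardy_b0_boundary (- S) = hardy_b0 (- S) (- S) \<and>
          hardy_b0 (- S) (- S) > 2))
     \<and>
     (\<forall>S :: 'a set. polytope S \<and> aff_dim S = int DIM('a) \<longrightarrow>
        (\<exists>\<alpha>\<^sub>c::real. 0 < \<alpha>\<^sub>c \<and> \<alpha>\<^sub>c < pi \<and>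
          ((\<exists>F G \<alpha>. F facet_of S \<and> G facet_of S \<and> F \<noteq> G \<and>
             dihedral_angle S (affine hull F) (affine hull G) \<alpha> \<and> \<alpha> < \<alpha>\<^sub>c) \<longrightarrow>
          hardy_a0_boundary (- S) = hardy_b0_boundary (- S) \<and>
          hardy_b0_boundary (- S) = hardy_b0 (- S) (- S) \<and>
          hardy_b0 (- S) (- S) > 2)))"
proof (intro conjI allI impI)
  show "\<exists>\<alpha>\<^sub>c::real. 0 < \<alpha>\<^sub>c \<and> \<alpha>\<^sub>c < pi \<and>
        (\<forall>S :: 'a set. polytope S \<and> aff_dim S = int DIM('a) \<longrightarrow>
          (\<exists>F G \<alpha>. F facet_of S \<and> G facet_of S \<and> F \<noteq> G \<and> aff_dim (F \<inter> G) = int DIM('a) - 2 \<and>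
             dihedral_angle S (affine hull F) (affine hull G) \<alpha> \<and> \<alpha> < \<alpha>\<^sub>c) \<longrightarrow>
          hardy_a0_boundary (- S) = hardy_b0_boundary (- S) \<and>
          hardy_b0_boundary (- S) = hardy_b0 (- S) (- S) \<and>
          hardy_b0 (- S) (- S) > 2)"
  proof (rule exI[of _ crit_angle], rule conjI[OF crit_angle_bounds(1)], rule conjI[OF crit_angle_bounds(2)], intro allI impI)
    fix S :: "'a set"
    assume S: "polytope S \<and> aff_dim S = int DIM('a)"
      and sharp: "\<exists>F G \<alpha>. F facet_of S \<and> G facet_of S \<and> F \<noteq> G \<and> aff_dim (F \<inter> G) = int DIM('a) - 2 \<and>
             dihedral_angle S (affine hull F) (affine hull G) \<alpha> \<and> \<alpha> < crit_angle"
    have "2 < hardy_a0_boundary (- S)"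
      using sharp hardy_sharp_edge S by blast
    then show "hardy_a0_boundary (- S) = hardy_b0_boundary (- S) \<and>
          hardy_b0_boundary (- S) = hardy_b0 (- S) (- S) \<and>
          hardy_b0 (- S) (- S) > 2"
      using convex_body.hardy_constants_eq[OF polytope_convex_body] S by metis
  qed
next
  fix S :: "'a set"
  assume S: "polytope S \<and> aff_dim S = int DIM('a)"
  define A where "A = {\<alpha>. \<exists>F G. F facet_of S \<and> G facet_of S \<and> F \<noteq> G \<and> dihedral_angle S (affine hull F) (affine hull G) \<alpha>}"
  have A: "finite A" "\<And>\<alpha>. \<alpha> \<in> A \<Longrightarrow> \<alpha> > 0"
    using dihedral_angles_finite_pos S unfolding A_def by blast+
  \<comment> \<open>No dihedral angle of this polytope lies below the minimum, so the premise of the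
    implication is never satisfied and the implication holds vacuously. Including
    \<open>pi / 2\<close> keeps the set nonempty and the threshold below \<open>pi\<close>.\<close>
  define \<alpha>\<^sub>c where "\<alpha>\<^sub>c = Min (insert (pi / 2) A)"
  have "0 < \<alpha>\<^sub>c"
    unfolding \<alpha>\<^sub>c_def using A by (subst Min_gr_iff) auto
  moreover have "\<alpha>\<^sub>c \<le> pi / 2"
    unfolding \<alpha>\<^sub>c_def using A(1) by (intro Min_le) auto
  then have "\<alpha>\<^sub>c < pi"
    using pi_gt_zero by linarith
  moreover have "\<not> (\<exists>F G \<alpha>. F facet_of S \<and> G facet_of S \<and> F \<noteq> G \<and>
             dihedral_angle S (affine hull F) (affine hull G) \<alpha> \<and> \<alpha> < \<alpha>\<^sub>c)"
  proof (intro notI, elim exE conjE)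
    fix F G \<alpha>
    assume "F facet_of S" "G facet_of S" "F \<noteq> G"
      "dihedral_angle S (affine hull F) (affine hull G) \<alpha>" "\<alpha> < \<alpha>\<^sub>c"
    then have "\<alpha> \<in> A"
      unfolding A_def by blast
    then have "\<alpha>\<^sub>c \<le> \<alpha>"
      unfolding \<alpha>\<^sub>c_def using A(1) by (intro Min_le) auto
    then show False
      using \<open>\<alpha> < \<alpha>\<^sub>c\<close> by simp
  qed
  ultimately show "\<exists>\<alpha>\<^sub>c::real. 0 < \<alpha>\<^sub>c \<and> \<alpha>\<^sub>c < pi \<and>
          ((\<exists>F G \<alpha>. F facet_of S \<and> G facet_of S \<and> F \<noteq> G \<and>
             dihedral_angle S (affine hull F) (affine hull G) \<alpha> \<and> \<alpha> < \<alpha>\<^sub>c) \<longrightarrow>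
          hardy_a0_boundary (- S) = hardy_b0_boundary (- S) \<and>
          hardy_b0_boundary (- S) = hardy_b0 (- S) (- S) \<and>
          hardy_b0 (- S) (- S) > 2)"
    by blast
qed

end
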